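(* Let $\Omega\subset\mathbb{R}^n$ be open and let $P(D)=\sum_{|\gamma|\le m}a_\gamma D^\gamma$ be a partial differential operator with constant generalized coefficients $a_\gamma\in\widetilde{\mathbb{C}}$. Assume that $P(D)$ is WH-elliptic with radius $(r_\varepsilon)_\varepsilon$ which is a slow scale net. Let $f\in\mathcal{G}^\infty(\Omega)$ and let $u\in\mathcal{G}(\Omega)$ be a solution of $P(D)u=f$ in $\mathcal{G}(\Omega)$. Then $u\in\mathcal{G}^\infty(\Omega)$.
   Context: Colombeau algebra: for $\Omega\subset\mathbb{R}^n$ open, $\mathcal{E}_{\mathrm M}(\Omega)$ is the set of nets $(u_\varepsilon)_{\varepsilon\in(0,1]}$ of functions in $C^\infty(\Omega)$ (complex valued) such that for every compact $K\subset\Omega$ and every $\alpha\in\mathbb{N}_0^n$ there is $p\ge0$ with $\sup_{x\in K}|\partial^\alpha u_\varepsilon(x)|=O(\varepsilon^{-p})$ as $\varepsilon\to0$. $\mathcal{N}(\Omega)$ is the set of nets such that for all such $K,\alpha$ and all $q\ge0$, $\sup_{x\in K}|\partial^\alpha u_\varepsilon(x)|=O(\varepsilon^{q})$. $\mathcal{G}(\Omega)=\mathcal{E}_{\mathrm M}(\Omega)/\mathcal{N}(\Omega)$ is a differential algebra with operations defined on representatives. $\mathcal{G}^\infty(\Omega)$ is the subalgebra of elements having a representative such that for every compact $K\subset\Omega$ there is $p\ge0$ such that for all $\alpha\in\mathbb{N}_0^n$, $\sup_{x\in K}|\partial^\alpha u_\varepsilon(x)|=O(\varepsilon^{-p})$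 (i.e. $p$ is independent of $\alpha$). $\widetilde{\mathbb{C}}$ is the ring of generalized numbers: nets $(c_\varepsilon)_{\varepsilon\in(0,1]}$ in $\mathbb{C}$ with $|c_\varepsilon|=O(\varepsilon^{-p})$ for some $p\ge 0$, modulo nets with $|c_\varepsilon|=O(\varepsilon^q)$ for all $q\ge 0$. $D=(-i\partial_1,\dots,-i\partial_n)$. Choosing representatives $(a_{\gamma\varepsilon})_\varepsilon$ of the coefficients, put $P_\varepsilon(\xi)=\sum_{|\gamma|\le m}a_{\gamma\varepsilon}\xi^\gamma$; $P(D)u$ is the class of $(P_\varepsilon(D)u_\varepsilon)_\varepsilon$. WH-elliptic with radius $(r_\varepsilon)_\varepsilon$ (constant coefficient case): there are $N>0$, $\varepsilon_0>0$ and $r_\varepsilon>0$ for $\varepsilon\in(0,\varepsilon_0)$ such that $|P_\varepsilon(\xi)|\ge\varepsilon^N(1+|\xi|)^m$ for all $\varepsilon\in(0,\varepsilon_0)$ and all $\xi\in\mathbb{R}^n$ with $|\xi|\ge r_\varepsilon$, and for every $\alpha\in\mathbb{N}_0^n$ there is $C_\alpha>0$ such that $|\partial^\alpha P_\varepsilon(\xi)|\le C_\alpha|P_\varepsilon(\xi)|(1+|\xi|)^{-|\alpha|}$ for all $\varepsilon\in(0,\varepsilon_0)$ and all $|\xi|\ge r_\varepsilon$. Slow scale net: a net $(r_\varepsilon)_\varepsilon$ of numbers such that for every $t\ge0$, $|r_\varepsilon|^t=O(1/\varepsilon)$ as $\varepsilon\to0$. *)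

theory Defs
  imports "HOL-Analysis.Analysis" "HOL-Library.Landau_Symbols"
begin

subsection \<open>Partial derivatives and smooth functions\<close>

type_synonym 'n multiindex = "'n \<Rightarrow> nat"

definition mi_order :: "'n::finite multiindex \<Rightarrow> nat" where
  "mi_order \<alpha> = (\<Sum>i\<in>UNIV. \<alpha> i)"

definition partial :: "'n::finite \<Rightarrow> (real ^ 'n \<Rightarrow> complex) \<Rightarrow> real ^ 'n \<Rightarrow> complex" where
  "partial i f = (\<lambda>x. frechet_derivative f (at x) (axis i 1))"

(* The list fixes an order in which the coordinate derivatives are taken; on an open set on which
   f is smooth the result does not depend on it. *)
definition mderiv :: "'n::finite multiindex \<Rightarrow> (real ^ 'n \<Rightarrow> complex) \<Rightarrow> real ^ 'n \<Rightarrow> complex" where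
  "mderiv \<alpha> f = fold (\<lambda>i. partial i ^^ \<alpha> i) (SOME is. distinct is \<and> set is = UNIV) f"

(* Values of f outside Omega are irrelevant, since derivatives are only evaluated at points of
   the open set Omega. *)
definition smooth_on :: "(real ^ 'n::finite) set \<Rightarrow> (real ^ 'n \<Rightarrow> complex) \<Rightarrow> bool" where
  "smooth_on \<Omega> f \<longleftrightarrow> (\<forall>is. \<forall>x\<in>\<Omega>. fold partial is f differentiable (at x))"


subsection \<open>Colombeau algebras\<close>

text \<open>Nets indexed by \<open>(0,1]\<close> are functions on all of \<open>real\<close>. Values at other parameters are never
  constrained, so nets that agree on \<open>(0,1]\<close> are identified in the quotients below; likewise for
  functions that agree on \<open>\<Omega>\<close>.\<close>

type_synonym 'n fun_net = "real \<Rightarrow> real ^ 'n \<Rightarrow> complex"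

definition sup_on :: "(real ^ 'n) set \<Rightarrow> (real ^ 'n \<Rightarrow> complex) \<Rightarrow> real" where
  "sup_on K g = (SUP x\<in>K. norm (g x))"

(* The empty compact set, over which the supremum would be an unspecified real, carries no
   condition and is left out. *)
definition compacts_in :: "(real ^ 'n::finite) set \<Rightarrow> (real ^ 'n) set set" where
  "compacts_in \<Omega> = {K. compact K \<and> K \<subseteq> \<Omega> \<and> K \<noteq> {}}"

definition smooth_nets :: "(real ^ 'n::finite) set \<Rightarrow> 'n fun_net set" where
  "smooth_nets \<Omega> = {u. \<forall>\<epsilon>\<in>{0<..1}. smooth_on \<Omega> (u \<epsilon>)}"

definition moderate_nets :: "(real ^ 'n::finite) set \<Rightarrow> 'n fun_net set" where
  "moderate_nets \<Omega> = {u \<in> smooth_nets \<Omega>. \<forall>K\<in>compacts_in \<Omega>. \<forall>\<alpha>. \<exists>p\<ge>0.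
     (\<lambda>\<epsilon>. sup_on K (mderiv \<alpha> (u \<epsilon>))) \<in> O[at_right 0](\<lambda>\<epsilon>. \<epsilon> powr (- p))}"

definition negligible_nets :: "(real ^ 'n::finite) set \<Rightarrow> 'n fun_net set" where
  "negligible_nets \<Omega> = {u \<in> smooth_nets \<Omega>. \<forall>K\<in>compacts_in \<Omega>. \<forall>\<alpha>. \<forall>q\<ge>0.
     (\<lambda>\<epsilon>. sup_on K (mderiv \<alpha> (u \<epsilon>))) \<in> O[at_right 0](\<lambda>\<epsilon>. \<epsilon> powr q)}"

definition colombeau_rel :: "(real ^ 'n::finite) set \<Rightarrow> ('n fun_net \<times> 'n fun_net) set" where
  "colombeau_rel \<Omega> = {(u, v). u \<in> moderate_nets \<Omega> \<and> v \<in> moderate_nets \<Omega> \<and>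
     (\<lambda>\<epsilon> x. u \<epsilon> x - v \<epsilon> x) \<in> negligible_nets \<Omega>}"

definition colombeau :: "(real ^ 'n::finite) set \<Rightarrow> 'n fun_net set set" where
  "colombeau \<Omega> = moderate_nets \<Omega> // colombeau_rel \<Omega>"

definition regular_nets :: "(real ^ 'n::finite) set \<Rightarrow> 'n fun_net set" where
  "regular_nets \<Omega> = {u \<in> moderate_nets \<Omega>. \<forall>K\<in>compacts_in \<Omega>. \<exists>p\<ge>0. \<forall>\<alpha>.
     (\<lambda>\<epsilon>. sup_on K (mderiv \<alpha> (u \<epsilon>))) \<in> O[at_right 0](\<lambda>\<epsilon>. \<epsilon> powr (- p))}"

definition colombeau_regular :: "(real ^ 'n::finite) set \<Rightarrow> 'n fun_net set set" where
  "colombeau_regular \<Omega> = {U \<in> colombeau \<Omega>. \<exists>u\<in>U. u \<in> regular_nets \<Omega>}"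


subsection \<open>Generalized numbers\<close>

definition moderate_numbers :: "(real \<Rightarrow> complex) set" where
  "moderate_numbers = {c. \<exists>p\<ge>0. (\<lambda>\<epsilon>. norm (c \<epsilon>)) \<in> O[at_right 0](\<lambda>\<epsilon>. \<epsilon> powr (- p))}"

definition negligible_numbers :: "(real \<Rightarrow> complex) set" where
  "negligible_numbers = {c. \<forall>q\<ge>0. (\<lambda>\<epsilon>. norm (c \<epsilon>)) \<in> O[at_right 0](\<lambda>\<epsilon>. \<epsilon> powr q)}"

definition gen_complex_rel :: "((real \<Rightarrow> complex) \<times> (real \<Rightarrow> complex)) set" where
  "gen_complex_rel = {(c, d). c \<in> moderate_numbers \<and> d \<in> moderate_numbers \<and>
     (\<lambda>\<epsilon>. c \<epsilon> - d \<epsilon>) \<in> negligible_numbers}"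

definition gen_complex :: "(real \<Rightarrow> complex) set set" where
  "gen_complex = moderate_numbers // gen_complex_rel"

definition slow_scale :: "(real \<Rightarrow> real) \<Rightarrow> bool" where
  "slow_scale r \<longleftrightarrow> (\<forall>t\<ge>0. (\<lambda>\<epsilon>. \<bar>r \<epsilon>\<bar> powr t) \<in> O[at_right 0](\<lambda>\<epsilon>. 1 / \<epsilon>))"


subsection \<open>Operators with constant generalized coefficients\<close>

definition monomial :: "'n::finite multiindex \<Rightarrow> real ^ 'n \<Rightarrow> real" where
  "monomial \<gamma> \<xi> = (\<Prod>i\<in>UNIV. (\<xi> $ i) ^ \<gamma> i)"

definition symbol_net ::
    "nat \<Rightarrow> ('n::finite multiindex \<Rightarrow> real \<Rightarrow> complex) \<Rightarrow> 'n fun_net" where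
  "symbol_net m a \<epsilon> \<xi> = (\<Sum>\<gamma> | mi_order \<gamma> \<le> m. a \<gamma> \<epsilon> * complex_of_real (monomial \<gamma> \<xi>))"

(* The factor (-i)^|gamma| comes from D = -i * partial. *)
definition pdo_net ::
    "nat \<Rightarrow> ('n::finite multiindex \<Rightarrow> real \<Rightarrow> complex) \<Rightarrow> 'n fun_net \<Rightarrow> 'n fun_net" where
  "pdo_net m a u \<epsilon> x =
     (\<Sum>\<gamma> | mi_order \<gamma> \<le> m. a \<gamma> \<epsilon> * ((- \<i>) ^ mi_order \<gamma> * mderiv \<gamma> (u \<epsilon>) x))"

definition coeff_reps ::
    "nat \<Rightarrow> ('n::finite multiindex \<Rightarrow> (real \<Rightarrow> complex) set) \<Rightarrow>
     ('n multiindex \<Rightarrow> real \<Rightarrow> complex) set" where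
  "coeff_reps m A = {a. \<forall>\<gamma>. mi_order \<gamma> \<le> m \<longrightarrow> a \<gamma> \<in> A \<gamma>}"

(* The class of pdo_net m a u, written as a union over all representatives a of the coefficients
   and u of U, in the style of Equiv_Relations; the class does not depend on a and u. *)
definition gen_pdo ::
    "(real ^ 'n::finite) set \<Rightarrow> nat \<Rightarrow> ('n multiindex \<Rightarrow> (real \<Rightarrow> complex) set) \<Rightarrow>
     'n fun_net set \<Rightarrow> 'n fun_net set" where
  "gen_pdo \<Omega> m A U = (\<Union>a\<in>coeff_reps m A. \<Union>u\<in>U. colombeau_rel \<Omega> `` {pdo_net m a u})"

definition WH_elliptic_net ::
    "nat \<Rightarrow> ('n::finite multiindex \<Rightarrow> real \<Rightarrow> complex) \<Rightarrow> (real \<Rightarrow> real) \<Rightarrow> bool" where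
  "WH_elliptic_net m a r \<longleftrightarrow>
     (\<exists>N>0. \<exists>\<epsilon>\<^sub>0>0. \<epsilon>\<^sub>0 \<le> 1 \<and>
        (\<forall>\<epsilon>\<in>{0<..<\<epsilon>\<^sub>0}. r \<epsilon> > 0) \<and>
        (\<forall>\<epsilon>\<in>{0<..<\<epsilon>\<^sub>0}. \<forall>\<xi>. norm \<xi> \<ge> r \<epsilon> \<longrightarrow>
           norm (symbol_net m a \<epsilon> \<xi>) \<ge> \<epsilon> powr N * (1 + norm \<xi>) ^ m) \<and>
        (\<forall>\<alpha>. \<exists>C>0. \<forall>\<epsilon>\<in>{0<..<\<epsilon>\<^sub>0}. \<forall>\<xi>. norm \<xi> \<ge> r \<epsilon> \<longrightarrow>
           norm (mderiv \<alpha> (symbol_net m a \<epsilon>) \<xi>)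
             \<le> C * norm (symbol_net m a \<epsilon> \<xi>) * (1 + norm \<xi>) powr (- real (mi_order \<alpha>))))"

(* The condition on representatives is invariant under negligible perturbations of the
   coefficients (after shrinking the parameter bound), so asking for one choice is the same as
   asking for all. *)
definition WH_elliptic ::
    "nat \<Rightarrow> ('n::finite multiindex \<Rightarrow> (real \<Rightarrow> complex) set) \<Rightarrow> (real \<Rightarrow> real) \<Rightarrow> bool" where
  "WH_elliptic m A r \<longleftrightarrow> (\<exists>a\<in>coeff_reps m A. WH_elliptic_net m a r)"

end

(* The proof replaces the Fourier transform by Fourier coefficients on the lattice Z^n, which are
   available for functions supported in a ball of radius less than 1.  Multiplying u by a cutoff
   turns P(D) into multiplication by P(k), up to the commutator with the cutoff.  The gradient bound
   |grad P| <= C |P| / (1 + |xi|), valid for |xi| >= r, lets the commutator gain one power of |k|;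
   lattice points with |k| of the size of r lose only a power of r, which the slow scale condition
   bounds by C / eps, whatever the power.  Iterating with a sequence of nested cutoffs gives decay
   of the coefficients of any order with one and the same power of eps, hence bounds for all
   derivatives of u with that power.  The passage from coefficients back to functions uses the
   trigonometric kernels prod_i ((1 + cos x_i) / 2)^M in place of Fourier inversion. *)

theory Submission
  imports Defs
begin

section \<open>Smooth functions and cutoffs\<close>

text \<open>The obstacle is that the exponent of \<epsilon> must not grow with the number of
  iterations. Two choices prevent this. The induction bounds the product of the symbol with the
  coefficient of the localised \<open>u\<close>, so the lower bound \<open>\<epsilon> powr N\<close>
  from ellipticity is paid once, after the induction. And in the commutator sum only the terms near
  the diagonal use the previous bound, with a constant free of \<epsilon>; all other terms are
  estimated anew from the moderate bounds of the symbol and of \<open>u\<close>, at the price of a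
  single factor 1/\<epsilon>. Such losses are never compounded, and the maximum of
  \<open>M + p0 + 1\<close> and \<open>pf\<close> serves at every stage. The radius bound 1 comes
  from the kernels: two points of the ball differ by at most 2 < pi in each coordinate, and there a
  kernel factor attains the value 1 only at the origin. So integrals over the whole space can stand
  for integrals over a period cell, and no function has to be extended periodically.\<close>

lemma partial_eqI: "(f has_derivative f') (at x) \<Longrightarrow> partial i f x = f' (axis i 1)"
  unfolding partial_def using frechet_derivative_at by metis

lemma has_derivative_partial:
  "f differentiable (at x) \<Longrightarrow> (f has_derivative frechet_derivative f (at x)) (at x)"
  using frechet_derivative_works by blast

lemma differentiable_cong_open:
  assumes "open S" "x \<in> S" "\<And>y. y \<in> S \<Longrightarrow> f y = g y" "g differentiable (at x)"
  shows "f differentiable (at x)"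
  using assms has_derivative_transform_within_open unfolding differentiable_def by metis

text \<open>\<open>frechet_derivative\<close> is a choice among all derivatives. Both functions
  admit the same derivatives at a point of the open set, so the choices agree, and no
  differentiability has to be assumed.\<close>

lemma partial_cong_open:
  assumes "open S" "x \<in> S" "\<And>y. y \<in> S \<Longrightarrow> f y = g y"
  shows "partial i f x = partial i g x"
proof -
  have "(f has_derivative D) (at x) \<longleftrightarrow> (g has_derivative D) (at x)" for D
    using has_derivative_transform_within_open[OF _ assms(1,2)] assms(3) by metis
  then show ?thesis unfolding partial_def frechet_derivative_def by simp
qed

lemma fold_partial_cong_open:
  assumes "open S" "\<And>y. y \<in> S \<Longrightarrow> f y = g y" "x \<in> S"
  shows "fold partial is f x = fold partial is g x"
  using assms(2,3)
proof (induction "is" arbitrary: f g)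
  case Nil
  then show ?case by simp
next
  case (Cons i "is")
  have "partial i f y = partial i g y" if "y \<in> S" for y
    by (rule partial_cong_open[OF assms(1) that Cons.prems(1)])
  from Cons.IH[OF this Cons.prems(2)] show ?case by simp
qed

text \<open>The power of each \<open>partial i\<close> becomes a block of equal entries in one list.
  The existential hides the arbitrary coordinate order in \<open>mderiv\<close>; facts proved for
  all lists by induction then carry over to multi-indices.\<close>

lemma mderiv_eq_fold: "\<exists>is. \<forall>f. mderiv \<alpha> f = fold partial is f"
proof -
  have "\<exists>is. \<forall>f. fold (\<lambda>i. partial i ^^ \<alpha> i) L f = fold partial is f" for L
  proof (induction L)
    case (Cons i L)
    then obtain "is" where "\<forall>f. fold (\<lambda>i. partial i ^^ \<alpha> i) L f = fold partial is f" by blast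
    then have "\<forall>f. fold (\<lambda>i. partial i ^^ \<alpha> i) (i#L) f = fold partial (replicate (\<alpha> i) i @ is) f"
      by (simp add: fold_replicate)
    then show ?case by blast
  qed (auto intro: exI[of _ "[]"])
  then show ?thesis unfolding mderiv_def by blast
qed

lemma mderiv_cong_open:
  assumes "open S" "\<And>y. y \<in> S \<Longrightarrow> f y = g y" "x \<in> S"
  shows "mderiv \<alpha> f x = mderiv \<alpha> g x"
proof -
  obtain "is" where "\<And>h. mderiv \<alpha> h = fold partial is h" using mderiv_eq_fold[of \<alpha>] by blast
  then show ?thesis using fold_partial_cong_open[of S f g x "is"] assms by simp
qed

lemma mderiv_order_list:
  fixes L :: "'n::finite list"
  defines "L \<equiv> SOME is. distinct is \<and> set is = UNIV"
  shows "distinct L" "set L = UNIV"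
proof -
  have "\<exists>is. distinct is \<and> set is = (UNIV :: 'n set)"
    using finite_distinct_list[of "UNIV :: 'n set"] by auto
  from someI_ex[OF this] show "distinct L" "set L = UNIV" by (auto simp: L_def)
qed

text \<open>In a list of distinct directions only one entry contributes. This links bounds for
  multi-indices to the pure derivatives and the gradient on which the Fourier estimates
  rely.\<close>

lemma mderiv_single: "mderiv ((\<lambda>j. 0)(i := k)) f = (partial i ^^ k) f"
proof -
  have "distinct L \<Longrightarrow> fold (\<lambda>j. partial j ^^ ((\<lambda>j. 0)(i := k)) j) L f
      = (if i \<in> set L then (partial i ^^ k) f else f)" for L f
    by (induction L arbitrary: f) auto
  from this[OF mderiv_order_list(1)] show ?thesis
    unfolding mderiv_def using mderiv_order_list(2) by auto
qed

lemma smooth_on_iff: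
  "smooth_on S f \<longleftrightarrow> (\<forall>x\<in>S. f differentiable (at x)) \<and> (\<forall>i. smooth_on S (partial i f))"
  unfolding smooth_on_def
proof (intro iffI conjI allI ballI)
  fix "is" x
  assume *: "(\<forall>x\<in>S. f differentiable (at x)) \<and> (\<forall>i is. \<forall>x\<in>S. fold partial is (partial i f) differentiable (at x))"
    and "x \<in> S"
  then show "fold partial is f differentiable (at x)" by (cases "is") simp_all
next
  fix x assume *: "\<forall>is. \<forall>x\<in>S. fold partial is f differentiable at x" "x \<in> S"
  show "f differentiable at x" using *(1)[rule_format, OF *(2), of "[]"] by simp
next
  fix i "is" x assume *: "\<forall>is. \<forall>x\<in>S. fold partial is f differentiable at x" "x \<in> S"
  show "fold partial is (partial i f) differentiable at x" 
    using *(1)[rule_format, OF *(2), of "i # is"] by simp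
qed

lemma smooth_on_partial: "smooth_on S f \<Longrightarrow> smooth_on S (partial i f)"
  by (drule iffD1[OF smooth_on_iff]) blast

lemma smooth_on_differentiable: "smooth_on S f \<Longrightarrow> x \<in> S \<Longrightarrow> f differentiable (at x)"
  by (drule iffD1[OF smooth_on_iff]) blast

lemma smooth_on_continuous: "smooth_on S f \<Longrightarrow> continuous_on S f"
  by (intro continuous_at_imp_continuous_on ballI differentiable_imp_continuous_within)
     (rule smooth_on_differentiable)

lemma smooth_on_fold_partial: "smooth_on S f \<Longrightarrow> smooth_on S (fold partial is f)"
  by (induction "is" arbitrary: f) (simp_all add: smooth_on_partial)

lemma smooth_on_mderiv: "smooth_on S f \<Longrightarrow> smooth_on S (mderiv \<alpha> f)"
  using smooth_on_fold_partial[of S f] mderiv_eq_fold[of \<alpha>] by auto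

lemma smooth_on_subset: "smooth_on S f \<Longrightarrow> T \<subseteq> S \<Longrightarrow> smooth_on T f"
  unfolding smooth_on_def by blast

lemma smooth_on_cong_open:
  assumes "open S" "\<And>y. y \<in> S \<Longrightarrow> f y = g y" "smooth_on S g"
  shows "smooth_on S f"
  unfolding smooth_on_def
proof (intro allI ballI)
  fix "is" x assume "x \<in> S"
  then show "fold partial is f differentiable (at x)"
    using differentiable_cong_open[OF assms(1), of x "fold partial is f" "fold partial is g"]
      fold_partial_cong_open[OF assms(1), of f g] assms(2,3) by (auto simp: smooth_on_def)
qed

lemma smooth_on_Un: "smooth_on S f \<Longrightarrow> smooth_on T f \<Longrightarrow> smooth_on (S \<union> T) f"
  unfolding smooth_on_def by blast

text \<open>Smoothness behaves like a greatest fixed point, so induction on the list of directions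
  carries the invariant \<open>X\<close> along. Derivatives are matched only on \<open>S\<close>
  because formulas such as the rule for reciprocals hold only there.\<close>

lemma smooth_on_coinduct:
  assumes "open S" "X f"
    and X: "\<And>f. X f \<Longrightarrow> (\<forall>x\<in>S. f differentiable (at x)) \<and>
                 (\<forall>i. \<exists>g. X g \<and> (\<forall>x\<in>S. partial i f x = g x))"
  shows "smooth_on S f"
proof -
  have "\<forall>f. (\<exists>g. X g \<and> (\<forall>x\<in>S. f x = g x)) \<longrightarrow> (\<forall>x\<in>S. fold partial is f differentiable (at x))" for "is"
  proof (induction "is")
    case Nil
    then show ?case using X differentiable_cong_open[OF assms(1)] by (metis fold_simps(1))
  next
    case (Cons i "is")
    show ?case
    proof (intro allI impI)
      fix f assume "\<exists>g. X g \<and> (\<forall>x\<in>S. f x = g x)"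
      then obtain g where g: "X g" "\<forall>x\<in>S. f x = g x" by blast
      then obtain h where h: "X h" "\<forall>x\<in>S. partial i g x = h x" using X by meson
      have "\<forall>x\<in>S. partial i f x = h x" using h g partial_cong_open[OF assms(1)] by metis
      then show "\<forall>x\<in>S. fold partial (i#is) f differentiable (at x)" using Cons h by auto
    qed
  qed
  then show ?thesis using assms(2) unfolding smooth_on_def by blast
qed

section \<open>Flat functions, an algebra of smooth functions, and bumps\<close>

definition flat :: "nat \<Rightarrow> real \<Rightarrow> real" where
  "flat n t = (if t \<le> 0 then 0 else (1/t) ^ n * exp (- (1/t)))"

text \<open>In the variable s = 1/t the quotient is s^(n+1) / exp s for t > 0, and it vanishes for t
  < 0. The limit is that of the difference quotient of \<open>flat n\<close> at 0.\<close>

lemma flat_tendsto_0: "((\<lambda>t. flat n t / t) \<longlongrightarrow> 0) (at 0)"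
proof -
  have "((\<lambda>s::real. s ^ Suc n / exp s) \<longlongrightarrow> 0) at_top" by (rule tendsto_power_div_exp_0)
  then have "((\<lambda>t::real. (inverse t) ^ Suc n / exp (inverse t)) \<longlongrightarrow> 0) (at_right 0)"
    by (rule filterlim_compose[OF _ filterlim_inverse_at_top_right])
  then have R: "((\<lambda>t. flat n t / t) \<longlongrightarrow> 0) (at_right 0)"
    by (rule Lim_transform_eventually)
       (auto simp: flat_def eventually_at_right_less exp_minus field_simps intro!: eventually_mono[OF eventually_at_right_less])
  have L: "((\<lambda>t. flat n t / t) \<longlongrightarrow> 0) (at_left 0)"
    by (rule Lim_transform_eventually[OF tendsto_const])
       (auto simp: flat_def eventually_at_filter)
  show ?thesis using L R by (simp add: filterlim_split_at)
qed

text \<open>The functions t^(-n) exp(-1/t), extended by zero, are closed under differentiation up to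
  scalar combinations, which is why they carry an index. The formula is the chain rule with s = 1/t
  and ds/dt = -s^2.\<close>

lemma flat_has_derivative:
  "(flat n has_real_derivative (flat (n+2) t - real n * flat (n+1) t)) (at t)"
proof (cases "t = 0")
  case True
  have "(flat n has_real_derivative 0) (at 0)"
    unfolding has_field_derivative_iff using flat_tendsto_0[of n] by (simp add: flat_def)
  then show ?thesis using True by (simp add: flat_def)
next
  case False
  show ?thesis
  proof (cases "t > 0")
    case True
    have s: "((\<lambda>t. 1/t) has_real_derivative (- ((1/t)\<^sup>2))) (at t)"
      using True by (auto intro!: derivative_eq_intros simp: power2_eq_square)
    have e: "((\<lambda>s. s ^ n * exp (- s)) has_real_derivative
        (real n * s ^ (n - 1) * exp (- s) - s ^ n * exp (- s))) (at s)" for s :: real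
      by (auto intro!: derivative_eq_intros)
    have "(real n * s ^ (n - 1) * exp (- s) - s ^ n * exp (- s)) * (- (s\<^sup>2))
        = s ^ (n+2) * exp (- s) - real n * (s ^ (n+1) * exp (- s))" for s :: real
      by (cases n) (auto simp: algebra_simps power2_eq_square)
    with DERIV_chain2[OF e s] have *: "((\<lambda>t. (1/t) ^ n * exp (- (1/t))) has_real_derivative (flat (n+2) t - real n * flat (n+1) t)) (at t)"
      using True by (simp add: flat_def)
    show ?thesis
      by (rule has_field_derivative_transform_within_open[OF *, of "{0<..}"]) (use True in \<open>auto simp: flat_def\<close>)
  next
    case f: False
    have *: "((\<lambda>t. 0) has_real_derivative (flat (n+2) t - real n * flat (n+1) t)) (at t)"
      using f by (simp add: flat_def)
    show ?thesis
      by (rule has_field_derivative_transform_within_open[OF *, of "{..<0}"]) (use f False in \<open>auto simp: flat_def\<close>)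
  qed
qed

text \<open>A class made to serve as the invariant of \<open>smooth_on_coinduct\<close>: the rules
  of calculus express each derivative through members of the class again. The rule
  \<open>flat\<close> acts on real-valued functions, given through their complex embedding.\<close>

inductive smooth_alg :: "(real ^ 'n::finite) set \<Rightarrow> (real ^ 'n \<Rightarrow> complex) \<Rightarrow> bool" for S where
  base: "smooth_on S f \<Longrightarrow> smooth_alg S f"
| const: "smooth_alg S (\<lambda>x. c)"
| coord: "smooth_alg S (\<lambda>x. of_real (x $ i))"
| add: "smooth_alg S f \<Longrightarrow> smooth_alg S g \<Longrightarrow> smooth_alg S (\<lambda>x. f x + g x)"
| mult: "smooth_alg S f \<Longrightarrow> smooth_alg S g \<Longrightarrow> smooth_alg S (\<lambda>x. f x * g x)"
| inv: "smooth_alg S f \<Longrightarrow> (\<And>x. x \<in> S \<Longrightarrow> f x \<noteq> 0) \<Longrightarrow> smooth_alg S (\<lambda>x. inverse (f x))"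
| flat: "smooth_alg S (\<lambda>x. of_real (q x)) \<Longrightarrow> smooth_alg S (\<lambda>x. of_real (flat n (q x)))"

lemma partial_add:
  assumes "f differentiable (at x)" "g differentiable (at x)"
  shows "partial i (\<lambda>x. f x + g x) x = partial i f x + partial i g x"
  by (rule trans[OF partial_eqI[OF has_derivative_add[OF assms[THEN has_derivative_partial]]]])
     (simp add: partial_def)

lemma partial_mult:
  assumes "f differentiable (at x)" "g differentiable (at x)"
  shows "partial i (\<lambda>x. f x * g x) x = f x * partial i g x + partial i f x * g x"
  by (rule trans[OF partial_eqI[OF has_derivative_mult[OF assms[THEN has_derivative_partial]]]])
     (simp add: partial_def)

lemma partial_const: "partial i (\<lambda>x. c) x = 0"
  by (rule trans[OF partial_eqI[OF has_derivative_const]]) simp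

lemma has_derivative_coord: "((\<lambda>x::real^'n. complex_of_real (x $ i)) has_derivative (\<lambda>h. of_real (h $ i))) (at x)"
  by (intro has_derivative_of_real bounded_linear.has_derivative[OF bounded_linear_vec_nth] has_derivative_ident)

lemma partial_coord: "partial j (\<lambda>x::real^'n::finite. complex_of_real (x $ i)) x = (if i = j then 1 else 0)"
  by (rule trans[OF partial_eqI[OF has_derivative_coord]]) (auto simp: axis_def)

lemma smooth_alg_step:
  assumes "open S" "smooth_alg S f"
  shows "(\<forall>x\<in>S. f differentiable (at x)) \<and> (\<forall>i. \<exists>g. smooth_alg S g \<and> (\<forall>x\<in>S. partial i f x = g x))"
  using assms(2)
proof induction
  case (base f)
  then show ?case using smooth_on_iff[of S f] smooth_alg.base[of S] by blast
next
  case (const c)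
  then show ?case using partial_const smooth_alg.const by (metis differentiable_const)
next
  case (coord i)
  have "\<exists>g. smooth_alg S g \<and> (\<forall>x\<in>S. partial j (\<lambda>x. complex_of_real (x $ i)) x = g x)" for j
    by (rule exI[of _ "\<lambda>x. if i = j then 1 else 0"]) (auto simp: partial_coord intro: smooth_alg.const)
  then show ?case using has_derivative_coord differentiableI by blast
next
  case (add f g)
  have "\<exists>h. smooth_alg S h \<and> (\<forall>x\<in>S. partial i (\<lambda>x. f x + g x) x = h x)" for i
  proof -
    obtain f' g' where "smooth_alg S f'" "\<forall>x\<in>S. partial i f x = f' x"
      "smooth_alg S g'" "\<forall>x\<in>S. partial i g x = g' x" using add by meson
    then show ?thesis using add
      by (intro exI[of _ "\<lambda>x. f' x + g' x"]) (auto simp: partial_add intro: smooth_alg.add)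
  qed
  then show ?case using add by (auto intro: differentiable_add)
next
  case (mult f g)
  have "\<exists>h. smooth_alg S h \<and> (\<forall>x\<in>S. partial i (\<lambda>x. f x * g x) x = h x)" for i
  proof -
    obtain f' g' where "smooth_alg S f'" "\<forall>x\<in>S. partial i f x = f' x"
      "smooth_alg S g'" "\<forall>x\<in>S. partial i g x = g' x" using mult by meson
    then show ?thesis using mult
      by (intro exI[of _ "\<lambda>x. f x * g' x + f' x * g x"]) (auto simp: partial_mult intro: smooth_alg.add smooth_alg.mult)
  qed
  then show ?case using mult by (auto intro: differentiable_mult)
next
  case (inv f)
  have d: "((\<lambda>x. inverse (f x)) has_derivative
     (\<lambda>h. - (inverse (f x) * frechet_derivative f (at x) h * inverse (f x)))) (at x)" if "x \<in> S" for x
    using inv that by (intro Deriv.has_derivative_inverse has_derivative_partial) auto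
  have "\<exists>h. smooth_alg S h \<and> (\<forall>x\<in>S. partial i (\<lambda>x. inverse (f x)) x = h x)" for i
  proof -
    obtain f' where f': "smooth_alg S f'" "\<forall>x\<in>S. partial i f x = f' x" using inv by meson
    have "smooth_alg S (\<lambda>x. (-1) * (inverse (f x) * f' x * inverse (f x)))"
      using inv f' by (intro smooth_alg.mult smooth_alg.const smooth_alg.inv) auto
    moreover have "\<forall>x\<in>S. partial i (\<lambda>x. inverse (f x)) x = (-1) * (inverse (f x) * f' x * inverse (f x))"
      using partial_eqI[OF d] f'(2) by (auto simp: partial_def)
    ultimately show ?thesis by blast
  qed
  then show ?case using d differentiableI by blast
next
  case (flat q n)
  \<comment> \<open>The induction hypothesis concerns the complex embedding of \<open>q\<close>;
    taking real parts recovers a derivative of \<open>q\<close> itself, to which the chain rule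
    applies.\<close>
  have q: "(q has_derivative (\<lambda>h. Re (frechet_derivative (\<lambda>x. complex_of_real (q x)) (at x) h))) (at x)" if "x \<in> S" for x
  proof -
    have "((\<lambda>x. complex_of_real (q x)) has_derivative frechet_derivative (\<lambda>x. complex_of_real (q x)) (at x)) (at x)"
      using flat that has_derivative_partial by blast
    from bounded_linear.has_derivative[OF bounded_linear_Re this] show ?thesis by simp
  qed
  define F where "F k x = complex_of_real (flat k (q x))" for k x
  define E where "E x = F (n+2) x + (- of_nat n) * F (n+1) x" for x
  have E: "smooth_alg S E" unfolding E_def F_def using flat
    by (intro smooth_alg.mult smooth_alg.const smooth_alg.add smooth_alg.flat) auto
  have d: "((\<lambda>x. complex_of_real (flat n (q x))) has_derivative
     (\<lambda>h. E x * of_real (Re (frechet_derivative (\<lambda>x. complex_of_real (q x)) (at x) h)))) (at x)" if "x \<in> S" for x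
  proof -
    from has_derivative_compose[OF q[OF that] flat_has_derivative[THEN has_field_derivative_imp_has_derivative]]
    have "((\<lambda>x. flat n (q x)) has_derivative (\<lambda>h. (flat (n+2) (q x) - real n * flat (n+1) (q x)) * 
        Re (frechet_derivative (\<lambda>x. complex_of_real (q x)) (at x) h))) (at x)" .
    from has_derivative_of_real[OF this, where 'a=complex] show ?thesis by (simp add: E_def F_def)
  qed
  have re: "of_real (Re (frechet_derivative (\<lambda>x. complex_of_real (q x)) (at x) h)) 
     = frechet_derivative (\<lambda>x. complex_of_real (q x)) (at x) h" if "x \<in> S" for x h
    using frechet_derivative_at[OF has_derivative_of_real[OF q[OF that], where 'a=complex]]  by metis
  have "\<exists>h. smooth_alg S h \<and> (\<forall>x\<in>S. partial i (\<lambda>x. complex_of_real (flat n (q x))) x = h x)" for i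
  proof -
    obtain q' where q': "smooth_alg S q'" "\<forall>x\<in>S. partial i (\<lambda>x. complex_of_real (q x)) x = q' x" using flat by meson
    have "\<forall>x\<in>S. partial i (\<lambda>x. complex_of_real (flat n (q x))) x = E x * q' x"
      using partial_eqI[OF d] q'(2) re by (auto simp: partial_def)
    then show ?thesis using smooth_alg.mult[OF E q'(1)] by blast
  qed
  then show ?case using d differentiableI by blast
qed

lemma smooth_alg_imp_smooth_on: "open S \<Longrightarrow> smooth_alg S f \<Longrightarrow> smooth_on S f"
  by (rule smooth_on_coinduct[of S "smooth_alg S"]) (use smooth_alg_step in blast)+

lemma smooth_on_const: "open S \<Longrightarrow> smooth_on S (\<lambda>x. c)"
  by (intro smooth_alg_imp_smooth_on smooth_alg.const)

lemma smooth_on_add: "open S \<Longrightarrow> smooth_on S f \<Longrightarrow> smooth_on S g \<Longrightarrow> smooth_on S (\<lambda>x. f x + g x)"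
  by (rule smooth_alg_imp_smooth_on, assumption) (intro smooth_alg.add smooth_alg.base)

lemma smooth_on_mult: "open S \<Longrightarrow> smooth_on S f \<Longrightarrow> smooth_on S g \<Longrightarrow> smooth_on S (\<lambda>x. f x * g x)"
  by (rule smooth_alg_imp_smooth_on, assumption) (intro smooth_alg.mult smooth_alg.base)

lemma smooth_on_sum: "open S \<Longrightarrow> (\<And>j. j \<in> J \<Longrightarrow> smooth_on S (f j)) \<Longrightarrow> smooth_on S (\<lambda>x. \<Sum>j\<in>J. f j x)"
  by (induction J rule: infinite_finite_induct) (simp_all add: smooth_on_const smooth_on_add)

lemma smooth_on_prod: "open S \<Longrightarrow> (\<And>j. j \<in> J \<Longrightarrow> smooth_on S (f j)) \<Longrightarrow> smooth_on S (\<lambda>x. \<Prod>j\<in>J. f j x)"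
  by (induction J rule: infinite_finite_induct) (simp_all add: smooth_on_const smooth_on_mult)

lemma smooth_on_coord: "open S \<Longrightarrow> smooth_on S (\<lambda>x. complex_of_real (x $ i))"
  by (intro smooth_alg_imp_smooth_on smooth_alg.coord)

lemma smooth_on_power: "open S \<Longrightarrow> smooth_on S f \<Longrightarrow> smooth_on S (\<lambda>x. f x ^ k)"
  by (induction k) (simp_all add: smooth_on_const smooth_on_mult)

lemma smooth_on_monomial: "open S \<Longrightarrow> smooth_on S (\<lambda>x. complex_of_real (monomial \<gamma> x))"
  unfolding monomial_def of_real_prod of_real_power
  by (intro smooth_on_prod smooth_on_power smooth_on_coord)

text \<open>The quotient A / (A + B), where A is positive exactly inside the larger ball and B
  exactly outside the smaller one; since a < b they never vanish together. Both are
  \<open>flat 0\<close> of an affine expression in the squared distance, which is a polynomial and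
  hence smooth.\<close>

lemma exists_smooth_bump:
  fixes z :: "real ^ 'n::finite"
  assumes "0 < a" "a < b"
  shows "\<exists>\<psi>. smooth_on UNIV \<psi> \<and> (\<forall>x\<in>cball z a. \<psi> x = 1) \<and> (\<forall>x. x \<notin> ball z b \<longrightarrow> \<psi> x = 0)"
proof -
  define q where "q x = (\<Sum>i\<in>UNIV. (x $ i - z $ i)\<^sup>2)" for x
  have qn: "q x = (dist z x)\<^sup>2" for x
    unfolding q_def dist_vec_def L2_set_def dist_real_def by (simp add: sum_nonneg power2_commute)
  define A B where "A x = complex_of_real (flat 0 (b\<^sup>2 + (-1) * q x))"
    and "B x = complex_of_real (flat 0 (q x + (- (a\<^sup>2))))" for x
  have q: "smooth_on UNIV (\<lambda>x. complex_of_real (q x))"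
  proof -
    have "smooth_on UNIV (\<lambda>x. \<Sum>i\<in>UNIV. (complex_of_real (x $ i) + (- of_real (z $ i)))\<^sup>2)"
      by (intro smooth_on_sum smooth_on_power smooth_on_add smooth_on_coord smooth_on_const) auto
    then show ?thesis unfolding q_def by simp
  qed
  have A: "smooth_alg UNIV A" unfolding A_def
    by (rule smooth_alg.flat, unfold of_real_add of_real_mult, intro smooth_alg.add smooth_alg.const smooth_alg.mult smooth_alg.base q)
  have B: "smooth_alg UNIV B" unfolding B_def
    by (rule smooth_alg.flat, unfold of_real_add of_real_mult, intro smooth_alg.add smooth_alg.const smooth_alg.mult smooth_alg.base q)
  have nn: "flat 0 t \<ge> 0" "flat 0 t > 0 \<longleftrightarrow> t > 0" for t by (auto simp: flat_def)
  have ab: "a\<^sup>2 < b\<^sup>2" using assms by (simp add: power_strict_mono)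
  have AB: "A x + B x \<noteq> 0" for x
  proof -
    have "flat 0 (b\<^sup>2 + (-1) * q x) > 0 \<or> flat 0 (q x + (- (a\<^sup>2))) > 0" using nn ab by auto
    then have "flat 0 (b\<^sup>2 + (-1) * q x) + flat 0 (q x + (- (a\<^sup>2))) > 0" using nn(1) 
      by (meson add_nonneg_pos add_pos_nonneg)
    then show ?thesis unfolding A_def B_def by (metis of_real_add of_real_eq_0_iff less_irrefl)
  qed
  define \<psi> where "\<psi> x = A x * inverse (A x + B x)" for x
  have "smooth_on UNIV \<psi>" unfolding \<psi>_def using AB
    by (intro smooth_alg_imp_smooth_on smooth_alg.mult smooth_alg.inv smooth_alg.add A B) auto
  moreover have "\<psi> x = 1" if "x \<in> cball z a" for x
  proof -
    have "q x \<le> a\<^sup>2" using that by (simp add: qn power_mono)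
    then have "B x = 0" by (simp add: B_def flat_def)
    then show ?thesis using AB[of x] by (simp add: \<psi>_def)
  qed
  moreover have "\<psi> x = 0" if "x \<notin> ball z b" for x
  proof -
    have "q x \<ge> b\<^sup>2" using that assms by (simp add: qn power_mono)
    then show ?thesis by (simp add: \<psi>_def A_def flat_def)
  qed
  ultimately show ?thesis by blast
qed

text \<open>The product is smooth on \<Omega> and zero on the open complement of \<open>C\<close>,
  and these two open sets cover the space. This gives a global function although nothing is known of
  \<open>u\<close> outside \<Omega>.\<close>

lemma smooth_on_cutoff_mult:
  assumes "open \<Omega>" "smooth_on UNIV \<phi>" "smooth_on \<Omega> u" "closed C" "C \<subseteq> \<Omega>" "\<And>x. x \<notin> C \<Longrightarrow> \<phi> x = 0"
  shows "smooth_on UNIV (\<lambda>x. \<phi> x * u x)"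
proof -
  have "smooth_on \<Omega> (\<lambda>x. \<phi> x * u x)"
    using assms by (intro smooth_on_mult) (auto intro: smooth_on_subset)
  moreover have "smooth_on (- C) (\<lambda>x. \<phi> x * u x)"
    by (rule smooth_on_cong_open[of _ _ "\<lambda>x. 0"]) (use assms in \<open>auto intro: smooth_on_const\<close>)
  moreover have "\<Omega> \<union> - C = UNIV" using assms by auto
  ultimately show ?thesis using smooth_on_Un by metis
qed

section \<open>Fourier coefficients of compactly supported functions\<close>

lemma frechet_derivative_eq_sum_partial:
  fixes f :: "real^'n::finite \<Rightarrow> complex"
  assumes "f differentiable (at x)"
  shows "frechet_derivative f (at x) v = (\<Sum>i\<in>UNIV. (v $ i) *\<^sub>R partial i f x)"
proof -
  have l: "linear (frechet_derivative f (at x))" using assms by (rule linear_frechet_derivative)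
  have "v = (\<Sum>i\<in>UNIV. (v $ i) *\<^sub>R axis i 1)"
    using basis_expansion[of v] by (simp add: scalar_mult_eq_scaleR)
  then have "frechet_derivative f (at x) v = frechet_derivative f (at x) (\<Sum>i\<in>UNIV. (v $ i) *\<^sub>R axis i 1)" by simp
  also have "\<dots> = (\<Sum>i\<in>UNIV. (v $ i) *\<^sub>R partial i f x)"
    using l by (simp add: linear_sum linear_scale partial_def)
  finally show ?thesis .
qed

lemma has_vector_derivative_imp_quotient:
  fixes f :: "real \<Rightarrow> complex"
  assumes "((\<lambda>t. f t) has_vector_derivative p) (at 0)"
  shows "((\<lambda>t. (f t - f 0) /\<^sub>R t) \<longlongrightarrow> p) (at 0)"
proof -
  have "((\<lambda>h. norm (f (0 + h) - f 0 - h *\<^sub>R p) / norm h) \<longlongrightarrow> 0) (at 0)"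
    using assms unfolding has_vector_derivative_def has_derivative_at by blast
  then have "((\<lambda>t. norm ((f t - f 0) /\<^sub>R t - p)) \<longlongrightarrow> 0) (at 0)"
  proof (rule Lim_transform_eventually)
    have "norm (f (0 + h) - f 0 - h *\<^sub>R p) / norm h = norm ((f h - f 0) /\<^sub>R h - p)" if "h \<noteq> 0" for h
    proof -
      have "(f h - f 0) /\<^sub>R h - p = (f h - f 0 - h *\<^sub>R p) /\<^sub>R h" using that by (simp add: scaleR_diff_right)
      then show ?thesis using that by (simp add: divide_inverse mult.commute)
    qed
    then show "\<forall>\<^sub>F h in at 0. norm (f (0 + h) - f 0 - h *\<^sub>R p) / norm h = norm ((f h - f 0) /\<^sub>R h - p)"
      by (simp add: eventually_at_filter)
  qed
  then show ?thesis by (simp add: tendsto_norm_zero_iff LIM_zero_cancel)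
qed

text \<open>Mean value inequality along the segment. The factor \<open>CARD('n)\<close> comes from
  bounding each coordinate of \<open>v\<close> by its norm.\<close>

lemma norm_diff_le_on_segment:
  fixes g :: "real^'n::finite \<Rightarrow> complex"
  assumes d: "\<And>t. t \<in> {0..1} \<Longrightarrow> g differentiable (at (x + t *\<^sub>R v))"
    and B: "\<And>t i. t \<in> {0..1} \<Longrightarrow> norm (partial i g (x + t *\<^sub>R v)) \<le> B"
  shows "norm (g (x + v) - g x) \<le> real CARD('n) * norm v * B"
proof -
  define f' where "f' t = (\<lambda>s. frechet_derivative g (at (x + t *\<^sub>R v)) (s *\<^sub>R v))" for t
  have "norm ((\<lambda>t. g (x + t *\<^sub>R v)) 1 - (\<lambda>t. g (x + t *\<^sub>R v)) 0) \<le> (real CARD('n) * norm v * B) * norm ((1::real) - 0)"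
  proof (rule differentiable_bound[where S = "{0..1}" and f' = f'])
    fix t :: real assume t: "t \<in> {0..1}"
    have "((\<lambda>t. x + t *\<^sub>R v) has_derivative (\<lambda>s. s *\<^sub>R v)) (at t)"
      by (auto intro!: derivative_eq_intros)
    from has_derivative_compose[OF this has_derivative_partial[OF d[OF t]]]
    show "((\<lambda>t. g (x + t *\<^sub>R v)) has_derivative f' t) (at t within {0..1})"
      unfolding f'_def by (rule has_derivative_at_withinI)
    have "norm (f' t s) \<le> real CARD('n) * norm v * B * norm s" for s
    proof -
      have "norm (f' t s) \<le> (\<Sum>i\<in>UNIV. norm ((s * v $ i) *\<^sub>R partial i g (x + t *\<^sub>R v)))"
        unfolding f'_def frechet_derivative_eq_sum_partial[OF d[OF t]] by (rule order_trans[OF norm_sum]) simp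
      also have "\<dots> \<le> (\<Sum>i\<in>(UNIV::'n set). \<bar>s\<bar> * norm v * B)"
        using component_le_norm_cart[of v] B[OF t]
        by (intro sum_mono) (auto simp: abs_mult intro!: mult_mono)
      finally show ?thesis by (simp add: mult_ac)
    qed
    then show "onorm (f' t) \<le> real CARD('n) * norm v * B" by (rule onorm_le)
  qed auto
  then show ?thesis by simp
qed

section \<open>Integrals of compactly supported functions\<close>

lemma integrable_compact_support:
  fixes g :: "real^'n::finite \<Rightarrow> 'b::{banach, second_countable_topology}"
  assumes "continuous_on UNIV g" "\<And>x. x \<notin> cball z d \<Longrightarrow> g x = 0"
  shows "integrable lborel g"
proof -
  have "integrable lborel (\<lambda>x. indicator (cball z d) x *\<^sub>R g x)"
    using assms(1) by (intro borel_integrable_compact compact_cball) (auto intro: continuous_on_subset)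
  moreover have "(\<lambda>x. indicator (cball z d) x *\<^sub>R g x) = g"
    using assms(2) by (auto simp: fun_eq_iff indicator_def)
  ultimately show ?thesis by simp
qed

lemma integral_translation:
  fixes g :: "real^'n::finite \<Rightarrow> 'b::{banach, second_countable_topology}"
  assumes "g \<in> borel_measurable borel"
  shows "(LINT x|lborel. g (v + x)) = (LINT x|lborel. g x)"
proof -
  have "(LINT x|lborel. g x) = (LINT x|distr lborel borel ((+) v). g x)" by (simp add: lborel_distr_plus)
  also have "\<dots> = (LINT x|lborel. g (v + x))" using assms by (intro integral_distr) auto
  finally show ?thesis by simp
qed

text \<open>By translation invariance every difference quotient of \<open>g\<close> integrates to 0,
  and dominated convergence passes to the limit.\<close>

lemma integral_partial_eq_0:
  fixes g :: "real^'n::finite \<Rightarrow> complex"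
  assumes d: "\<And>x. g differentiable (at x)" and c: "continuous_on UNIV (partial i g)"
    and s: "\<And>x. x \<notin> cball z \<delta> \<Longrightarrow> g x = 0"
  shows "(LINT x|lborel. partial i g x) = 0"
proof -
  have gc: "continuous_on UNIV g"
    by (intro continuous_at_imp_continuous_on ballI differentiable_imp_continuous_within d)
  have ps: "partial i g x = 0" if "x \<notin> cball z \<delta>" for x
    using partial_cong_open[of "- cball z \<delta>" x g "\<lambda>_. 0"] that s by (simp add: partial_const open_Compl)
  obtain B where B: "\<And>x. norm (partial i g x) \<le> B"
  proof -
    have "compact (partial i g ` cball z \<delta>)"
      using c by (intro compact_continuous_image) (auto intro: continuous_on_subset)
    then obtain B where "\<forall>y\<in>partial i g ` cball z \<delta>. norm y \<le> B" 
      using compact_imp_bounded bounded_iff by metis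
    then have "norm (partial i g x) \<le> max B 0" for x
      using ps[of x] by (cases "x \<in> cball z \<delta>") (auto simp: le_max_iff_disj)
    then show ?thesis using that by blast
  qed
  define h where "h n = inverse (real (Suc n))" for n
  have h: "0 < h n" "h n \<le> 1" for n unfolding h_def by (auto simp: inverse_le_1_iff)
  define e where "e = axis i (1::real)"
  have ne: "norm e = 1" by (simp add: e_def norm_axis_1)
  define F where "F n x = (g (h n *\<^sub>R e + x) - g x) /\<^sub>R h n" for n x
  have "(\<lambda>n. LINT x|lborel. F n x) \<longlonglongrightarrow> (LINT x|lborel. partial i g x)"
  proof (rule integral_dominated_convergence)
    show "partial i g \<in> borel_measurable lborel" using c borel_measurable_continuous_onI by simp
    have gm: "g \<in> borel_measurable borel" using gc by (rule borel_measurable_continuous_onI)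
    show "F n \<in> borel_measurable lborel" for n
    proof -
      have "continuous_on UNIV (F n)" unfolding F_def using gc
        by (auto intro!: continuous_intros continuous_on_compose2[OF gc])
      then show ?thesis using borel_measurable_continuous_onI by simp
    qed
    \<comment> \<open>The steps have length at most 1, so all difference quotients vanish outside
      the ball enlarged by 1.\<close>
    show "integrable lborel (\<lambda>x. B * indicat_real (cball z (\<delta> + 1)) x)"
      using emeasure_lborel_cball_finite[of z "\<delta>+1"] by (auto intro!: integrable_mult_right simp: integrable_indicator_iff)
    have lim: "(\<lambda>n. F n x) \<longlonglongrightarrow> partial i g x" for x
    proof -
      have "((\<lambda>t. g (x + t *\<^sub>R e)) has_vector_derivative partial i g x) (at 0)"
      proof -
        have "((\<lambda>t. x + t *\<^sub>R e) has_derivative (\<lambda>s. s *\<^sub>R e)) (at 0)" by (auto intro!: derivative_eq_intros)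
        from has_derivative_compose[OF this, of g "frechet_derivative g (at x)"] has_derivative_partial[OF d]
        have "((\<lambda>t. g (x + t *\<^sub>R e)) has_derivative (\<lambda>s. frechet_derivative g (at x) (s *\<^sub>R e))) (at 0)" by simp
        moreover have "frechet_derivative g (at x) (s *\<^sub>R e) = s *\<^sub>R partial i g x" for s
          using linear_scale[OF linear_frechet_derivative[OF d]] by (simp add: partial_def e_def)
        ultimately show ?thesis by (simp add: has_vector_derivative_def)
      qed
      then have "((\<lambda>t. (g (x + t *\<^sub>R e) - g (x + 0 *\<^sub>R e)) /\<^sub>R t) \<longlongrightarrow> partial i g x) (at 0)"
        by (rule has_vector_derivative_imp_quotient)
      moreover have "filterlim h (at 0) sequentially"
        unfolding filterlim_at using h LIMSEQ_inverse_real_of_nat by (auto simp: h_def[abs_def] less_imp_neq)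
      ultimately show ?thesis unfolding F_def using filterlim_compose[of _ "nhds (partial i g x)" "at 0" h sequentially]
        by (auto simp: add.commute)
    qed
    then show "AE x in lborel. (\<lambda>n. F n x) \<longlonglongrightarrow> partial i g x" by simp
    have bd: "norm (F n x) \<le> B * indicat_real (cball z (\<delta> + 1)) x" for n x
    proof (cases "x \<in> cball z (\<delta> + 1)")
      case True
      have "norm ((\<lambda>t. g (x + t *\<^sub>R e)) (h n) - (\<lambda>t. g (x + t *\<^sub>R e)) 0) \<le> B * norm (h n - 0)"
      proof (rule differentiable_bound[where S = UNIV and f' = "\<lambda>t s. s *\<^sub>R partial i g (x + t *\<^sub>R e)"])
        fix t
        have "((\<lambda>t. x + t *\<^sub>R e) has_derivative (\<lambda>s. s *\<^sub>R e)) (at t)" by (auto intro!: derivative_eq_intros)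
        from has_derivative_compose[OF this has_derivative_partial[OF d]]
        have "((\<lambda>t. g (x + t *\<^sub>R e)) has_derivative (\<lambda>s. frechet_derivative g (at (x + t *\<^sub>R e)) (s *\<^sub>R e))) (at t)" .
        moreover have "frechet_derivative g (at (x + t *\<^sub>R e)) (s *\<^sub>R e) = s *\<^sub>R partial i g (x + t *\<^sub>R e)" for s
          using linear_scale[OF linear_frechet_derivative[OF d]] by (simp add: partial_def e_def)
        ultimately show "((\<lambda>t. g (x + t *\<^sub>R e)) has_derivative (\<lambda>s. s *\<^sub>R partial i g (x + t *\<^sub>R e))) (at t within UNIV)" by simp
        show "onorm (\<lambda>s. s *\<^sub>R partial i g (x + t *\<^sub>R e)) \<le> B"
          using B by (intro onorm_le) (simp add: mult.commute[of B] mult_left_mono)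
      qed auto
      then have "norm (g (x + h n *\<^sub>R e) - g x) / h n \<le> B" using h(1)[of n] by (simp add: pos_divide_le_eq)
      moreover have "norm (F n x) = norm (g (x + h n *\<^sub>R e) - g x) / h n"
        unfolding F_def using h(1)[of n] by (simp add: divide_inverse mult.commute add.commute)
      ultimately show ?thesis using True by simp
    next
      case False
      then have "x \<notin> cball z \<delta>" by auto
      moreover have "h n *\<^sub>R e + x \<notin> cball z \<delta>"
      proof
        assume "h n *\<^sub>R e + x \<in> cball z \<delta>"
        moreover have "dist z x \<le> dist z (h n *\<^sub>R e + x) + dist (h n *\<^sub>R e + x) x" by (rule dist_triangle)
        moreover have "dist (h n *\<^sub>R e + x) x \<le> 1" using h[of n] ne by (simp add: dist_norm)
        ultimately show False using False by auto
      qed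
      ultimately show ?thesis using False by (simp add: F_def s)
    qed
    then show "AE x in lborel. norm (F n x) \<le> B * indicat_real (cball z (\<delta> + 1)) x" for n by simp
  qed
  moreover have "(LINT x|lborel. F n x) = 0" for n
  proof -
    have gi: "integrable lborel g" using gc s by (rule integrable_compact_support)
    have "integrable (distr lborel borel ((+) (h n *\<^sub>R e))) g" using gi by (simp add: lborel_distr_plus)
    then have gi': "integrable lborel (\<lambda>x. g (h n *\<^sub>R e + x))" by (subst (asm) integrable_distr_eq) (use gi in auto)
    show ?thesis unfolding F_def using gi gi' integral_translation[of g "h n *\<^sub>R e"]
      borel_measurable_continuous_onI[OF gc] by simp
  qed
  ultimately show ?thesis by (simp add: LIMSEQ_const_iff)
qed

section \<open>Lattice Fourier coefficients and their calculus\<close>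

definition latt :: "('n::finite \<Rightarrow> int) \<Rightarrow> real^'n" where
  "latt k = (\<chi> i. of_int (k i))"

lemma latt_diff: "latt (\<lambda>i. k i - l i) = latt k - latt l"
  by (simp add: latt_def vec_eq_iff)

text \<open>An integral over the whole space without the factor (2 pi)^(-n). For supports in a ball
  of radius less than 1 it is an integral over one period cell; the normalisation is left to
  \<open>kmass\<close>.\<close>

definition fcoef :: "('n::finite \<Rightarrow> int) \<Rightarrow> (real^'n \<Rightarrow> complex) \<Rightarrow> complex" where
  "fcoef k g = (LINT x|lborel. cis (- (latt k \<bullet> x)) * g x)"

definition test_fun :: "real^'n::finite \<Rightarrow> real \<Rightarrow> (real^'n \<Rightarrow> complex) \<Rightarrow> bool" where
  "test_fun z d g \<longleftrightarrow> smooth_on UNIV g \<and> (\<forall>x. x \<notin> cball z d \<longrightarrow> g x = 0)"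

lemma test_fun_partial:
  assumes "test_fun z d g"
  shows "test_fun z d (partial i g)"
proof -
  have "partial i g x = 0" if "x \<notin> cball z d" for x
    using partial_cong_open[of "- cball z d" x g "\<lambda>_. 0"] that assms
    by (simp add: partial_const open_Compl test_fun_def)
  then show ?thesis using assms smooth_on_partial unfolding test_fun_def by blast
qed

lemma test_fun_mono: "test_fun z d g \<Longrightarrow> d \<le> d' \<Longrightarrow> test_fun z d' g"
  unfolding test_fun_def by auto

lemma test_fun_fold_partial: "test_fun z d g \<Longrightarrow> test_fun z d (fold partial is g)"
  by (induction "is" arbitrary: g) (simp_all add: test_fun_partial)

lemma test_fun_mderiv: "test_fun z d g \<Longrightarrow> test_fun z d (mderiv \<alpha> g)"
  using test_fun_fold_partial[of z d g] mderiv_eq_fold[of \<alpha>] by auto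

lemma test_fun_mult:
  assumes "test_fun z d \<phi>" "open \<Omega>" "cball z d \<subseteq> \<Omega>" "smooth_on \<Omega> u"
  shows "test_fun z d (\<lambda>x. \<phi> x * u x)"
proof -
  have "smooth_on UNIV (\<lambda>x. \<phi> x * u x)"
    by (rule smooth_on_cutoff_mult[OF assms(2) _ assms(4) closed_cball assms(3)]) (use assms(1) in \<open>auto simp: test_fun_def\<close>)
  then show ?thesis using assms(1) by (simp add: test_fun_def)
qed

lemma test_fun_continuous: "test_fun z d g \<Longrightarrow> continuous_on UNIV g"
  using smooth_on_continuous by (auto simp: test_fun_def)

lemma integrable_fcoef:
  assumes "continuous_on UNIV g" "\<And>x. x \<notin> cball z d \<Longrightarrow> g x = 0"
  shows "integrable lborel (\<lambda>x. cis (- (latt k \<bullet> x)) * g x)"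
  using assms by (intro integrable_compact_support[of _ z d]) (auto intro!: continuous_intros)

lemma fcoef_add:
  assumes "continuous_on UNIV f" "\<And>x. x \<notin> cball z d \<Longrightarrow> f x = 0"
    and "continuous_on UNIV g" "\<And>x. x \<notin> cball z d \<Longrightarrow> g x = 0"
  shows "fcoef k (\<lambda>x. f x + g x) = fcoef k f + fcoef k g"
  unfolding fcoef_def distrib_left
  by (intro Bochner_Integration.integral_add integrable_fcoef[of _ z d] assms)

lemma fcoef_diff:
  assumes "continuous_on UNIV f" "\<And>x. x \<notin> cball z d \<Longrightarrow> f x = 0"
    and "continuous_on UNIV g" "\<And>x. x \<notin> cball z d \<Longrightarrow> g x = 0"
  shows "fcoef k (\<lambda>x. f x - g x) = fcoef k f - fcoef k g"
  unfolding fcoef_def right_diff_distrib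
  by (intro Bochner_Integration.integral_diff integrable_fcoef[of _ z d] assms)

lemma norm_fcoef_le:
  assumes "continuous_on UNIV g" "\<And>x. x \<notin> cball z d \<Longrightarrow> g x = 0" "\<And>x. x \<in> cball z d \<Longrightarrow> norm (g x) \<le> B"
  shows "norm (fcoef k g) \<le> B * measure lborel (cball z d)"
proof -
  have "norm (fcoef k g) \<le> (LINT x|lborel. norm (cis (- (latt k \<bullet> x)) * g x))"
    unfolding fcoef_def by (rule integral_norm_bound)
  also have "\<dots> \<le> (LINT x|lborel. B * indicat_real (cball z d) x)"
  proof (rule integral_mono)
    show "integrable lborel (\<lambda>x. norm (cis (- (latt k \<bullet> x)) * g x))"
      using integrable_fcoef[OF assms(1,2)] by (rule integrable_norm)
    show "integrable lborel (\<lambda>x. B * indicat_real (cball z d) x)"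
      using emeasure_lborel_cball_finite[of z d] by (auto intro!: integrable_mult_right simp: integrable_indicator_iff)
  qed (use assms in \<open>auto simp: norm_mult indicator_def\<close>)
  also have "\<dots> = B * measure lborel (cball z d)" by simp
  finally show ?thesis .
qed

lemma has_derivative_cis_latt:
  "((\<lambda>x. cis (- (latt k \<bullet> x))) has_derivative (\<lambda>h. - \<i> * of_real (latt k \<bullet> h) * cis (- (latt k \<bullet> x)))) (at x)"
proof -
  have "((\<lambda>x. cis (- (latt k \<bullet> x))) has_derivative (\<lambda>h. (- (latt k \<bullet> h)) *\<^sub>R (\<i> * cis (- (latt k \<bullet> x))))) (at x)"
    by (rule has_derivative_compose[OF _ has_derivative_cis]) (auto intro!: derivative_eq_intros)
  then show ?thesis by (simp add: scaleR_conv_of_real mult_ac)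
qed

text \<open>Integration by parts: the derivative of the product of \<open>g\<close> with the
  character integrates to 0.\<close>

lemma fcoef_partial:
  fixes g :: "real^'n::finite \<Rightarrow> complex"
  assumes "test_fun z d g"
  shows "fcoef k (partial i g) = \<i> * of_int (k i) * fcoef k g"
proof -
  define E where "E x = cis (- (latt k \<bullet> x))" for x :: "real^'n"
  have Ed: "(E has_derivative (\<lambda>h. - \<i> * of_real (latt k \<bullet> h) * E x)) (at x)" for x
    unfolding E_def by (rule has_derivative_cis_latt)
  have Ep: "partial i E x = - \<i> * of_int (k i) * E x" for x
    by (rule trans[OF partial_eqI[OF Ed]]) (simp add: latt_def inner_axis)
  have gd: "g differentiable (at x)" for x using assms smooth_on_differentiable[of UNIV g] by (auto simp: test_fun_def)
  have P: "partial i (\<lambda>x. E x * g x) x = E x * partial i g x - \<i> * of_int (k i) * (E x * g x)" for x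
    using partial_mult[OF differentiableI[OF Ed] gd] Ep by (simp add: mult_ac)
  have gc: "continuous_on UNIV g" "continuous_on UNIV (partial i g)"
    using assms test_fun_partial test_fun_continuous by blast+
  have Ec: "continuous_on UNIV E" unfolding E_def by (intro continuous_intros)
  have "(LINT x|lborel. partial i (\<lambda>x. E x * g x) x) = 0"
  proof (rule integral_partial_eq_0)
    show "(\<lambda>x. E x * g x) differentiable at x" for x
      using differentiableI[OF Ed] gd by (rule differentiable_mult)
    show "continuous_on UNIV (partial i (\<lambda>x. E x * g x))" unfolding P
      by (intro continuous_intros gc Ec)
    show "x \<notin> cball z d \<Longrightarrow> E x * g x = 0" for x using assms by (simp add: test_fun_def)
  qed
  moreover have "integrable lborel (\<lambda>x. E x * g x)" "integrable lborel (\<lambda>x. E x * partial i g x)"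
    unfolding E_def using integrable_fcoef[of g z d k] integrable_fcoef[of "partial i g" z d k] gc 
      assms test_fun_partial[OF assms] by (auto simp: test_fun_def)
  ultimately show ?thesis unfolding fcoef_def P E_def[symmetric] by simp
qed

lemma fcoef_partial_power:
  assumes "test_fun z d g"
  shows "fcoef k ((partial i ^^ j) g) = (\<i> * of_int (k i)) ^ j * fcoef k g \<and> test_fun z d ((partial i ^^ j) g)"
proof (induction j)
  case (Suc j)
  then show ?case using fcoef_partial[of z d "(partial i ^^ j) g" k i] test_fun_partial[of z d "(partial i ^^ j) g" i]
    by simp
qed (use assms in simp)

text \<open>Directions are processed one after the other in the order of the list inside
  \<open>mderiv\<close>. The multipliers commute, so this order leaves no trace in the result, which
  is what later makes derivatives commute.\<close>

lemma fcoef_mderiv: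
  fixes g :: "real^'n::finite \<Rightarrow> complex"
  assumes "test_fun z d g"
  shows "fcoef k (mderiv \<alpha> g) = \<i> ^ mi_order \<alpha> * of_real (monomial \<alpha> (latt k)) * fcoef k g"
proof -
  have "distinct L \<Longrightarrow> test_fun z d g \<Longrightarrow> fcoef k (fold (\<lambda>i. partial i ^^ \<alpha> i) L g) = (\<Prod>i\<in>set L. (\<i> * of_int (k i)) ^ \<alpha> i) * fcoef k g"
    for L and g :: "real^'n::finite \<Rightarrow> complex"
  proof (induction L arbitrary: g)
    case (Cons i L)
    have "fcoef k (fold (\<lambda>i. partial i ^^ \<alpha> i) (i # L) g) = fcoef k (fold (\<lambda>i. partial i ^^ \<alpha> i) L ((partial i ^^ \<alpha> i) g))" by simp
    also have "\<dots> = (\<Prod>i\<in>set L. (\<i> * of_int (k i)) ^ \<alpha> i) * fcoef k ((partial i ^^ \<alpha> i) g)"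
      using Cons fcoef_partial_power[OF Cons.prems(2)] by (intro Cons.IH) auto
    finally show ?case using fcoef_partial_power[OF Cons.prems(2)] Cons.prems(1) by simp
  qed simp
  from this[OF mderiv_order_list(1) assms] have "fcoef k (mderiv \<alpha> g) = (\<Prod>i\<in>UNIV. (\<i> * of_int (k i)) ^ \<alpha> i) * fcoef k g"
    unfolding mderiv_def mderiv_order_list(2) .
  also have "(\<Prod>i\<in>UNIV. (\<i> * of_int (k i)) ^ \<alpha> i) = \<i> ^ mi_order \<alpha> * of_real (monomial \<alpha> (latt k))"
    by (simp add: power_mult_distrib prod.distrib power_sum mi_order_def monomial_def latt_def)
  finally show ?thesis .
qed

lemma test_fun_lincomb:
  assumes "\<And>j. j \<in> J \<Longrightarrow> test_fun z d (f j)"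
  shows "test_fun z d (\<lambda>x. \<Sum>j\<in>J. c j * f j x)"
  using assms unfolding test_fun_def
  by (auto intro!: smooth_on_sum smooth_on_mult smooth_on_const sum.neutral)

lemma fcoef_lincomb:
  assumes "\<And>j. j \<in> J \<Longrightarrow> continuous_on UNIV (f j)" "\<And>x j. j \<in> J \<Longrightarrow> x \<notin> cball z d \<Longrightarrow> f j x = 0"
  shows "fcoef k (\<lambda>x. \<Sum>j\<in>J. c j * f j x) = (\<Sum>j\<in>J. c j * fcoef k (f j))"
proof -
  have "fcoef k (\<lambda>x. \<Sum>j\<in>J. c j * f j x) = (LINT x|lborel. (\<Sum>j\<in>J. c j * (cis (- (latt k \<bullet> x)) * f j x)))"
    unfolding fcoef_def by (simp add: sum_distrib_left mult_ac)
  also have "\<dots> = (\<Sum>j\<in>J. (LINT x|lborel. c j * (cis (- (latt k \<bullet> x)) * f j x)))"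
    using assms by (intro Bochner_Integration.integral_sum integrable_mult_right integrable_fcoef[of _ z d]) auto
  finally show ?thesis unfolding fcoef_def by simp
qed

text \<open>The factor (-i)^|\<gamma>| of D cancels the i^|\<gamma>| produced by differentiation,
  and the symbol at the lattice point remains.\<close>

lemma fcoef_pdo_net:
  assumes "test_fun z d (u \<epsilon>)"
  shows "test_fun z d (pdo_net m a u \<epsilon>)"
    and "fcoef k (pdo_net m a u \<epsilon>) = symbol_net m a \<epsilon> (latt k) * fcoef k (u \<epsilon>)"
proof -
  have eq: "pdo_net m a u \<epsilon> = (\<lambda>x. \<Sum>\<gamma> | mi_order \<gamma> \<le> m. (a \<gamma> \<epsilon> * (- \<i>) ^ mi_order \<gamma>) * mderiv \<gamma> (u \<epsilon>) x)"
    by (auto simp: fun_eq_iff pdo_net_def mult_ac)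
  show "test_fun z d (pdo_net m a u \<epsilon>)" unfolding eq
    using test_fun_mderiv[OF assms] by (intro test_fun_lincomb)
  have "fcoef k (pdo_net m a u \<epsilon>) = (\<Sum>\<gamma> | mi_order \<gamma> \<le> m. (a \<gamma> \<epsilon> * (- \<i>) ^ mi_order \<gamma>) * fcoef k (mderiv \<gamma> (u \<epsilon>)))"
    unfolding eq
  proof (rule fcoef_lincomb)
    fix \<gamma> :: "'a \<Rightarrow> nat"
    show "continuous_on UNIV (mderiv \<gamma> (u \<epsilon>))" by (rule test_fun_continuous[OF test_fun_mderiv[OF assms]])
    show "mderiv \<gamma> (u \<epsilon>) x = 0" if "x \<notin> cball z d" for x
      using test_fun_mderiv[OF assms] that by (simp add: test_fun_def)
  qed
  also have "\<dots> = (\<Sum>\<gamma> | mi_order \<gamma> \<le> m. a \<gamma> \<epsilon> * of_real (monomial \<gamma> (latt k)) * fcoef k (u \<epsilon>))"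
  proof (rule sum.cong)
    fix \<gamma> :: "'a \<Rightarrow> nat"
    have "(- \<i>) ^ mi_order \<gamma> * \<i> ^ mi_order \<gamma> = 1" by (simp flip: power_mult_distrib)
    then show "a \<gamma> \<epsilon> * (- \<i>) ^ mi_order \<gamma> * fcoef k (mderiv \<gamma> (u \<epsilon>)) = a \<gamma> \<epsilon> * complex_of_real (monomial \<gamma> (latt k)) * fcoef k (u \<epsilon>)"
      unfolding fcoef_mderiv[OF assms] by (metis (no_types, opaque_lifting) mult.assoc mult.left_commute mult.right_neutral)
  qed auto
  finally show "fcoef k (pdo_net m a u \<epsilon>) = symbol_net m a \<epsilon> (latt k) * fcoef k (u \<epsilon>)"
    unfolding symbol_net_def by (simp add: sum_distrib_right)
qed

text \<open>Integration by parts \<open>N\<close> times, each derivative falling on the cutoff or on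
  \<open>f\<close>; the induction therefore runs over all cutoffs. The constant is chosen before
  \<open>f\<close>, since later \<open>f\<close> varies with \<epsilon>.\<close>

lemma fcoef_decay_coord:
  fixes \<phi> :: "real^'n::finite \<Rightarrow> complex"
  assumes "open \<Omega>" "cball z d \<subseteq> \<Omega>" "test_fun z d \<phi>"
  shows "\<exists>C\<ge>0. \<forall>f B k. smooth_on \<Omega> f \<longrightarrow> (\<forall>j\<le>N. \<forall>x\<in>cball z d. norm ((partial i ^^ j) f x) \<le> B) \<longrightarrow>
     \<bar>real_of_int (k i)\<bar> ^ N * norm (fcoef k (\<lambda>x. \<phi> x * f x)) \<le> C * B"
  using assms(3)
proof (induction N arbitrary: \<phi>)
  case 0
  have "continuous_on UNIV \<phi>" using 0 test_fun_continuous by blast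
  then have "compact (\<phi> ` cball z d)"
    by (intro compact_continuous_image) (auto intro: continuous_on_subset)
  then obtain M where "\<forall>y\<in>\<phi> ` cball z d. norm y \<le> M" using compact_imp_bounded bounded_iff by metis
  then have M: "\<forall>x\<in>cball z d. norm (\<phi> x) \<le> max M 0" by (auto simp: le_max_iff_disj)
  show ?case
  proof (intro exI[of _ "max M 0 * measure lborel (cball z d)"] conjI allI impI)
    fix f B and k :: "'n \<Rightarrow> int"
    assume f: "smooth_on \<Omega> f" "\<forall>j\<le>0. \<forall>x\<in>cball z d. norm ((partial i ^^ j) f x) \<le> B"
    have t: "test_fun z d (\<lambda>x. \<phi> x * f x)" using test_fun_mult[OF 0 assms(1,2) f(1)] .
    have "norm (fcoef k (\<lambda>x. \<phi> x * f x)) \<le> (max M 0 * B) * measure lborel (cball z d)"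
    proof (rule norm_fcoef_le)
      show "continuous_on UNIV (\<lambda>x. \<phi> x * f x)" using t by (rule test_fun_continuous)
      show "x \<notin> cball z d \<Longrightarrow> \<phi> x * f x = 0" for x using t by (simp add: test_fun_def)
      show "x \<in> cball z d \<Longrightarrow> norm (\<phi> x * f x) \<le> max M 0 * B" for x
        using M f(2) by (auto simp: norm_mult intro!: mult_mono)
    qed
    then show "\<bar>real_of_int (k i)\<bar> ^ 0 * norm (fcoef k (\<lambda>x. \<phi> x * f x)) \<le> max M 0 * measure lborel (cball z d) * B"
      by (simp add: mult_ac)
  qed auto
next
  case (Suc N)
  obtain C1 where C1: "C1 \<ge> 0" "\<And>f B k. smooth_on \<Omega> f \<Longrightarrow> (\<forall>j\<le>N. \<forall>x\<in>cball z d. norm ((partial i ^^ j) f x) \<le> B) \<Longrightarrow>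
     \<bar>real_of_int (k i)\<bar> ^ N * norm (fcoef k (\<lambda>x. \<phi> x * f x)) \<le> C1 * B" using Suc.IH[OF Suc.prems] by meson
  obtain C2 where C2: "C2 \<ge> 0" "\<And>f B k. smooth_on \<Omega> f \<Longrightarrow> (\<forall>j\<le>N. \<forall>x\<in>cball z d. norm ((partial i ^^ j) f x) \<le> B) \<Longrightarrow>
     \<bar>real_of_int (k i)\<bar> ^ N * norm (fcoef k (\<lambda>x. partial i \<phi> x * f x)) \<le> C2 * B" using Suc.IH[OF test_fun_partial[OF Suc.prems]] by meson
  show ?case
  proof (intro exI[of _ "C1 + C2"] conjI allI impI)
    fix f B and k :: "'n \<Rightarrow> int"
    assume f: "smooth_on \<Omega> f" "\<forall>j\<le>Suc N. \<forall>x\<in>cball z d. norm ((partial i ^^ j) f x) \<le> B"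
    have t: "test_fun z d (\<lambda>x. \<phi> x * f x)" using test_fun_mult[OF Suc.prems assms(1,2) f(1)] .
    have t1: "test_fun z d (\<lambda>x. \<phi> x * partial i f x)" using test_fun_mult[OF Suc.prems assms(1,2) smooth_on_partial[OF f(1)]] .
    have t2: "test_fun z d (\<lambda>x. partial i \<phi> x * f x)" using test_fun_mult[OF test_fun_partial[OF Suc.prems] assms(1,2) f(1)] .
    \<comment> \<open>Inside the ball this is the product rule; outside, where \<open>f\<close> may
      fail to be differentiable, both sides are 0.\<close>
    have "partial i (\<lambda>x. \<phi> x * f x) x = \<phi> x * partial i f x + partial i \<phi> x * f x" for x
    proof (cases "x \<in> cball z d")
      case True
      then have "x \<in> \<Omega>" using assms(2) by auto
      then show ?thesis using smooth_on_differentiable[OF f(1)] smooth_on_differentiable[of UNIV \<phi>] Suc.prems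
        by (intro partial_mult) (auto simp: test_fun_def)
    next
      case False
      then show ?thesis using test_fun_partial[OF t, of i] test_fun_partial[OF Suc.prems, of i] Suc.prems by (simp add: test_fun_def)
    qed
    then have "partial i (\<lambda>x. \<phi> x * f x) = (\<lambda>x. \<phi> x * partial i f x + partial i \<phi> x * f x)" by blast
    then have "\<i> * of_int (k i) * fcoef k (\<lambda>x. \<phi> x * f x) = fcoef k (\<lambda>x. \<phi> x * partial i f x) + fcoef k (\<lambda>x. partial i \<phi> x * f x)"
      using fcoef_partial[OF t, of k i] fcoef_add[of "\<lambda>x. \<phi> x * partial i f x" z d "\<lambda>x. partial i \<phi> x * f x" k]
        test_fun_continuous[OF t1] test_fun_continuous[OF t2] t1 t2 by (auto simp: test_fun_def)
    then have "\<bar>real_of_int (k i)\<bar> * norm (fcoef k (\<lambda>x. \<phi> x * f x)) = norm (fcoef k (\<lambda>x. \<phi> x * partial i f x) + fcoef k (\<lambda>x. partial i \<phi> x * f x))"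
      by (metis norm_ii mult_1 norm_mult norm_of_int)
    also have "\<dots> \<le> norm (fcoef k (\<lambda>x. \<phi> x * partial i f x)) + norm (fcoef k (\<lambda>x. partial i \<phi> x * f x))" by (rule norm_triangle_ineq)
    finally have "\<bar>real_of_int (k i)\<bar> ^ N * (\<bar>real_of_int (k i)\<bar> * norm (fcoef k (\<lambda>x. \<phi> x * f x))) \<le> 
       \<bar>real_of_int (k i)\<bar> ^ N * (norm (fcoef k (\<lambda>x. \<phi> x * partial i f x)) + norm (fcoef k (\<lambda>x. partial i \<phi> x * f x)))"
      by (rule mult_left_mono) simp
    also have "\<dots> \<le> C1 * B + C2 * B"
    proof -
      have "norm ((partial i ^^ j) (partial i f) x) \<le> B" if "j \<le> N" "x \<in> cball z d" for j x
        using f(2)[rule_format, of "Suc j" x] that by (simp add: funpow_swap1)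
      then have "\<bar>real_of_int (k i)\<bar> ^ N * norm (fcoef k (\<lambda>x. \<phi> x * partial i f x)) \<le> C1 * B"
        using smooth_on_partial[OF f(1)] by (intro C1) auto
      moreover have "\<bar>real_of_int (k i)\<bar> ^ N * norm (fcoef k (\<lambda>x. partial i \<phi> x * f x)) \<le> C2 * B"
        using f by (intro C2) auto
      ultimately show ?thesis by (simp add: distrib_left)
    qed
    finally show "\<bar>real_of_int (k i)\<bar> ^ Suc N * norm (fcoef k (\<lambda>x. \<phi> x * f x)) \<le> (C1 + C2) * B"
      by (simp add: algebra_simps)
  qed (use C1 C2 in auto)
qed

text \<open>Compare with the largest coordinate. Powers of single coordinates thus control the full
  weight, and pure derivatives suffice for decay in all directions.\<close>

lemma one_plus_norm_power_le:
  fixes x :: "real^'n::finite"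
  shows "(1 + norm x) ^ N \<le> (1 + real CARD('n)) ^ N * (1 + (\<Sum>i\<in>UNIV. \<bar>x $ i\<bar> ^ N))"
proof -
  obtain i where i: "\<And>j. \<bar>x $ j\<bar> \<le> \<bar>x $ i\<bar>"
  proof -
    have "Max (range (\<lambda>j. \<bar>x $ j\<bar>)) \<in> range (\<lambda>j. \<bar>x $ j\<bar>)" by (rule Max_in) auto
    then obtain i where "Max (range (\<lambda>j. \<bar>x $ j\<bar>)) = \<bar>x $ i\<bar>" by (rule rangeE)
    then show ?thesis using that[of i] Max_ge[of "range (\<lambda>j. \<bar>x $ j\<bar>)"] by auto
  qed
  define M where "M = max 1 \<bar>x $ i\<bar>"
  have "norm x \<le> (\<Sum>j\<in>UNIV. \<bar>x $ j\<bar>)" by (rule norm_le_l1_cart)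
  also have "\<dots> \<le> (\<Sum>j\<in>(UNIV :: 'n set). M)" using i by (intro sum_mono) (auto simp: M_def le_max_iff_disj)
  finally have "1 + norm x \<le> (1 + real CARD('n)) * M" by (simp add: M_def algebra_simps)
  then have "(1 + norm x) ^ N \<le> ((1 + real CARD('n)) * M) ^ N" by (intro power_mono) auto
  also have "\<dots> = (1 + real CARD('n)) ^ N * M ^ N" by (rule power_mult_distrib)
  also have "M ^ N \<le> 1 + \<bar>x $ i\<bar> ^ N" by (auto simp: M_def max_def)
  also have "\<bar>x $ i\<bar> ^ N \<le> (\<Sum>i\<in>UNIV. \<bar>x $ i\<bar> ^ N)" by (rule member_le_sum) auto
  finally show ?thesis by (simp add: mult_left_mono)
qed

lemma fcoef_decay:
  fixes \<phi> :: "real^'n::finite \<Rightarrow> complex"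
  assumes "open \<Omega>" "cball z d \<subseteq> \<Omega>" "test_fun z d \<phi>"
  shows "\<exists>C\<ge>0. \<forall>f B k. smooth_on \<Omega> f \<longrightarrow> (\<forall>i. \<forall>j\<le>N. \<forall>x\<in>cball z d. norm ((partial i ^^ j) f x) \<le> B) \<longrightarrow>
     (1 + norm (latt k)) ^ N * norm (fcoef k (\<lambda>x. \<phi> x * f x)) \<le> C * B"
proof -
  have "\<forall>i. \<exists>C\<ge>0. \<forall>f B k. smooth_on \<Omega> f \<longrightarrow> (\<forall>j\<le>N. \<forall>x\<in>cball z d. norm ((partial i ^^ j) f x) \<le> B) \<longrightarrow>
     \<bar>real_of_int (k i)\<bar> ^ N * norm (fcoef k (\<lambda>x. \<phi> x * f x)) \<le> C * B"
    using fcoef_decay_coord[OF assms] by blast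
  then obtain C where C: "\<And>i. C i \<ge> 0" "\<And>i f B k. smooth_on \<Omega> f \<Longrightarrow> (\<forall>j\<le>N. \<forall>x\<in>cball z d. norm ((partial i ^^ j) f x) \<le> B) \<Longrightarrow>
     \<bar>real_of_int (k i)\<bar> ^ N * norm (fcoef k (\<lambda>x. \<phi> x * f x)) \<le> C i * B" by metis
  obtain C0 where C0: "C0 \<ge> 0" "\<And>f B k. smooth_on \<Omega> f \<Longrightarrow> (\<forall>x\<in>cball z d. norm (f x) \<le> B) \<Longrightarrow>
     norm (fcoef k (\<lambda>x. \<phi> x * f x)) \<le> C0 * B" using fcoef_decay_coord[OF assms, of 0] by auto
  show ?thesis
  proof (intro exI[of _ "(1 + real CARD('n)) ^ N * (C0 + (\<Sum>i\<in>UNIV. C i))"] conjI allI impI)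
    fix f B and k :: "'n \<Rightarrow> int"
    assume f: "smooth_on \<Omega> f" "\<forall>i. \<forall>j\<le>N. \<forall>x\<in>cball z d. norm ((partial i ^^ j) f x) \<le> B"
    let ?c = "norm (fcoef k (\<lambda>x. \<phi> x * f x))"
    have "(1 + norm (latt k)) ^ N * ?c \<le> (1 + real CARD('n)) ^ N * (1 + (\<Sum>i\<in>UNIV. \<bar>latt k $ i\<bar> ^ N)) * ?c"
      by (intro mult_right_mono one_plus_norm_power_le) simp
    also have "\<dots> = (1 + real CARD('n)) ^ N * (?c + (\<Sum>i\<in>UNIV. \<bar>real_of_int (k i)\<bar> ^ N * ?c))"
      by (simp add: latt_def distrib_right sum_distrib_right mult.assoc)
    also have "\<dots> \<le> (1 + real CARD('n)) ^ N * (C0 * B + (\<Sum>i\<in>UNIV. C i * B))"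
      using f C0(2)[OF f(1), of B] f(2)[rule_format, of 0] by (intro mult_left_mono add_mono sum_mono C(2)) auto
    finally show "(1 + norm (latt k)) ^ N * ?c \<le> (1 + real CARD('n)) ^ N * (C0 + (\<Sum>i\<in>UNIV. C i)) * B"
      by (simp add: distrib_right sum_distrib_right mult.assoc)
  qed (use C C0 in \<open>auto intro!: mult_nonneg_nonneg add_nonneg_nonneg sum_nonneg\<close>)
qed

section \<open>Trigonometric approximation\<close>

text \<open>A product of unnormalised de la Vallee Poussin kernels cos^(2M)(t/2), one per
  coordinate: nonnegative trigonometric polynomials that concentrate at 0.\<close>

definition kern :: "nat \<Rightarrow> real^'n::finite \<Rightarrow> real" where
  "kern M x = (\<Prod>i\<in>UNIV. ((1 + cos (x $ i)) / 2) ^ M)"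

definition kbox :: "nat \<Rightarrow> ('n::finite \<Rightarrow> int) set" where
  "kbox M = PiE UNIV (\<lambda>_. {- int M..int M})"

text \<open>For \<open>l\<close> in \<open>kbox M\<close> these are the Fourier coefficients of
  \<open>kern M\<close>.\<close>

definition kcoef :: "nat \<Rightarrow> ('n::finite \<Rightarrow> int) \<Rightarrow> real" where
  "kcoef M l = (\<Prod>i\<in>UNIV. real (2 * M choose nat (int M + l i)) / 4 ^ M)"

text \<open>Large enough for all differences of two points of a ball of radius less than 1, and
  small enough to stay within |t| <= pi in each coordinate, where cos t = 1 forces t = 0.\<close>

definition kcube :: "(real^'n::finite) set" where
  "kcube = cbox (\<chi> i. -2) (\<chi> i. 2)"

text \<open>The mass over the cube and not over a full period cell, because only displacements in
  the cube occur. The type argument carries the dimension.\<close>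

definition kmass :: "'n::finite itself \<Rightarrow> nat \<Rightarrow> real" where
  "kmass _ M = (LINT w|lborel. indicator (kcube :: (real^'n) set) w * kern M w)"

lemma mem_kcube: "w \<in> kcube \<longleftrightarrow> (\<forall>i. \<bar>w $ i\<bar> \<le> 2)"
  by (auto simp: kcube_def mem_box_cart abs_le_iff minus_le_iff[of _ 2])

text \<open>(1 + cos t) / 2 is the square of the mean of exp(i t/2) and exp(-i t/2). The binomial
  theorem applies to the power 2M, and j = q - M is its shifted index.\<close>

lemma cos_power_expansion:
  "complex_of_real (((1 + cos t) / 2) ^ M) =
     (\<Sum>j\<in>{- int M..int M}. of_real (real (2 * M choose nat (int M + j)) / 4 ^ M) * cis (of_int j * t))"
proof -
  have sq: "complex_of_real ((1 + cos t) / 2) = (cis (t/2) + cis (- (t/2)))\<^sup>2 / 4"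
  proof -
    have "cos t = 2 * (cos (t/2))\<^sup>2 - 1" using cos_double_cos[of "t/2"] by simp
    moreover have "cis (t/2) + cis (- (t/2)) = complex_of_real (2 * cos (t/2))" by (simp add: complex_eq_iff)
    ultimately show ?thesis by (simp add: power2_eq_square)
  qed
  have "complex_of_real (((1 + cos t) / 2) ^ M) = (cis (t/2) + cis (- (t/2))) ^ (2 * M) / 4 ^ M"
    unfolding of_real_power sq by (simp add: power_divide power_mult)
  also have "\<dots> = (\<Sum>q\<le>2 * M. of_nat (2 * M choose q) * cis (t/2) ^ q * cis (- (t/2)) ^ (2 * M - q)) / 4 ^ M"
    by (simp add: binomial_ring)
  also have "\<dots> = (\<Sum>q\<le>2 * M. of_real (real (2 * M choose q) / 4 ^ M) * cis (of_int (int q - int M) * t))"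
    unfolding sum_divide_distrib
  proof (rule sum.cong)
    fix q assume q: "q \<in> {..2 * M}"
    have "cis (t/2) ^ q * cis (- (t/2)) ^ (2 * M - q) = cis (real q * (t/2) + real (2 * M - q) * (- (t/2)))"
      by (simp add: Complex.DeMoivre cis_mult)
    also have "real q * (t/2) + real (2 * M - q) * (- (t/2)) = of_int (int q - int M) * t"
      using q by (simp add: of_nat_diff field_simps)
    finally show "of_nat (2 * M choose q) * cis (t/2) ^ q * cis (- (t/2)) ^ (2 * M - q) / 4 ^ M
       = of_real (real (2 * M choose q) / 4 ^ M) * cis (of_int (int q - int M) * t)"
      by (simp add: mult.assoc)
  qed simp
  also have "\<dots> = (\<Sum>j\<in>{- int M..int M}. of_real (real (2 * M choose nat (int M + j)) / 4 ^ M) * cis (of_int j * t))"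
    by (rule sum.reindex_bij_witness[where i = "\<lambda>j. nat (int M + j)" and j = "\<lambda>q. int q - int M"]) auto
  finally show ?thesis .
qed

lemma kern_expansion:
  "complex_of_real (kern M x) = (\<Sum>l\<in>kbox M. of_real (kcoef M l) * cis (latt l \<bullet> x))"
proof -
  have "complex_of_real (kern M x) = (\<Prod>i\<in>UNIV. \<Sum>j\<in>{- int M..int M}. 
      of_real (real (2 * M choose nat (int M + j)) / 4 ^ M) * cis (of_int j * x $ i))"
    unfolding kern_def of_real_prod cos_power_expansion ..
  also have "\<dots> = (\<Sum>l\<in>kbox M. \<Prod>i\<in>UNIV. of_real (real (2 * M choose nat (int M + l i)) / 4 ^ M) * cis (of_int (l i) * x $ i))"
    unfolding kbox_def by (intro prod_sum_PiE) auto
  also have "\<dots> = (\<Sum>l\<in>kbox M. of_real (kcoef M l) * cis (latt l \<bullet> x))"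
  proof (rule sum.cong)
    fix l :: "'a \<Rightarrow> int"
    have "(\<Prod>i\<in>UNIV. cis (of_int (l i) * x $ i)) = cis (latt l \<bullet> x)"
      by (simp add: cis_conv_exp inner_vec_def latt_def exp_sum sum_distrib_left mult_ac)
    then show "(\<Prod>i\<in>UNIV. of_real (real (2 * M choose nat (int M + l i)) / 4 ^ M) * cis (of_int (l i) * x $ i)) = of_real (kcoef M l) * cis (latt l \<bullet> x)"
      unfolding kcoef_def prod.distrib of_real_prod by simp
  qed simp
  finally show ?thesis .
qed

lemma kern_even: "kern M (y - x) = kern M (x - y)"
  unfolding kern_def by (simp add: cos_diff mult.commute)

lemma kern_factor_bounds: "0 \<le> (1 + cos (t::real)) / 2" "(1 + cos t) / 2 \<le> 1"
proof -
  have "-1 \<le> c \<Longrightarrow> c \<le> 1 \<Longrightarrow> 0 \<le> (1 + c) / 2 \<and> (1 + c) / 2 \<le> 1" for c :: real by simp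
  from this[OF cos_ge_minus_one cos_le_one] show "0 \<le> (1 + cos t) / 2" "(1 + cos t) / 2 \<le> 1" by blast+
qed

lemma kern_nonneg: "0 \<le> kern M x"
  unfolding kern_def using kern_factor_bounds by (intro prod_nonneg) auto

lemma kern_eq_power: "kern M x = kern 1 x ^ M"
  unfolding kern_def by (simp add: prod_power_distrib)

lemma continuous_kern: "continuous_on S (kern M)"
  unfolding kern_def by (intro continuous_intros) auto

text \<open>Some coordinate t of \<open>w\<close> satisfies 0 < |t| <= 2 <= pi, so cos t < 1 there;
  the other factors are at most 1.\<close>

lemma kern_1_lt_1:
  assumes "w \<in> kcube" "w \<noteq> 0"
  shows "kern 1 w < 1"
proof -
  obtain i where i: "w $ i \<noteq> 0" using assms(2) by (auto simp: vec_eq_iff)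
  have "\<bar>w $ i\<bar> \<le> 2" using assms(1) unfolding mem_kcube by blast
  then have "cos \<bar>w $ i\<bar> < cos 0" using i pi_ge_two by (intro cos_monotone_0_pi) auto
  then have c: "cos (w $ i) < 1" by simp
  have "kern 1 w = (1 + cos (w $ i)) / 2 * (\<Prod>j\<in>UNIV - {i}. (1 + cos (w $ j)) / 2)"
    unfolding kern_def by (subst prod.remove[of _ i]) auto
  also have "\<dots> \<le> (1 + cos (w $ i)) / 2 * 1"
    using kern_factor_bounds by (intro mult_left_mono prod_le_1) auto
  finally show ?thesis using c by auto
qed

text \<open>Passing from M to M + 1 multiplies the left side by (2M + 1)(2M + 3) / (2M + 2)^2, which
  is at most 1. The resulting order M^(-1/2) matches the lower bound for the kernel mass in each
  dimension.\<close>

lemma central_binomial_sq_le: "(real (2 * M choose M) / 4 ^ M)\<^sup>2 * (2 * real M + 1) \<le> 1"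
proof (induction M)
  case (Suc M)
  define c where "c = real (2 * M choose M)"
  \<comment> \<open>Two absorption identities and the symmetry of binomial coefficients; one common
    factor M + 1 cancels.\<close>
  have "Suc M * (2 * Suc M choose Suc M) = 2 * ((2 * M + 1) * (2 * M choose M))"
  proof -
    have "Suc M * (Suc (Suc (2 * M)) choose Suc M) = Suc (Suc (2 * M)) * (Suc (2 * M) choose M)"
      using Suc_times_binomial_eq[of "Suc (2 * M)" M] by (simp only: mult.commute)
    moreover have "Suc M * (Suc (2 * M) choose Suc M) = Suc (2 * M) * (2 * M choose M)"
      using Suc_times_binomial_eq[of "2 * M" M] by (simp only: mult.commute)
    moreover have "Suc (2 * M) choose M = (Suc (2 * M) choose Suc M)"
      using binomial_symmetric[of M "Suc (2 * M)"] by (simp add: Suc_diff_le del: binomial_Suc_Suc)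
    ultimately have "Suc M * (Suc M * (Suc (Suc (2 * M)) choose Suc M)) = Suc (Suc (2 * M)) * (Suc (2 * M) * (2 * M choose M))"
      by (metis mult.left_commute)
    then have "Suc M * (Suc M * (2 * Suc M choose Suc M)) = Suc M * (2 * ((2 * M + 1) * (2 * M choose M)))"
      by (simp del: binomial_Suc_Suc)
    then show ?thesis by (simp only: mult_cancel1) simp
  qed
  then have "real (Suc M) * real (2 * Suc M choose Suc M) = 2 * ((2 * real M + 1) * c)"
    unfolding c_def by (metis (no_types, opaque_lifting) of_nat_1 of_nat_add of_nat_mult of_nat_numeral)
  then have e: "real (2 * Suc M choose Suc M) = 2 * (2 * real M + 1) * c / (real M + 1)"
    by (simp add: field_simps)
  have e': "real (2 * Suc M choose Suc M) / 4 ^ Suc M = (c / 4 ^ M) * ((2 * real M + 1) / (2 * (real M + 1)))"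
    unfolding e by (simp add: divide_simps) (simp add: algebra_simps)
  have "(real (2 * Suc M choose Suc M) / 4 ^ Suc M)\<^sup>2 * (2 * real (Suc M) + 1)
     = ((c / 4 ^ M)\<^sup>2 * (2 * real M + 1)) * ((2 * real M + 1) * (2 * real M + 3) / (2 * (real M + 1))\<^sup>2)"
    unfolding e' power_mult_distrib power_divide[of "2 * real M + 1"] by (simp add: power2_eq_square mult_ac)
  also have "\<dots> \<le> 1 * 1"
  proof (rule mult_mono)
    show "(c / 4 ^ M)\<^sup>2 * (2 * real M + 1) \<le> 1" using Suc c_def by simp
    show "(2 * real M + 1) * (2 * real M + 3) / (2 * (real M + 1))\<^sup>2 \<le> 1"
    proof -
      have "(2 * real M + 1) * (2 * real M + 3) \<le> (2 * (real M + 1))\<^sup>2" by (simp add: power2_eq_square algebra_simps)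
      moreover have "0 < (2 * (real M + 1))\<^sup>2" by (intro zero_less_power) simp
      ultimately show ?thesis by (simp only: divide_le_eq_1_pos)
    qed
  qed auto
  finally show ?case by simp
qed simp

lemma kcoef_nonneg: "0 \<le> kcoef M l"
  unfolding kcoef_def by (intro prod_nonneg) auto

lemma kcoef_le:
  fixes l :: "'n::finite \<Rightarrow> int"
  assumes "M \<ge> 1"
  shows "kcoef M l \<le> (1 / sqrt (real M)) ^ CARD('n)"
proof -
  have c: "real (2 * M choose M) / 4 ^ M \<le> 1 / sqrt (real M)"
  proof (rule power2_le_imp_le)
    have "(real (2 * M choose M) / 4 ^ M)\<^sup>2 * real M \<le> (real (2 * M choose M) / 4 ^ M)\<^sup>2 * (2 * real M + 1)"
      by (intro mult_left_mono) auto
    then have "(real (2 * M choose M) / 4 ^ M)\<^sup>2 * real M \<le> 1" using central_binomial_sq_le[of M] by linarith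
    then show "(real (2 * M choose M) / 4 ^ M)\<^sup>2 \<le> (1 / sqrt (real M))\<^sup>2" using assms
      by (simp add: field_simps)
  qed auto
  have "kcoef M l \<le> (\<Prod>i\<in>(UNIV::'n set). 1 / sqrt (real M))"
    unfolding kcoef_def
  proof (rule prod_mono, intro conjI)
    fix i
    have "real (2 * M choose nat (int M + l i)) / 4 ^ M \<le> real (2 * M choose M) / 4 ^ M"
      using binomial_maximum'[of M] by (intro divide_right_mono) auto
    then show "real (2 * M choose nat (int M + l i)) / 4 ^ M \<le> 1 / sqrt (real M)" using c by linarith
  qed auto
  then show ?thesis by simp
qed

lemma integrable_on_kcube:
  fixes f :: "real^'n::finite \<Rightarrow> 'b::{banach, second_countable_topology}"
  assumes "continuous_on UNIV f"
  shows "integrable lborel (\<lambda>w. indicator kcube w *\<^sub>R f w)"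
  using assms unfolding kcube_def by (intro borel_integrable_compact compact_cbox) (auto intro: continuous_on_subset)

text \<open>On the cube with half side s = 1 / sqrt M each factor of the kernel is at least 3/4: cos
  t >= 1 - t^2/2 and Bernoulli's inequality give (1 - s^2/4)^M >= 1 - M s^2/4 = 3/4. Together with
  the volume (2s)^n this is (3/2)^n s^n.\<close>

lemma kmass_ge:
  assumes "M \<ge> 1"
  shows "(1 / sqrt (real M)) ^ CARD('n) \<le> kmass TYPE('n::finite) M"
proof -
  define s where "s = 1 / sqrt (real M)"
  have s: "0 < s" "s \<le> 1" "s\<^sup>2 * real M = 1" using assms by (auto simp: s_def power_divide)
  define R :: "(real^'n) set" where "R = cbox (\<chi> i. - s) (\<chi> i. s)"
  have mR: "measure lborel R = (2 * s) ^ CARD('n)"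
    using s content_cbox_cart[of "(\<chi> i. - s)::real^'n" "\<chi> i. s"] by (auto simp: R_def interval_eq_empty_cart)
  have "s ^ CARD('n) \<le> (3/4) ^ CARD('n) * (2 * s) ^ CARD('n)"
    unfolding power_mult_distrib[symmetric] using s by (intro power_mono) auto
  also have "\<dots> = (LINT w|lborel. (3/4) ^ CARD('n) * indicat_real R w)" by (simp add: mR)
  also have "\<dots> \<le> (LINT w|lborel. indicator kcube w * kern M (w :: real^'n))"
  proof (rule integral_mono)
    show "integrable lborel (\<lambda>w. (3/4) ^ CARD('n) * indicat_real R w)"
      unfolding R_def by (intro integrable_mult_right integrable_real_indicator) (use emeasure_lborel_cbox_finite in auto)
    show "integrable lborel (\<lambda>w. indicator kcube w * kern M (w::real^'n))"
      using integrable_on_kcube[OF continuous_kern, of M] by simp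
    fix w :: "real^'n"
    show "(3/4) ^ CARD('n) * indicat_real R w \<le> indicator kcube w * kern M w"
    proof (cases "w \<in> R")
      case True
      then have wi: "\<bar>w $ i\<bar> \<le> s" for i unfolding R_def mem_box_cart by (auto simp: abs_le_iff dest: spec[of _ i])
      have "\<bar>w $ i\<bar> \<le> 2" for i using wi[of i] s by linarith
      then have k: "w \<in> kcube" unfolding mem_kcube by blast
      have f: "3/4 \<le> ((1 + cos (w $ i)) / 2) ^ M" for i
      proof -
        have "(w $ i)\<^sup>2 \<le> s\<^sup>2" using wi[of i] by (meson abs_ge_zero power2_le_iff_abs_le s(1) less_imp_le)
        moreover have "1 - (w $ i)\<^sup>2 / 2 \<le> cos (w $ i)" 
        proof -
          have "cos (w $ i) = 1 - 2 * (sin (w $ i / 2))\<^sup>2" using cos_double_sin[of "w $ i / 2"] by simp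
          moreover have "(sin (w $ i / 2))\<^sup>2 \<le> (w $ i / 2)\<^sup>2"
            using abs_sin_x_le_abs_x[of "w $ i / 2"] abs_le_square_iff by blast
          ultimately show ?thesis by (simp add: power2_eq_square)
        qed
        ultimately have b: "1 + (- (s\<^sup>2 / 4)) \<le> (1 + cos (w $ i)) / 2" by simp
        have s1: "s\<^sup>2 \<le> 1" using s by (simp add: power_le_one)
        have "3/4 = 1 + real M * (- (s\<^sup>2 / 4))" using s(3) by (simp add: mult.commute)
        also have "\<dots> \<le> (1 + (- (s\<^sup>2 / 4))) ^ M" using s1 by (intro Bernoulli_inequality) auto
        also have "\<dots> \<le> ((1 + cos (w $ i)) / 2) ^ M" using b s1 by (intro power_mono) auto
        finally show ?thesis .
      qed
      have "(\<Prod>i\<in>(UNIV::'n set). 3/4::real) \<le> kern M w" unfolding kern_def using f by (intro prod_mono) auto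
      then show ?thesis using True k by simp
    next
      case False
      then show ?thesis using kern_nonneg[of M w] by (simp add: indicator_def)
    qed
  qed
  finally show ?thesis unfolding kmass_def s_def .
qed

lemma kmass_pos: "M \<ge> 1 \<Longrightarrow> 0 < kmass TYPE('n::finite) M"
  using kmass_ge[of M, where 'n='n] by (rule less_le_trans[rotated]) auto

text \<open>The upper bound for the coefficients and the lower bound for the mass are the same
  expression. Damped coefficients are thus never larger than the original ones, and the later
  estimates are uniform in \<open>M\<close>.\<close>

lemma kcoef_kmass:
  fixes l :: "'n::finite \<Rightarrow> int"
  assumes "M \<ge> 1"
  shows "0 \<le> kcoef M l / kmass TYPE('n) M" "kcoef M l / kmass TYPE('n) M \<le> 1"
  using kcoef_le[OF assms, of l] kmass_ge[OF assms, where 'n='n] kmass_pos[OF assms, where 'n='n] kcoef_nonneg[of M l]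
  by (auto simp: divide_le_eq_1)

text \<open>A Fourier series damped by the coefficients of the normalised kernel; on the ball it is
  the convolution with that kernel.\<close>

definition trig_approx :: "nat \<Rightarrow> (real^'n::finite \<Rightarrow> complex) \<Rightarrow> real^'n \<Rightarrow> complex" where
  "trig_approx M \<phi> x = (\<Sum>l\<in>kbox M. of_real (kcoef M l / kmass TYPE('n) M) * fcoef l \<phi> * cis (latt l \<bullet> x))"

text \<open>Insert the definition of the coefficients, sum the characters back to the kernel, and
  translate. Wherever the integrand is nonzero, x and x + w both lie in the ball, so w lies in
  \<open>kcube\<close>.\<close>

lemma trig_approx_eq_integral:
  fixes \<phi> :: "real^'n::finite \<Rightarrow> complex"
  assumes c: "continuous_on UNIV \<phi>" and s: "\<And>x. x \<notin> cball z d \<Longrightarrow> \<phi> x = 0"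
    and d: "d < 1" and x: "x \<in> cball z d" and M: "M \<ge> 1"
  shows "of_real (kmass TYPE('n) M) * trig_approx M \<phi> x
    = (LINT w|lborel. indicator kcube w *\<^sub>R (\<phi> (x + w) * of_real (kern M w)))"
proof -
  have "of_real (kmass TYPE('n) M) * trig_approx M \<phi> x
     = (\<Sum>l\<in>kbox M. of_real (kcoef M l) * cis (latt l \<bullet> x) * fcoef l \<phi>)"
    unfolding trig_approx_def using kmass_pos[OF M, where 'n='n] by (simp add: sum_distrib_left field_simps)
  also have "\<dots> = (\<Sum>l\<in>kbox M. (LINT y|lborel. of_real (kcoef M l) * cis (latt l \<bullet> x) * (cis (- (latt l \<bullet> y)) * \<phi> y)))"
    unfolding fcoef_def by simp
  also have "\<dots> = (LINT y|lborel. (\<Sum>l\<in>kbox M. of_real (kcoef M l) * cis (latt l \<bullet> x) * (cis (- (latt l \<bullet> y)) * \<phi> y)))"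
    by (intro Bochner_Integration.integral_sum[symmetric] integrable_mult_right integrable_fcoef[of _ z d] c s)
  also have "(\<lambda>y. \<Sum>l\<in>kbox M. of_real (kcoef M l) * cis (latt l \<bullet> x) * (cis (- (latt l \<bullet> y)) * \<phi> y)) = (\<lambda>y. \<phi> y * of_real (kern M (y - x)))"
  proof
    fix y
    have e: "cis (latt l \<bullet> (x - y)) = cis (latt l \<bullet> x) * cis (- (latt l \<bullet> y))" for l :: "'n \<Rightarrow> int"
      by (simp add: cis_mult inner_diff_right)
    show "(\<Sum>l\<in>kbox M. of_real (kcoef M l) * cis (latt l \<bullet> x) * (cis (- (latt l \<bullet> y)) * \<phi> y)) = \<phi> y * of_real (kern M (y - x))"
      unfolding kern_even[of M y x] kern_expansion e by (simp add: sum_distrib_left mult_ac)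
  qed
  also have "(LINT y|lborel. \<phi> y * of_real (kern M (y - x))) = (LINT w|lborel. \<phi> (x + w) * of_real (kern M (x + w - x)))"
  proof (rule integral_translation[symmetric])
    show "(\<lambda>y. \<phi> y * of_real (kern M (y - x))) \<in> borel_measurable borel"
      by (intro borel_measurable_continuous_onI continuous_intros c continuous_on_compose2[OF continuous_kern[of UNIV]]) auto
  qed
  also have "(\<lambda>w. \<phi> (x + w) * of_real (kern M (x + w - x))) = (\<lambda>w. indicator kcube w *\<^sub>R (\<phi> (x + w) * of_real (kern M w)))"
  proof
    fix w
    have "w \<in> kcube" if "\<phi> (x + w) \<noteq> 0"
    proof -
      have "dist z (x + w) \<le> d" using s that by (metis mem_cball)
      moreover have "norm w = dist x (x + w)" by (simp add: dist_norm)
      moreover have "dist x (x + w) \<le> dist x z + dist z (x + w)" by (rule dist_triangle)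
      ultimately have "norm w \<le> 2" using x d by (simp add: dist_commute)
      then have "\<bar>w $ i\<bar> \<le> 2" for i using component_le_norm_cart[of w i] by linarith
      then show ?thesis unfolding mem_kcube by blast
    qed
    then show "\<phi> (x + w) * of_real (kern M (x + w - x)) = indicator kcube w *\<^sub>R (\<phi> (x + w) * of_real (kern M w))"
      by (auto simp: indicator_def)
  qed
  finally show ?thesis .
qed

text \<open>For n > 0 the term is the n-th power of M s^M, where s is the n-th root of q.\<close>

lemma power_times_exp_small:
  fixes q :: real
  assumes "0 < q" "q < 1"
  shows "(\<lambda>M. real M ^ n * q ^ M) \<longlonglongrightarrow> 0"
proof (cases n)
  case 0
  then show ?thesis using assms by (simp add: LIMSEQ_realpow_zero)
next
  case (Suc k)
  define s where "s = root n q"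
  have s: "0 < s" "s < 1" "s ^ n = q" using assms Suc real_root_pow_pos[of n q] by (auto simp: s_def simp del: power_Suc)
  have "(\<lambda>M. (real M * s ^ M) ^ n) \<longlonglongrightarrow> 0 ^ n"
    using s powser_times_n_limit_0[of s] by (intro tendsto_power) auto
  moreover have "(real M * s ^ M) ^ n = real M ^ n * q ^ M" for M
    by (simp add: power_mult_distrib s(3)[symmetric] mult.commute flip: power_mult)
  moreover have "(0::real) ^ n = 0" using Suc by simp
  ultimately show ?thesis by simp
qed

text \<open>The argument for approximate identities: small displacements are controlled by uniform
  continuity, the others by the kernel bound q^M with q < 1. Dividing by the mass costs at most a
  power of M, which the exponential absorbs.\<close>

lemma trig_approx_uniform:
  fixes \<phi> :: "real^'n::finite \<Rightarrow> complex"
  assumes c: "continuous_on UNIV \<phi>" and s: "\<And>x. x \<notin> cball z d \<Longrightarrow> \<phi> x = 0" and d: "d < 1" and \<eta>: "\<eta> > 0"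
  shows "\<forall>\<^sub>F M in sequentially. \<forall>x\<in>cball z d. norm (\<phi> x - trig_approx M \<phi> x) \<le> \<eta>"
proof -
  \<comment> \<open>The radius leaves room for x + w with w in \<open>kcube\<close>, by a crude
    bound of 4 per coordinate.\<close>
  have "uniformly_continuous_on (cball z (d + 4 * real CARD('n))) \<phi>"
    by (rule compact_uniformly_continuous) (auto intro: continuous_on_subset[OF c])
  then obtain r where r: "r > 0" "\<And>x y. x \<in> cball z (d + 4 * real CARD('n)) \<Longrightarrow> y \<in> cball z (d + 4 * real CARD('n)) \<Longrightarrow> dist y x < r \<Longrightarrow> dist (\<phi> y) (\<phi> x) < \<eta> / 2"
    using \<eta> unfolding uniformly_continuous_on_def by (meson half_gt_zero)
  obtain B where B: "B > 0" "\<And>x. norm (\<phi> x) \<le> B"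
  proof -
    have "compact (\<phi> ` cball z d)"
      using c by (intro compact_continuous_image) (auto intro: continuous_on_subset)
    then obtain B where B: "\<forall>y\<in>\<phi> ` cball z d. norm y \<le> B" 
      using compact_imp_bounded bounded_iff by metis
    have "norm (\<phi> x) \<le> max B 1" for x
      using s[of x] B by (cases "x \<in> cball z d") (auto simp: le_max_iff_disj)
    then show ?thesis using that[of "max B 1"] by auto
  qed
  \<comment> \<open>Compactness of the cube without a neighbourhood of 0. The value 1/2 keeps q
    positive and serves the case that this set is empty.\<close>
  obtain q where q: "0 < q" "q < 1" "\<And>w. w \<in> kcube \<Longrightarrow> r \<le> norm w \<Longrightarrow> kern 1 (w::real^'n) \<le> q"
  proof -
    define S :: "(real^'n) set" where "S = kcube - ball 0 r"
    have S: "compact S" unfolding S_def kcube_def by (intro compact_diff compact_cbox open_ball)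
    show ?thesis
    proof (cases "S = {}")
      case True
      then show ?thesis by (intro that[of "1/2"]) (force simp: S_def)+
    next
      case False
      then obtain w0 where w0: "w0 \<in> S" "\<forall>w\<in>S. kern 1 w \<le> kern 1 w0"
        using continuous_attains_sup[OF S False continuous_kern] by blast
      have "w0 \<noteq> 0" using w0 r(1) by (auto simp: S_def)
      then have "kern 1 w0 < 1" using w0 by (intro kern_1_lt_1) (auto simp: S_def)
      then show ?thesis using that[of "max (1/2) (kern 1 w0)"] w0 by (auto simp: S_def le_max_iff_disj)
    qed
  qed
  define V where "V = measure lborel (kcube :: (real^'n) set)"
  have "(\<lambda>M. 2 * B * V * (real M ^ CARD('n) * q ^ M)) \<longlonglongrightarrow> 2 * B * V * 0"
    by (intro tendsto_mult_left power_times_exp_small q)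
  then have "\<forall>\<^sub>F M in sequentially. 2 * B * V * (real M ^ CARD('n) * q ^ M) < \<eta> / 2"
    using \<eta> by (intro order_tendstoD(2)) auto
  then show ?thesis using eventually_ge_at_top[of 1]
  proof eventually_elim
    case (elim M)
    define \<kappa> where "\<kappa> = kmass TYPE('n) M"
    have \<kappa>: "\<kappa> > 0" unfolding \<kappa>_def using elim(2) by (rule kmass_pos)
    \<comment> \<open>The mass is at least M^(-n/2), hence at least M^(-n), and an integer power is
      what \<open>power_times_exp_small\<close> absorbs.\<close>
    have "1 \<le> real M ^ CARD('n) * \<kappa>"
    proof -
      have "1 \<le> real M * (1 / sqrt (real M))" using elim(2) by (simp add: real_div_sqrt)
      then have "1 \<le> (real M * (1 / sqrt (real M))) ^ CARD('n)" by (rule one_le_power)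
      also have "\<dots> \<le> real M ^ CARD('n) * \<kappa>"
        unfolding power_mult_distrib \<kappa>_def using kmass_ge[OF elim(2), where 'n='n] by (intro mult_left_mono) auto
      finally show ?thesis .
    qed
    then have qk: "q ^ M \<le> real M ^ CARD('n) * q ^ M * \<kappa>" using q(1) by (simp add: mult_ac)
    show ?case
    proof
      fix x assume x: "x \<in> cball z d"
      have I1: "integrable lborel (\<lambda>w. indicator kcube w *\<^sub>R (\<phi> (x + w) * of_real (kern M w)))"
        by (intro integrable_on_kcube continuous_intros continuous_kern continuous_on_compose2[OF c]) auto
      have I2: "integrable lborel (\<lambda>w. indicator kcube w *\<^sub>R (\<phi> x * complex_of_real (kern M (w::real^'n))))"
        by (intro integrable_on_kcube continuous_intros continuous_kern)
      have I3: "integrable lborel (\<lambda>w. indicator kcube w * kern M (w::real^'n))"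
        using integrable_on_kcube[OF continuous_kern, of M] by simp
      have I4: "integrable lborel (\<lambda>w. 2 * B * q ^ M * indicat_real (kcube::(real^'n) set) w)"
        unfolding kcube_def by (intro integrable_mult_right integrable_real_indicator) (use emeasure_lborel_cbox_finite in auto)
      have e1: "of_real \<kappa> * trig_approx M \<phi> x = (LINT w|lborel. indicator kcube w *\<^sub>R (\<phi> (x + w) * of_real (kern M w)))"
        unfolding \<kappa>_def by (rule trig_approx_eq_integral[OF c s d x elim(2)])
      have e3: "(\<lambda>w. indicator kcube w *\<^sub>R (\<phi> x * complex_of_real (kern M (w::real^'n)))) = (\<lambda>w. \<phi> x * of_real (indicator kcube w * kern M w))"
        by (auto simp: indicator_def fun_eq_iff)
      have e2: "of_real \<kappa> * \<phi> x = (LINT w|lborel. indicator kcube w *\<^sub>R (\<phi> x * complex_of_real (kern M (w::real^'n))))"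
        unfolding \<kappa>_def kmass_def e3 by (simp only: integral_mult_right_zero integral_complex_of_real mult.commute)
      have "norm (of_real \<kappa> * (\<phi> x - trig_approx M \<phi> x)) = norm (LINT w|lborel. indicator kcube w *\<^sub>R (\<phi> x * complex_of_real (kern M w)) - indicator kcube w *\<^sub>R (\<phi> (x + w) * of_real (kern M w)))"
        unfolding right_diff_distrib e1 e2 using I1 I2 by simp
      also have "\<dots> \<le> (LINT w|lborel. norm (indicator kcube w *\<^sub>R (\<phi> x * complex_of_real (kern M w)) - indicator kcube w *\<^sub>R (\<phi> (x + w) * of_real (kern M w))))"
        by (rule integral_norm_bound)
      also have "\<dots> \<le> (LINT w|lborel. \<eta> / 2 * (indicator kcube w * kern M (w::real^'n)) + 2 * B * q ^ M * indicat_real kcube w)"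
      proof (rule integral_mono)
        show "integrable lborel (\<lambda>w. norm (indicator kcube w *\<^sub>R (\<phi> x * complex_of_real (kern M w)) - indicator kcube w *\<^sub>R (\<phi> (x + w) * of_real (kern M w))))"
          by (intro integrable_norm Bochner_Integration.integrable_diff I1 I2)
        show "integrable lborel (\<lambda>w. \<eta> / 2 * (indicator kcube w * kern M (w::real^'n)) + 2 * B * q ^ M * indicat_real kcube w)"
          by (intro Bochner_Integration.integrable_add integrable_mult_right I3 I4)
        fix w :: "real^'n"
        show "norm (indicator kcube w *\<^sub>R (\<phi> x * complex_of_real (kern M w)) - indicator kcube w *\<^sub>R (\<phi> (x + w) * of_real (kern M w)))
           \<le> \<eta> / 2 * (indicator kcube w * kern M w) + 2 * B * q ^ M * indicat_real kcube w"
        proof (cases "w \<in> kcube")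
          case True
          have n: "norm (\<phi> x * complex_of_real (kern M w) - \<phi> (x + w) * of_real (kern M w)) = norm (\<phi> x - \<phi> (x + w)) * kern M w"
            using kern_nonneg[of M w] by (simp add: norm_mult flip: left_diff_distrib)
          have "norm (\<phi> x - \<phi> (x + w)) * kern M w \<le> \<eta> / 2 * kern M w + 2 * B * q ^ M"
          proof (cases "norm w < r")
            case True
            have "norm w \<le> (\<Sum>i\<in>UNIV. \<bar>w $ i\<bar>)" by (rule norm_le_l1_cart)
            also have "\<dots> \<le> (\<Sum>i\<in>(UNIV::'n set). 4)"
              using \<open>w \<in> kcube\<close> unfolding mem_kcube by (intro sum_mono) (auto intro: order_trans)
            finally have "dist x (x + w) \<le> 4 * real CARD('n)" by (simp add: dist_norm)
            then have "x + w \<in> cball z (d + 4 * real CARD('n))" using x dist_triangle[of z "x + w" x] by auto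
            moreover have "x \<in> cball z (d + 4 * real CARD('n))" using x by (auto intro: order_trans)
            ultimately have "dist (\<phi> (x + w)) (\<phi> x) < \<eta> / 2" using True by (intro r(2)) (auto simp: dist_norm)
            then have "norm (\<phi> x - \<phi> (x + w)) * kern M w \<le> \<eta> / 2 * kern M w"
              using kern_nonneg[of M w] by (intro mult_right_mono) (auto simp: dist_norm norm_minus_commute)
            then show ?thesis using B q by (smt (verit) mult_nonneg_nonneg zero_le_power)
          next
            case False
            then have "kern M w \<le> q ^ M" 
              unfolding kern_eq_power[of M] using q(3)[OF \<open>w \<in> kcube\<close>] kern_nonneg[of 1 w] by (intro power_mono) auto
            moreover have "norm (\<phi> x - \<phi> (x + w)) \<le> 2 * B" using B(2)[of x] B(2)[of "x+w"] norm_triangle_ineq4[of "\<phi> x" "\<phi> (x+w)"] by linarith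
            ultimately have "norm (\<phi> x - \<phi> (x + w)) * kern M w \<le> 2 * B * q ^ M" using B kern_nonneg[of M w] by (intro mult_mono) auto
            then show ?thesis using \<eta> kern_nonneg[of M w] by (smt (verit) mult_nonneg_nonneg half_gt_zero)
          qed
          then show ?thesis using True n by simp
        qed simp
      qed
      also have "\<dots> = \<eta> / 2 * \<kappa> + 2 * B * q ^ M * V"
        using I3 I4 unfolding \<kappa>_def kmass_def V_def
        by (subst Bochner_Integration.integral_add) auto
      also have "\<dots> \<le> \<eta> / 2 * \<kappa> + 2 * B * (real M ^ CARD('n) * q ^ M * \<kappa>) * V"
        using qk B by (intro add_left_mono mult_right_mono mult_left_mono) (auto simp: V_def)
      also have "\<dots> = \<kappa> * (\<eta> / 2 + 2 * B * V * (real M ^ CARD('n) * q ^ M))" by (simp add: algebra_simps)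
      also have "\<dots> \<le> \<kappa> * \<eta>" using elim(1) \<kappa> by (intro mult_left_mono) auto
      finally show "norm (\<phi> x - trig_approx M \<phi> x) \<le> \<eta>" using \<kappa> by (simp add: norm_mult)
    qed
  qed
qed

section \<open>Lattice sums and bounds for functions by their coefficients\<close>

lemma sum_inverse_squares_le: "(\<Sum>j\<in>{- int M..int M}. inverse (1 + \<bar>real_of_int j\<bar>) ^ 2) \<le> 4"
proof -
  have a: "(\<Sum>j\<le>M. inverse (1 + real j) ^ 2) \<le> 2 - 1 / (1 + real M)"
  proof (induction M)
    case (Suc M)
    \<comment> \<open>The telescoping comparison; each half of the integer range then contributes at
      most 2.\<close>
    have "inverse (2 + real M) ^ 2 \<le> 1 / (1 + real M) - 1 / (2 + real M)"
      by (simp add: divide_simps power2_eq_square)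
    then show ?case using Suc by simp
  qed simp
  have "(\<Sum>j\<in>{- int M..int M}. inverse (1 + \<bar>real_of_int j\<bar>) ^ 2) \<le> (\<Sum>j\<in>int ` {..M} \<union> (\<lambda>j. - int j) ` {..M}. inverse (1 + \<bar>real_of_int j\<bar>) ^ 2)"
  proof (rule sum_mono2)
    show "{- int M..int M} \<subseteq> int ` {..M} \<union> (\<lambda>j. - int j) ` {..M}"
    proof
      fix j assume "j \<in> {- int M..int M}"
      then show "j \<in> int ` {..M} \<union> (\<lambda>j. - int j) ` {..M}"
        by (cases "j \<ge> 0") (auto intro: image_eqI[of _ _ "nat j"] image_eqI[of _ _ "nat (- j)"])
    qed
  qed auto
  also have "\<dots> \<le> (\<Sum>j\<in>int ` {..M}. inverse (1 + \<bar>real_of_int j\<bar>) ^ 2) + (\<Sum>j\<in>(\<lambda>j. - int j) ` {..M}. inverse (1 + \<bar>real_of_int j\<bar>) ^ 2)"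
    by (subst sum.union_inter[symmetric]) (auto intro: sum_nonneg)
  also have "\<dots> = 2 * (\<Sum>j\<le>M. inverse (1 + real j) ^ 2)"
    by (subst (1 2) sum.reindex) (auto simp: inj_on_def)
  finally have "(\<Sum>j\<in>{- int M..int M}. inverse (1 + \<bar>real_of_int j\<bar>) ^ 2) \<le> 2 * (2 - 1 / (1 + real M))" using mult_left_mono[OF a, of 2] by simp
  moreover have "1 / (1 + real M) \<ge> 0" by simp
  ultimately show ?thesis by argo
qed

text \<open>Since |l_i| <= |l| for each i, the summand is dominated by a product over the
  coordinates, and the sum of that factorises into one-dimensional sums of inverse squares. This is
  the origin of the exponent \<open>2 * CARD('n)\<close> and the constant
  \<open>4 ^ CARD('n)\<close> in the estimates below.\<close>

lemma sum_kbox_le: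
  "(\<Sum>l\<in>(kbox M :: ('n::finite \<Rightarrow> int) set). inverse ((1 + norm (latt l)) ^ (2 * CARD('n)))) \<le> 4 ^ CARD('n)"
proof -
  have "(\<Sum>l\<in>(kbox M :: ('n \<Rightarrow> int) set). inverse ((1 + norm (latt l)) ^ (2 * CARD('n)))) 
     \<le> (\<Sum>l\<in>(kbox M :: ('n \<Rightarrow> int) set). \<Prod>i\<in>UNIV. inverse (1 + \<bar>real_of_int (l i)\<bar>) ^ 2)"
  proof (rule sum_mono)
    fix l :: "'n \<Rightarrow> int"
    have "inverse ((1 + norm (latt l)) ^ (2 * CARD('n))) = (\<Prod>i\<in>(UNIV::'n set). inverse (1 + norm (latt l)) ^ 2)"
      by (simp add: power_inverse flip: power_mult)
    also have "\<dots> \<le> (\<Prod>i\<in>UNIV. inverse (1 + \<bar>real_of_int (l i)\<bar>) ^ 2)"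
    proof (intro prod_mono conjI power_mono le_imp_inverse_le)
      fix i
      show "1 + \<bar>real_of_int (l i)\<bar> \<le> 1 + norm (latt l)" using component_le_norm_cart[of "latt l" i] by (simp add: latt_def)
    qed (auto intro: add_pos_nonneg)
    finally show "inverse ((1 + norm (latt l)) ^ (2 * CARD('n))) \<le> (\<Prod>i\<in>UNIV. inverse (1 + \<bar>real_of_int (l i)\<bar>) ^ 2)" .
  qed
  also have "\<dots> = (\<Prod>i\<in>(UNIV::'n set). \<Sum>j\<in>{- int M..int M}. inverse (1 + \<bar>real_of_int j\<bar>) ^ 2)"
    unfolding kbox_def by (intro prod_sum_PiE[symmetric]) auto
  also have "\<dots> \<le> (\<Prod>i\<in>(UNIV::'n set). 4)"
    by (intro prod_mono conjI sum_inverse_squares_le sum_nonneg) auto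
  finally show ?thesis by simp
qed

lemma sum_kbox_bound:
  fixes F :: "('n::finite \<Rightarrow> int) \<Rightarrow> complex"
  assumes "\<And>l. norm (F l) * (1 + norm (latt l)) ^ (2 * CARD('n)) \<le> B"
  shows "norm (\<Sum>l\<in>kbox M. F l) \<le> 4 ^ CARD('n) * B"
proof -
  have B: "0 \<le> B" using assms[of "\<lambda>_. 0"] by (rule order_trans[rotated]) auto
  have "norm (\<Sum>l\<in>kbox M. F l) \<le> (\<Sum>l\<in>(kbox M :: ('n \<Rightarrow> int) set). B * inverse ((1 + norm (latt l)) ^ (2 * CARD('n))))"
  proof (rule order_trans[OF norm_sum sum_mono])
    fix l :: "'n \<Rightarrow> int" assume "l \<in> kbox M"
    have "0 < (1 + norm (latt l)) ^ (2 * CARD('n))" by (intro zero_less_power add_pos_nonneg) auto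
    then show "norm (F l) \<le> B * inverse ((1 + norm (latt l)) ^ (2 * CARD('n)))"
      using assms[of l] by (simp add: field_simps)
  qed
  also have "\<dots> \<le> B * 4 ^ CARD('n)"
    unfolding sum_distrib_left[symmetric] using B by (intro mult_left_mono sum_kbox_le)
  finally show ?thesis by (simp add: mult.commute)
qed

text \<open>The damped sums are bounded uniformly in \<open>M\<close> and converge to
  \<open>g\<close> on the ball. With \<open>B = 0\<close> this gives the uniqueness theorem: a
  function whose coefficients all vanish is zero.\<close>

lemma sup_le_fcoef:
  fixes g :: "real^'n::finite \<Rightarrow> complex"
  assumes c: "continuous_on UNIV g" and s: "\<And>x. x \<notin> cball z d \<Longrightarrow> g x = 0" and d: "d < 1"
    and B: "\<And>l. norm (fcoef l g) * (1 + norm (latt l)) ^ (2 * CARD('n)) \<le> B"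
  shows "norm (g x) \<le> 4 ^ CARD('n) * B"
proof (cases "x \<in> cball z d")
  case True
  show ?thesis
  proof (rule field_le_epsilon)
    fix \<eta> :: real assume "\<eta> > 0"
    from eventually_conj[OF trig_approx_uniform[OF c s d this] eventually_ge_at_top[of 1]]
    obtain M where M: "M \<ge> 1" "\<forall>x\<in>cball z d. norm (g x - trig_approx M g x) \<le> \<eta>"
      using eventually_happens'[of sequentially] by force
    have "norm (trig_approx M g x) \<le> 4 ^ CARD('n) * B"
      unfolding trig_approx_def
    proof (rule sum_kbox_bound)
      fix l :: "'n \<Rightarrow> int"
      let ?t = "complex_of_real (kcoef M l / kmass TYPE('n) M) * fcoef l g * cis (latt l \<bullet> x)"
      have "norm ?t = (kcoef M l / kmass TYPE('n) M) * norm (fcoef l g)"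
        using kcoef_kmass(1)[OF M(1), of l] by (simp only: norm_mult norm_of_real norm_cis abs_of_nonneg mult_1_right)
      also have "\<dots> \<le> 1 * norm (fcoef l g)" by (rule mult_right_mono[OF kcoef_kmass(2)[OF M(1)] norm_ge_zero])
      finally have "norm ?t * (1 + norm (latt l)) ^ (2 * CARD('n))
         \<le> norm (fcoef l g) * (1 + norm (latt l)) ^ (2 * CARD('n))" by (intro mult_right_mono) auto
      then show "norm ?t * (1 + norm (latt l)) ^ (2 * CARD('n)) \<le> B"
        using B[of l] by linarith
    qed
    then show "norm (g x) \<le> 4 ^ CARD('n) * B + \<eta>"
      using M(2)[rule_format, OF True] norm_triangle_ineq2[of "g x" "trig_approx M g x"] by linarith
  qed
next
  case False
  have "0 \<le> B" using B[of "\<lambda>_. 0"] by (rule order_trans[rotated]) auto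
  then show ?thesis using s[OF False] by simp
qed

section \<open>Products and commutators with a cutoff\<close>

lemma fcoef_trig_approx_mult:
  assumes "continuous_on UNIV v" "\<And>x. x \<notin> cball z d \<Longrightarrow> v x = 0"
  shows "fcoef k (\<lambda>x. trig_approx M \<phi> x * v x)
     = (\<Sum>l\<in>kbox M. of_real (kcoef M l / kmass TYPE('n::finite) M) * fcoef l \<phi> * fcoef (\<lambda>i. k i - l i) (v :: real^'n \<Rightarrow> complex))"
proof -
  have "fcoef k (\<lambda>x. trig_approx M \<phi> x * v x) = fcoef k (\<lambda>x. \<Sum>l\<in>kbox M. (of_real (kcoef M l / kmass TYPE('n) M) * fcoef l \<phi>) * (cis (latt l \<bullet> x) * v x))"
    unfolding trig_approx_def by (simp add: sum_distrib_right mult.assoc)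
  also have "\<dots> = (\<Sum>l\<in>kbox M. (of_real (kcoef M l / kmass TYPE('n) M) * fcoef l \<phi>) * fcoef k (\<lambda>x. cis (latt l \<bullet> x) * v x))"
    using assms by (intro fcoef_lincomb[of _ _ z d]) (auto intro!: continuous_intros)
  finally have "fcoef k (\<lambda>x. trig_approx M \<phi> x * v x) = (\<Sum>l\<in>kbox M. (of_real (kcoef M l / kmass TYPE('n) M) * fcoef l \<phi>) * fcoef k (\<lambda>x. cis (latt l \<bullet> x) * v x))" .
  moreover have "fcoef k (\<lambda>x. cis (latt l \<bullet> x) * v x) = fcoef (\<lambda>i. k i - l i) v" for l
    unfolding fcoef_def latt_diff by (simp add: inner_diff_left cis_mult flip: mult.assoc)
  ultimately show ?thesis by simp
qed

text \<open>Replace the cutoff by a damped sum T. For T the coefficient of a product is a finite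
  convolution, so the commutator becomes a sum of p(k) - p(k - l) against the coefficients of the
  cutoff and of \<open>v\<close>, bounded uniformly in \<open>M\<close>. As \<open>k\<close> is
  fixed, the error of the replacement can be made arbitrarily small.\<close>

lemma fcoef_commutator:
  fixes \<phi> v g :: "real^'n::finite \<Rightarrow> complex"
  assumes \<phi>: "continuous_on UNIV \<phi>" "\<And>x. x \<notin> cball z d \<Longrightarrow> \<phi> x = 0" and d: "d < 1"
    and v: "continuous_on UNIV v" "\<And>x. x \<notin> cball z d \<Longrightarrow> v x = 0"
    and g: "continuous_on UNIV g" "\<And>x. x \<notin> cball z d \<Longrightarrow> g x = 0"
    and p: "\<And>k. fcoef k g = p k * fcoef k v"
    and B: "\<And>l. norm (fcoef l \<phi>) * norm ((p k - p (\<lambda>i. k i - l i)) * fcoef (\<lambda>i. k i - l i) v) * (1 + norm (latt l)) ^ (2 * CARD('n)) \<le> B"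
  shows "norm (p k * fcoef k (\<lambda>x. \<phi> x * v x) - fcoef k (\<lambda>x. \<phi> x * g x)) \<le> 4 ^ CARD('n) * B"
proof (rule field_le_epsilon)
  fix e :: real assume e: "e > 0"
  obtain W where W: "W \<ge> 0" "\<And>x. norm (v x) \<le> W" "\<And>x. norm (g x) \<le> W"
  proof -
    have "compact (v ` cball z d \<union> g ` cball z d)"
      using v g by (intro compact_Un compact_continuous_image) (auto intro: continuous_on_subset)
    then obtain W where "\<forall>y\<in>v ` cball z d \<union> g ` cball z d. norm y \<le> W" 
      using compact_imp_bounded bounded_iff by metis
    then have "norm (v x) \<le> max W 0 \<and> norm (g x) \<le> max W 0" for x
      using v(2)[of x] g(2)[of x] by (cases "x \<in> cball z d") (auto simp: le_max_iff_disj)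
    then show ?thesis using that[of "max W 0"] by auto
  qed
  define Z where "Z = W * measure lborel (cball z d)"
  have Z: "Z \<ge> 0" unfolding Z_def using W by simp
  \<comment> \<open>Chosen so that the two replacement errors, one of them multiplied by p(k),
    amount to at most \<open>e\<close>.\<close>
  define \<eta> where "\<eta> = e / ((norm (p k) + 1) * (Z + 1))"
  have \<eta>: "\<eta> > 0" unfolding \<eta>_def using e Z by (intro divide_pos_pos mult_pos_pos add_nonneg_pos) auto
  from eventually_conj[OF trig_approx_uniform[OF \<phi> d \<eta>] eventually_ge_at_top[of 1]]
  obtain M where M: "M \<ge> 1" "\<forall>x\<in>cball z d. norm (\<phi> x - trig_approx M \<phi> x) \<le> \<eta>"
    using eventually_happens'[of sequentially] by force
  define T where "T = trig_approx M \<phi>"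
  have Tc: "continuous_on UNIV T" unfolding T_def trig_approx_def by (intro continuous_intros)
  have diff: "norm (fcoef k (\<lambda>x. \<phi> x * h x) - fcoef k (\<lambda>x. T x * h x)) \<le> \<eta> * Z"
    if h: "continuous_on UNIV h" "\<And>x. x \<notin> cball z d \<Longrightarrow> h x = 0" "\<And>x. norm (h x) \<le> W" for h
  proof -
    have "fcoef k (\<lambda>x. \<phi> x * h x) = fcoef k (\<lambda>x. T x * h x + (\<phi> x - T x) * h x)" by (simp add: algebra_simps)
    also have "\<dots> = fcoef k (\<lambda>x. T x * h x) + fcoef k (\<lambda>x. (\<phi> x - T x) * h x)"
      using h by (intro fcoef_add[of _ z d]) (auto intro!: continuous_intros Tc \<phi>)
    finally have "fcoef k (\<lambda>x. \<phi> x * h x) - fcoef k (\<lambda>x. T x * h x) = fcoef k (\<lambda>x. (\<phi> x - T x) * h x)" by simp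
    moreover have "norm (fcoef k (\<lambda>x. (\<phi> x - T x) * h x)) \<le> (\<eta> * W) * measure lborel (cball z d)"
    proof (rule norm_fcoef_le)
      show "continuous_on UNIV (\<lambda>x. (\<phi> x - T x) * h x)" using h by (auto intro!: continuous_intros Tc \<phi>)
      show "x \<notin> cball z d \<Longrightarrow> (\<phi> x - T x) * h x = 0" for x using h by simp
      show "x \<in> cball z d \<Longrightarrow> norm ((\<phi> x - T x) * h x) \<le> \<eta> * W" for x
        unfolding norm_mult using M(2) h(3)[of x] \<eta> by (intro mult_mono) (auto simp: T_def)
    qed
    ultimately show ?thesis by (simp add: Z_def mult.assoc)
  qed
  have "p k * fcoef k (\<lambda>x. T x * v x) - fcoef k (\<lambda>x. T x * g x)
      = (\<Sum>l\<in>kbox M. of_real (kcoef M l / kmass TYPE('n) M) * fcoef l \<phi> * ((p k - p (\<lambda>i. k i - l i)) * fcoef (\<lambda>i. k i - l i) v))"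
    unfolding T_def using fcoef_trig_approx_mult[OF v, where k = k and M = M and \<phi> = \<phi>] fcoef_trig_approx_mult[OF g, where k = k and M = M and \<phi> = \<phi>]
    by (simp add: p sum_distrib_left sum_subtractf algebra_simps)
  also have "norm \<dots> \<le> 4 ^ CARD('n) * B"
  proof (rule sum_kbox_bound)
    fix l :: "'n \<Rightarrow> int"
    let ?t = "complex_of_real (kcoef M l / kmass TYPE('n) M) * fcoef l \<phi> * ((p k - p (\<lambda>i. k i - l i)) * fcoef (\<lambda>i. k i - l i) v)"
    let ?X = "norm (fcoef l \<phi>) * norm ((p k - p (\<lambda>i. k i - l i)) * fcoef (\<lambda>i. k i - l i) v)"
    have "norm ?t
       = (kcoef M l / kmass TYPE('n) M) * ?X"
      using kcoef_kmass(1)[OF M(1), of l] by (simp only: norm_mult norm_of_real abs_of_nonneg mult.assoc)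
    also have "\<dots> \<le> 1 * ?X" by (intro mult_right_mono kcoef_kmass(2)[OF M(1)]) simp
    finally have "norm ?t * (1 + norm (latt l)) ^ (2 * CARD('n))
       \<le> ?X * (1 + norm (latt l)) ^ (2 * CARD('n))" by (intro mult_right_mono) auto
    then show "norm ?t * (1 + norm (latt l)) ^ (2 * CARD('n)) \<le> B"
      using B[of l] by linarith
  qed
  finally have main: "norm (p k * fcoef k (\<lambda>x. T x * v x) - fcoef k (\<lambda>x. T x * g x)) \<le> 4 ^ CARD('n) * B" .
  define D1 D2 where "D1 = fcoef k (\<lambda>x. \<phi> x * v x) - fcoef k (\<lambda>x. T x * v x)" and "D2 = fcoef k (\<lambda>x. \<phi> x * g x) - fcoef k (\<lambda>x. T x * g x)"
  have "p k * fcoef k (\<lambda>x. \<phi> x * v x) - fcoef k (\<lambda>x. \<phi> x * g x)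
     = (p k * fcoef k (\<lambda>x. T x * v x) - fcoef k (\<lambda>x. T x * g x)) + p k * D1 - D2"
    unfolding D1_def D2_def by (simp add: algebra_simps)
  then have "norm (p k * fcoef k (\<lambda>x. \<phi> x * v x) - fcoef k (\<lambda>x. \<phi> x * g x)) \<le> 4 ^ CARD('n) * B + norm (p k * D1) + norm D2"
    using main norm_triangle_ineq4[of "(p k * fcoef k (\<lambda>x. T x * v x) - fcoef k (\<lambda>x. T x * g x)) + p k * D1" D2]
      norm_triangle_ineq[of "p k * fcoef k (\<lambda>x. T x * v x) - fcoef k (\<lambda>x. T x * g x)" "p k * D1"] by simp
  also have "norm (p k * D1) \<le> norm (p k) * (\<eta> * Z)"
    unfolding norm_mult D1_def by (intro mult_left_mono diff v W) auto
  also have "norm D2 \<le> \<eta> * Z" unfolding D2_def by (intro diff g W)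
  also have "4 ^ CARD('n) * B + norm (p k) * (\<eta> * Z) + \<eta> * Z = 4 ^ CARD('n) * B + \<eta> * ((norm (p k) + 1) * Z)" by (simp add: algebra_simps)
  also have "\<dots> \<le> 4 ^ CARD('n) * B + \<eta> * ((norm (p k) + 1) * (Z + 1))"
    using \<eta> Z by (intro add_left_mono mult_left_mono) auto
  also have "\<eta> * ((norm (p k) + 1) * (Z + 1)) = e"
    unfolding \<eta>_def using Z norm_ge_zero[of "p k"] by (simp add: add_nonneg_eq_0_iff)
  finally show "norm (p k * fcoef k (\<lambda>x. \<phi> x * v x) - fcoef k (\<lambda>x. \<phi> x * g x)) \<le> 4 ^ CARD('n) * B + e" by simp
qed

section \<open>The bootstrap on a ball\<close>

lemma smooth_on_pdo_net: "open S \<Longrightarrow> smooth_on S (u \<epsilon>) \<Longrightarrow> smooth_on S (pdo_net m a u \<epsilon>)"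
  unfolding pdo_net_def[abs_def]
  by (intro smooth_on_sum smooth_on_mult smooth_on_const smooth_on_mderiv)

lemma smooth_on_symbol_net: "open S \<Longrightarrow> smooth_on S (symbol_net m a \<epsilon>)"
  unfolding symbol_net_def[abs_def]
  by (intro smooth_on_sum smooth_on_mult smooth_on_const smooth_on_monomial)

lemma pdo_net_cong_open:
  assumes "open S" "\<And>y. y \<in> S \<Longrightarrow> u \<epsilon> y = v \<epsilon> y" "x \<in> S"
  shows "pdo_net m a u \<epsilon> x = pdo_net m a v \<epsilon> x"
  unfolding pdo_net_def using mderiv_cong_open[OF assms] by simp

lemma abs_monomial_le: "\<bar>monomial \<gamma> x\<bar> \<le> (1 + norm x) ^ mi_order \<gamma>"
proof -
  have "\<bar>monomial \<gamma> x\<bar> = (\<Prod>i\<in>UNIV. \<bar>x $ i\<bar> ^ \<gamma> i)"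
    by (simp add: monomial_def abs_prod power_abs)
  also have "\<dots> \<le> (\<Prod>i\<in>UNIV. (1 + norm x) ^ \<gamma> i)"
    using component_le_norm_cart[of x] by (intro prod_mono conjI power_mono) (auto intro: order_trans add_increasing)
  finally show ?thesis by (simp add: mi_order_def power_sum)
qed

text \<open>Mean value inequality with the maximum S of |q| on the segment. The smallness of
  \<open>l\<close> keeps the segment outside the ball of radius \<open>R\<close> and the weight 1 +
  norm above half its value at \<xi>. Then S <= |q(\<xi>)| + S/2, so S is at most 2 |q(\<xi>)|,
  which accounts for the factor 4 in the result.\<close>

lemma symbol_diff_le:
  fixes q :: "real^'n::finite \<Rightarrow> complex"
  assumes q: "smooth_on UNIV q" and C: "C > 0" and R: "R > 0"
    and grad: "\<And>i \<xi>. R \<le> norm \<xi> \<Longrightarrow> norm (partial i q \<xi>) * (1 + norm \<xi>) \<le> C * norm (q \<xi>)"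
    and \<xi>: "2 * R + 1 \<le> norm \<xi>" and l: "norm l * (4 * real CARD('n) * C + 4) \<le> 1 + norm \<xi>"
  shows "norm (q (\<xi> + l) - q \<xi>) \<le> 4 * real CARD('n) * C * norm l / (1 + norm \<xi>) * norm (q \<xi>)"
proof -
  define b where "b = 1 + norm \<xi>"
  have b: "b > 0" unfolding b_def by (intro add_pos_nonneg) auto
  have l4: "norm l * 4 \<le> b" and lC: "2 * real CARD('n) * C * norm l \<le> b / 2"
  proof -
    have "norm l * 4 \<le> norm l * (4 * real CARD('n) * C + 4)" using C by (intro mult_left_mono) auto
    then show "norm l * 4 \<le> b" using l unfolding b_def by (rule order_trans)
    have "norm l * (4 * real CARD('n) * C) \<le> norm l * (4 * real CARD('n) * C + 4)" by (intro mult_left_mono) auto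
    also have "\<dots> \<le> b" using l unfolding b_def .
    finally show "2 * real CARD('n) * C * norm l \<le> b / 2" by (simp add: mult_ac)
  qed
  have seg: "R \<le> norm (\<xi> + t *\<^sub>R l)" "b / 2 \<le> 1 + norm (\<xi> + t *\<^sub>R l)" if "t \<in> {0..1}" for t
  proof -
    have "norm (t *\<^sub>R l) \<le> norm l" using that by (simp add: mult_left_le_one_le)
    then have "norm (\<xi> + t *\<^sub>R l) \<ge> norm \<xi> - b / 4" using norm_diff_ineq[of \<xi> "t *\<^sub>R l"] l4 by linarith
    then have "R \<le> norm (\<xi> + t *\<^sub>R l) \<and> b / 2 \<le> 1 + norm (\<xi> + t *\<^sub>R l)" using \<xi> R unfolding b_def by argo
    then show "R \<le> norm (\<xi> + t *\<^sub>R l)" "b / 2 \<le> 1 + norm (\<xi> + t *\<^sub>R l)" by blast+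
  qed
  have "continuous_on {0..1} (\<lambda>t. norm (q (\<xi> + t *\<^sub>R l)))"
    by (intro continuous_intros continuous_on_compose2[OF smooth_on_continuous[OF q]]) auto
  then obtain t0 where t0: "t0 \<in> {0..1}" "\<And>t. t \<in> {0..1} \<Longrightarrow> norm (q (\<xi> + t *\<^sub>R l)) \<le> norm (q (\<xi> + t0 *\<^sub>R l))"
    using continuous_attains_sup[of "{0..1::real}" "\<lambda>t. norm (q (\<xi> + t *\<^sub>R l))"] by force
  define S where "S = norm (q (\<xi> + t0 *\<^sub>R l))"
  have pb: "norm (partial i q (\<xi> + t *\<^sub>R l)) \<le> 2 * C * S / b" if "t \<in> {0..1}" for t i
  proof -
    have "norm (partial i q (\<xi> + t *\<^sub>R l)) * (b / 2) \<le> norm (partial i q (\<xi> + t *\<^sub>R l)) * (1 + norm (\<xi> + t *\<^sub>R l))"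
      using seg[OF that] by (intro mult_left_mono) auto
    also have "\<dots> \<le> C * norm (q (\<xi> + t *\<^sub>R l))" using seg[OF that] by (intro grad)
    also have "\<dots> \<le> C * S" using t0(2)[OF that] C unfolding S_def by (intro mult_left_mono) auto
    finally show ?thesis using b by (simp add: field_simps)
  qed
  have diff: "norm (q (\<xi> + s *\<^sub>R l) - q \<xi>) \<le> real CARD('n) * norm l * (2 * C * S / b)" if s: "s \<in> {0..1}" for s
  proof -
    have ts: "t * s \<in> {0..1}" if "t \<in> {0..1}" for t using that s by (auto simp: mult_le_one)
    have "norm (q (\<xi> + s *\<^sub>R l) - q \<xi>) \<le> real CARD('n) * norm (s *\<^sub>R l) * (2 * C * S / b)"
      using pb[OF ts] smooth_on_differentiable[OF q] by (intro norm_diff_le_on_segment) auto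
    also have "\<dots> \<le> real CARD('n) * norm l * (2 * C * S / b)"
      using s C b by (intro mult_right_mono mult_left_mono) (auto simp: S_def mult_left_le_one_le)
    finally show ?thesis .
  qed
  have "S \<le> 2 * norm (q \<xi>)"
  proof -
    have "real CARD('n) * norm l * (2 * C * S / b) = (2 * real CARD('n) * C * norm l) * (S / b)" by simp
    also have "\<dots> \<le> (b / 2) * (S / b)" using lC b by (intro mult_right_mono) (auto simp: S_def)
    also have "\<dots> = S / 2" using b by simp
    finally have "S - norm (q \<xi>) \<le> S / 2"
      using diff[OF t0(1)] norm_triangle_ineq2[of "q (\<xi> + t0 *\<^sub>R l)" "q \<xi>"] unfolding S_def by linarith
    then show ?thesis by simp
  qed
  have "norm (q (\<xi> + l) - q \<xi>) \<le> real CARD('n) * norm l * (2 * C * S / b)" using diff[of 1] by simp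
  also have "\<dots> \<le> real CARD('n) * norm l * (2 * C * (2 * norm (q \<xi>)) / b)"
    using \<open>S \<le> 2 * norm (q \<xi>)\<close> C b by (intro mult_left_mono divide_right_mono) auto
  finally show ?thesis by (simp add: b_def mult_ac)
qed

text \<open>Here a, b, c stand for the brackets of k, k - l and l, X for a commutator term, and Y
  for symbol times coefficient at k - l. Up to powers of c, a^(j+1) is dominated by b^(j+1); one b
  is cancelled by the gradient gain 1/b, and b^j by the previous bound. Powers of c are harmless
  because the coefficients of the cutoff decay rapidly.\<close>

lemma commutator_bound_near:
  fixes a b c :: real
  assumes "1 \<le> a" "1 \<le> b" "1 \<le> c" "a \<le> b * c" "b \<le> a * c"
    and "0 \<le> K" "0 \<le> Y" "0 \<le> Z" "X \<le> K * c / b * Y" "Y * b ^ j \<le> Z * b ^ m"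
  shows "X * a ^ (j + 1) \<le> K * Z * a ^ m * c ^ (m + 2 * j + 2)"
proof -
  have "X * a ^ (j + 1) \<le> (K * c / b * Y) * (b * c) ^ (j + 1)"
    using assms by (intro mult_mono power_mono) auto
  also have "\<dots> = K * c ^ (j + 2) * (Y * b ^ j)" using assms by (simp add: power_mult_distrib mult_ac)
  also have "\<dots> \<le> K * c ^ (j + 2) * (Z * b ^ m)" using assms by (intro mult_left_mono) auto
  also have "\<dots> \<le> K * c ^ (j + 2) * (Z * (a * c) ^ m)" using assms by (intro mult_left_mono power_mono) auto
  also have "\<dots> = K * Z * a ^ m * c ^ (m + j + 2)" by (simp add: power_mult_distrib power_add mult_ac)
  \<comment> \<open>Raised to the power of c that the far case produces.\<close>
  also have "\<dots> \<le> K * Z * a ^ m * c ^ (m + 2 * j + 2)" using assms by (intro mult_left_mono power_increasing) auto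
  finally show ?thesis .
qed

text \<open>Away from the diagonal the difference of symbols is bounded by its two terms, and the
  powers of b are traded for powers of c and the factor H, into which 1/\<epsilon> enters
  later.\<close>

lemma commutator_bound_far:
  fixes a b c :: real
  assumes "1 \<le> a" "1 \<le> b" "1 \<le> c" "a \<le> b * c" "b \<le> a * c"
    and "0 \<le> W" "0 \<le> H" "X \<le> W * (a ^ m + b ^ m)" "b ^ (j + 1) \<le> H * c ^ (j + 1)"
  shows "X * a ^ (j + 1) \<le> 2 * W * H * a ^ m * c ^ (m + 2 * j + 2)"
proof -
  have "b ^ m \<le> (a * c) ^ m" "a ^ m \<le> (a * c) ^ m" using assms by (auto intro!: power_mono simp: mult_le_cancel_left1)
  then have "a ^ m + b ^ m \<le> 2 * (a ^ m * c ^ m)" by (simp add: power_mult_distrib)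
  then have "X \<le> W * (2 * (a ^ m * c ^ m))" using assms by (meson mult_left_mono order_trans)
  moreover have "a ^ (j + 1) \<le> H * c ^ (j + 1) * c ^ (j + 1)"
  proof -
    have "a ^ (j + 1) \<le> (b * c) ^ (j + 1)" using assms by (intro power_mono) auto
    also have "\<dots> \<le> H * c ^ (j + 1) * c ^ (j + 1)" unfolding power_mult_distrib using assms by (intro mult_right_mono) auto
    finally show ?thesis .
  qed
  ultimately have "X * a ^ (j + 1) \<le> (W * (2 * (a ^ m * c ^ m))) * (H * c ^ (j + 1) * c ^ (j + 1))"
    using assms by (intro mult_mono) auto
  also have "\<dots> = 2 * W * H * a ^ m * c ^ (m + 2 * j + 2)" 
  proof -
    have "m + 2 * j + 2 = m + (j + 1) + (j + 1)" by simp
    then show ?thesis by (simp only: power_add mult_ac)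
  qed
  finally show ?thesis .
qed

section \<open>Estimates for fixed representatives on one ball\<close>

lemma eventually_unit_interval: "\<forall>\<^sub>F \<epsilon> in at_right (0::real). 0 < \<epsilon> \<and> \<epsilon> < 1"
  by (rule eventually_mono[OF eventually_at_right_real[of 0 1]]) auto

text \<open>All assumptions are in asymptotic form. The exponent \<open>p0\<close> concerns
  \<open>u\<close> itself and not its derivatives, whereas \<open>pf\<close> serves the derivatives
  of every order of P u; the goal is to transfer this uniformity to \<open>u\<close>.\<close>

locale regularity_on_ball =
  fixes \<Omega> :: "(real ^ 'n::finite) set" and z :: "real ^ 'n" and \<delta> :: real
    and u :: "'n fun_net" and m :: nat and a :: "'n multiindex \<Rightarrow> real \<Rightarrow> complex"
    and r :: "real \<Rightarrow> real" and M p0 pf N :: real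
  assumes open_\<Omega>: "open \<Omega>" and \<delta>: "0 < \<delta>" "\<delta> < 1" "cball z \<delta> \<subseteq> \<Omega>"
    and exponents: "0 \<le> M" "0 \<le> p0" "0 \<le> pf" "0 \<le> N"
    and smooth_u: "\<forall>\<^sub>F \<epsilon> in at_right 0. smooth_on \<Omega> (u \<epsilon>)"
    and bound_u: "\<exists>C\<ge>0. \<forall>\<^sub>F \<epsilon> in at_right 0. \<forall>x\<in>cball z \<delta>. norm (u \<epsilon> x) \<le> C * \<epsilon> powr (- p0)"
    and bound_f: "\<And>i j. \<exists>C\<ge>0. \<forall>\<^sub>F \<epsilon> in at_right 0. \<forall>x\<in>cball z \<delta>.
        norm ((partial i ^^ j) (pdo_net m a u \<epsilon>) x) \<le> C * \<epsilon> powr (- pf)"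
    and bound_symbol: "\<exists>C\<ge>0. \<forall>\<^sub>F \<epsilon> in at_right 0. \<forall>\<xi>.
        norm (symbol_net m a \<epsilon> \<xi>) \<le> C * \<epsilon> powr (- M) * (1 + norm \<xi>) ^ m"
    and gradient: "\<exists>C>0. \<forall>\<^sub>F \<epsilon> in at_right 0. \<forall>i \<xi>. r \<epsilon> \<le> norm \<xi> \<longrightarrow>
        norm (partial i (symbol_net m a \<epsilon>) \<xi>) * (1 + norm \<xi>) \<le> C * norm (symbol_net m a \<epsilon> \<xi>)"
    and elliptic: "\<forall>\<^sub>F \<epsilon> in at_right 0. \<forall>\<xi>. r \<epsilon> \<le> norm \<xi> \<longrightarrow>
        \<epsilon> powr N * (1 + norm \<xi>) ^ m \<le> norm (symbol_net m a \<epsilon> \<xi>)"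
    and radius: "\<forall>\<^sub>F \<epsilon> in at_right 0. 0 < r \<epsilon>"
    and slow: "\<And>s. \<exists>C\<ge>0. \<forall>\<^sub>F \<epsilon> in at_right 0. (2 + 2 * r \<epsilon>) ^ s \<le> C / \<epsilon>"
begin

abbreviation bracket :: "('n \<Rightarrow> int) \<Rightarrow> real" where "bracket k \<equiv> 1 + norm (latt k)"

abbreviation symcoef :: "real \<Rightarrow> (real ^ 'n \<Rightarrow> complex) \<Rightarrow> ('n \<Rightarrow> int) \<Rightarrow> real" where
  "symcoef \<epsilon> \<phi> k \<equiv> norm (symbol_net m a \<epsilon> (latt k) * fcoef k (\<lambda>x. \<phi> x * u \<epsilon> x))"

text \<open>\<open>M + p0\<close> is the crude exponent for symbol times coefficient, 1 is the price
  of the slow scale, and \<open>pf\<close> comes from the right-hand side.\<close>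

definition p where "p = max (M + p0 + 1) pf"

lemma powr_mono_neg: "0 < \<epsilon> \<Longrightarrow> \<epsilon> < 1 \<Longrightarrow> s \<le> t \<Longrightarrow> \<epsilon> powr (- s) \<le> \<epsilon> powr (- t)" for \<epsilon> :: real
  by (intro powr_mono') auto

lemma powr_minus_Suc: "0 < \<epsilon> \<Longrightarrow> \<epsilon> powr (- (s + 1)) = \<epsilon> powr (- s) / \<epsilon>" for \<epsilon> :: real
proof -
  assume "0 < \<epsilon>"
  moreover have "- (s + 1) = - s - 1" by simp
  ultimately show ?thesis by (simp only: powr_diff powr_one less_imp_le)
qed

lemma cutoff_test_fun:
  assumes "test_fun z \<rho> \<phi>" "\<rho> \<le> \<delta>" "smooth_on \<Omega> f"
  shows "test_fun z \<rho> (\<lambda>x. \<phi> x * f x)"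
  using assms \<delta> by (intro test_fun_mult[OF _ open_\<Omega>]) (auto intro: order_trans)

lemma fcoef_u_bound:
  assumes "test_fun z \<rho> \<phi>" "\<rho> \<le> \<delta>"
  shows "\<exists>C\<ge>0. \<forall>\<^sub>F \<epsilon> in at_right 0. \<forall>k. norm (fcoef k (\<lambda>x. \<phi> x * u \<epsilon> x)) \<le> C * \<epsilon> powr (- p0)"
proof -
  obtain C where C: "C \<ge> 0" "\<And>f B k. smooth_on \<Omega> f \<Longrightarrow> (\<forall>i. \<forall>j\<le>0. \<forall>x\<in>cball z \<delta>. norm ((partial i ^^ j) f x) \<le> B) \<Longrightarrow>
     (1 + norm (latt k)) ^ 0 * norm (fcoef k (\<lambda>x. \<phi> x * f x)) \<le> C * B"
    using fcoef_decay[OF open_\<Omega> \<delta>(3) test_fun_mono[OF assms], of 0] by blast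
  obtain B where B: "B \<ge> 0" "\<forall>\<^sub>F \<epsilon> in at_right 0. \<forall>x\<in>cball z \<delta>. norm (u \<epsilon> x) \<le> B * \<epsilon> powr (- p0)"
    using bound_u by blast
  have "\<forall>\<^sub>F \<epsilon> in at_right 0. \<forall>k. norm (fcoef k (\<lambda>x. \<phi> x * u \<epsilon> x)) \<le> (C * B) * \<epsilon> powr (- p0)"
    using B(2) smooth_u
  proof eventually_elim
    case (elim \<epsilon>)
    show ?case using C(2)[OF elim(2), of "B * \<epsilon> powr (- p0)"] elim(1) by (simp add: mult.assoc)
  qed
  then show ?thesis using B C by (intro exI[of _ "C * B"]) auto
qed

lemma fcoef_f_bound:
  assumes "test_fun z \<rho> \<phi>" "\<rho> \<le> \<delta>"
  shows "\<exists>C\<ge>0. \<forall>\<^sub>F \<epsilon> in at_right 0. \<forall>k. bracket k ^ s * norm (fcoef k (\<lambda>x. \<phi> x * pdo_net m a u \<epsilon> x)) \<le> C * \<epsilon> powr (- pf)"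
proof -
  obtain C where C: "C \<ge> 0" "\<And>f B k. smooth_on \<Omega> f \<Longrightarrow> (\<forall>i. \<forall>j\<le>s. \<forall>x\<in>cball z \<delta>. norm ((partial i ^^ j) f x) \<le> B) \<Longrightarrow>
     (1 + norm (latt k)) ^ s * norm (fcoef k (\<lambda>x. \<phi> x * f x)) \<le> C * B"
    using fcoef_decay[OF open_\<Omega> \<delta>(3) test_fun_mono[OF assms], of s] by blast
  define Q where "Q i j B \<longleftrightarrow> B \<ge> 0 \<and> (\<forall>\<^sub>F \<epsilon> in at_right 0. \<forall>x\<in>cball z \<delta>.
      norm ((partial i ^^ j) (pdo_net m a u \<epsilon>) x) \<le> B * \<epsilon> powr (- pf))" for i j B
  have "\<forall>i j. \<exists>B. Q i j B" using bound_f unfolding Q_def by blast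
  then obtain B where "\<And>i j. Q i j (B i j)" by metis
  then have B: "\<And>i j. B i j \<ge> 0" "\<And>i j. \<forall>\<^sub>F \<epsilon> in at_right 0. \<forall>x\<in>cball z \<delta>.
      norm ((partial i ^^ j) (pdo_net m a u \<epsilon>) x) \<le> B i j * \<epsilon> powr (- pf)"
    unfolding Q_def by blast+
  define B' where "B' = (\<Sum>i\<in>UNIV. \<Sum>j\<le>s. B i j)"
  have BB: "B i j \<le> B'" if "j \<le> s" for i j
  proof -
    have "B i j \<le> (\<Sum>j\<le>s. B i j)" using that B by (intro member_le_sum) auto
    also have "\<dots> \<le> B'" unfolding B'_def using B by (intro member_le_sum[of i UNIV "\<lambda>i. \<Sum>j\<le>s. B i j"] sum_nonneg) auto
    finally show ?thesis .
  qed
  have "\<forall>\<^sub>F \<epsilon> in at_right 0. \<forall>i\<in>UNIV. \<forall>j\<in>{..s}. \<forall>x\<in>cball z \<delta>.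
      norm ((partial i ^^ j) (pdo_net m a u \<epsilon>) x) \<le> B i j * \<epsilon> powr (- pf)"
    by (intro eventually_ball_finite[of UNIV] eventually_ball_finite[of "{..s}"] ballI B(2)) auto
  then have "\<forall>\<^sub>F \<epsilon> in at_right 0. \<forall>k. bracket k ^ s * norm (fcoef k (\<lambda>x. \<phi> x * pdo_net m a u \<epsilon> x)) \<le> (C * B') * \<epsilon> powr (- pf)"
    using smooth_u
  proof eventually_elim
    case (elim \<epsilon>)
    have "norm ((partial i ^^ j) (pdo_net m a u \<epsilon>) x) \<le> B' * \<epsilon> powr (- pf)" if "j \<le> s" "x \<in> cball z \<delta>" for i j x
      using elim(1)[rule_format, of i j x] that BB[of j i] mult_right_mono[OF BB[of j i], of "\<epsilon> powr (- pf)"] by force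
    then show ?case using C(2)[OF smooth_on_pdo_net[of \<Omega> u \<epsilon> m a, OF open_\<Omega> elim(2)], of "B' * \<epsilon> powr (- pf)"]
      by (simp add: mult.assoc)
  qed
  moreover have "C * B' \<ge> 0" using C B unfolding B'_def by (intro mult_nonneg_nonneg sum_nonneg) auto
  ultimately show ?thesis by blast
qed

text \<open>The decay estimate for \<phi> f in the case f = 1.\<close>

lemma fcoef_cutoff_decay:
  assumes "test_fun z \<rho> \<phi>" "\<rho> \<le> \<delta>"
  shows "\<exists>C\<ge>0. \<forall>k. norm (fcoef k \<phi>) * bracket k ^ s \<le> C"
proof -
  obtain C where C: "C \<ge> 0" "\<And>f B k. smooth_on \<Omega> f \<Longrightarrow> (\<forall>i. \<forall>j\<le>s. \<forall>x\<in>cball z \<delta>. norm ((partial i ^^ j) f x) \<le> B) \<Longrightarrow>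
     (1 + norm (latt k)) ^ s * norm (fcoef k (\<lambda>x. \<phi> x * f x)) \<le> C * B"
    using fcoef_decay[OF open_\<Omega> \<delta>(3) test_fun_mono[OF assms], of s] by blast
  have pc: "(partial i ^^ j) (\<lambda>x. c) = (\<lambda>x. if j = 0 then c else 0)" for i j and c :: complex
  proof -
    have "partial i (\<lambda>x. c) = (\<lambda>_. 0)" for c by (rule ext) (rule partial_const)
    then show ?thesis by (induction j) simp_all
  qed
  have "norm (fcoef k \<phi>) * bracket k ^ s \<le> C" for k
    using C(2)[OF smooth_on_const[OF open_\<Omega>, of 1], of 1 k] by (simp add: pc mult.commute)
  then show ?thesis using C(1) by blast
qed

lemma symbol_fcoef_bound_0:
  assumes "test_fun z \<rho> \<phi>" "\<rho> \<le> \<delta>"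
  shows "\<exists>C\<ge>0. \<forall>\<^sub>F \<epsilon> in at_right 0. \<forall>k.
     symcoef \<epsilon> \<phi> k * bracket k ^ 0 \<le> C * \<epsilon> powr (- p) * bracket k ^ m"
proof -
  obtain C1 where C1: "C1 \<ge> 0" "\<forall>\<^sub>F \<epsilon> in at_right 0. \<forall>k. norm (fcoef k (\<lambda>x. \<phi> x * u \<epsilon> x)) \<le> C1 * \<epsilon> powr (- p0)"
    using fcoef_u_bound[OF assms] by blast
  obtain C2 where C2: "C2 \<ge> 0" "\<forall>\<^sub>F \<epsilon> in at_right 0. \<forall>\<xi>. norm (symbol_net m a \<epsilon> \<xi>) \<le> C2 * \<epsilon> powr (- M) * (1 + norm \<xi>) ^ m"
    using bound_symbol by blast
  have "\<forall>\<^sub>F \<epsilon> in at_right 0. \<forall>k.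
     symcoef \<epsilon> \<phi> k * bracket k ^ 0 \<le> (C2 * C1) * \<epsilon> powr (- p) * bracket k ^ m"
    using C1(2) C2(2) eventually_unit_interval
  proof eventually_elim
    case (elim \<epsilon>)
    show ?case
    proof
      fix k
      have "symcoef \<epsilon> \<phi> k \<le> (C2 * \<epsilon> powr (- M) * bracket k ^ m) * (C1 * \<epsilon> powr (- p0))"
        unfolding norm_mult using elim C2(1) by (intro mult_mono) auto
      also have "\<dots> = (C2 * C1) * \<epsilon> powr (- (M + p0)) * bracket k ^ m" by (simp add: powr_add[symmetric] mult_ac)
      also have "\<dots> \<le> (C2 * C1) * \<epsilon> powr (- p) * bracket k ^ m"
        using elim C1 C2 by (intro mult_right_mono mult_left_mono powr_mono_neg) (auto simp: p_def)
      finally show "symcoef \<epsilon> \<phi> k * bracket k ^ 0 \<le> (C2 * C1) * \<epsilon> powr (- p) * bracket k ^ m" by simp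
    qed
  qed
  then show ?thesis using C1 C2 by (intro exI[of _ "C2 * C1"]) auto
qed

text \<open>Peetre's inequality with exponent 1.\<close>

lemma bracket_triangle: "bracket k \<le> bracket (\<lambda>i. k i - l i) * bracket l" "bracket (\<lambda>i. k i - l i) \<le> bracket k * bracket l"
proof -
  have *: "1 + x \<le> (1 + y) * (1 + w)" if "x \<le> y + w" "0 \<le> y" "0 \<le> w" for x y w :: real
  proof -
    have "(1 + y) * (1 + w) = 1 + y + w + y * w" by (simp add: algebra_simps)
    then show ?thesis using that(1) mult_nonneg_nonneg[OF that(2,3)] by linarith
  qed
  show "bracket k \<le> bracket (\<lambda>i. k i - l i) * bracket l" "bracket (\<lambda>i. k i - l i) \<le> bracket k * bracket l"
    unfolding latt_diff using norm_triangle_sub[of "latt k" "latt l"] norm_triangle_ineq4[of "latt k" "latt l"]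
    by (auto intro!: * simp: add.commute)
qed

text \<open>One application of the commutator estimate gains one power of \<open>bracket k\<close> without
  changing the exponent \<open>p\<close> of \<open>\<epsilon>\<close>: close to the diagonal the gain comes from the gradient bound on
  the symbol, and elsewhere from the slow scale of the radius or from the decay of the cutoff.\<close>

lemma symbol_fcoef_bound_Suc:
  assumes IH: "\<And>\<rho> \<phi>. 0 < \<rho> \<Longrightarrow> \<rho> < \<delta> \<Longrightarrow> test_fun z \<rho> \<phi> \<Longrightarrow> \<exists>C\<ge>0. \<forall>\<^sub>F \<epsilon> in at_right 0. \<forall>k.
     symcoef \<epsilon> \<phi> k * bracket k ^ j \<le> C * \<epsilon> powr (- p) * bracket k ^ m"
    and \<rho>: "0 < \<rho>" "\<rho> < \<delta>" and \<phi>: "test_fun z \<rho> \<phi>"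
  shows "\<exists>C\<ge>0. \<forall>\<^sub>F \<epsilon> in at_right 0. \<forall>k.
     symcoef \<epsilon> \<phi> k * bracket k ^ (j + 1) \<le> C * \<epsilon> powr (- p) * bracket k ^ m"
proof -
  \<comment> \<open>Two intermediate radii. The cutoff \<psi> is 1 near the support of \<phi>, which
    gives \<phi> P(\<psi> u) = \<phi> P u by locality, and its own support has radius below
    \<delta>, so the induction hypothesis applies to \<psi>.\<close>
  define \<rho>1 where "\<rho>1 = (2 * \<rho> + \<delta>) / 3"
  define \<rho>2 where "\<rho>2 = (\<rho> + 2 * \<delta>) / 3"
  have \<rho>s: "\<rho> < \<rho>1" "\<rho>1 < \<rho>2" "\<rho>2 < \<delta>" using \<rho> by (auto simp: \<rho>1_def \<rho>2_def)
  have "0 < \<rho>1" using \<rho>s \<rho> by simp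
  from exists_smooth_bump[OF this \<rho>s(2), of z] obtain \<psi> where \<psi>: "smooth_on UNIV \<psi>" "\<forall>x\<in>cball z \<rho>1. \<psi> x = 1"
    "\<forall>x. x \<notin> ball z \<rho>2 \<longrightarrow> \<psi> x = 0" by blast
  have \<psi>t: "test_fun z \<rho>2 \<psi>" using \<psi> unfolding test_fun_def by force
  obtain A where A: "A \<ge> 0" "\<forall>\<^sub>F \<epsilon> in at_right 0. \<forall>k.
     symcoef \<epsilon> \<psi> k * bracket k ^ j \<le> A * \<epsilon> powr (- p) * bracket k ^ m"
    using IH[OF _ \<rho>s(3) \<psi>t] \<rho>s \<rho> by fastforce
  obtain C0 where C0: "C0 \<ge> 0" "\<forall>\<^sub>F \<epsilon> in at_right 0. \<forall>k. norm (fcoef k (\<lambda>x. \<psi> x * u \<epsilon> x)) \<le> C0 * \<epsilon> powr (- p0)"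
    using fcoef_u_bound[OF \<psi>t] \<rho>s by auto
  obtain Cf where Cf: "Cf \<ge> 0" "\<forall>\<^sub>F \<epsilon> in at_right 0. \<forall>k.
      bracket k ^ (j + 1) * norm (fcoef k (\<lambda>x. \<phi> x * pdo_net m a u \<epsilon> x)) \<le> Cf * \<epsilon> powr (- pf)"
    using fcoef_f_bound[OF \<phi>, of "j + 1"] \<rho> by auto
  obtain CP where CP: "CP \<ge> 0" "\<forall>\<^sub>F \<epsilon> in at_right 0. \<forall>\<xi>. norm (symbol_net m a \<epsilon> \<xi>) \<le> CP * \<epsilon> powr (- M) * (1 + norm \<xi>) ^ m"
    using bound_symbol by blast
  obtain G where G: "G > 0" "\<forall>\<^sub>F \<epsilon> in at_right 0. \<forall>i \<xi>. r \<epsilon> \<le> norm \<xi> \<longrightarrow>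
        norm (partial i (symbol_net m a \<epsilon>) \<xi>) * (1 + norm \<xi>) \<le> G * norm (symbol_net m a \<epsilon> \<xi>)"
    using gradient by blast
  obtain H0 where H0: "H0 \<ge> 0" "\<forall>\<^sub>F \<epsilon> in at_right 0. (2 + 2 * r \<epsilon>) ^ (j + 1) \<le> H0 / \<epsilon>" using slow by blast
  \<comment> \<open>The power of \<open>bracket l\<close> lost in the commutator bounds. The
    coefficients of \<phi> pay for it, and for \<open>2 * CARD('n)\<close> further powers that make
    the sum over l converge.\<close>
  define T where "T = m + 2 * j + 2"
  obtain D where D: "D \<ge> 0" "\<And>l. norm (fcoef l \<phi>) * bracket l ^ (T + 2 * CARD('n)) \<le> D"
    using fcoef_cutoff_decay[OF \<phi>] \<rho> by (meson less_imp_le)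
  define K where "K = 4 * real CARD('n) * G"
  have K: "K > 0" using G by (simp add: K_def)
  define H where "H = H0 + (K + 4) ^ (j + 1)"
  have H: "H \<ge> 0" using H0 K by (simp add: H_def)
  \<comment> \<open>The near terms contribute \<open>K * A\<close>, the far terms the other
    summand.\<close>
  define E where "E = K * A + 2 * (CP * C0) * H"
  have E: "E \<ge> 0" using A CP C0 H K by (simp add: E_def)
  have "\<forall>\<^sub>F \<epsilon> in at_right 0. \<forall>k. symcoef \<epsilon> \<phi> k * bracket k ^ (j + 1) 
        \<le> (Cf + 4 ^ CARD('n) * (D * E)) * \<epsilon> powr (- p) * bracket k ^ m"
    using A(2) C0(2) Cf(2) CP(2) G(2) H0(2) eventually_unit_interval smooth_u radius
  proof eventually_elim
    case (elim \<epsilon>)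
    define q where "q = symbol_net m a \<epsilon>"
    define e where "e = \<epsilon> powr (- p)"
    have e: "e > 0" using elim by (simp add: e_def)
    define v where "v = (\<lambda>x. \<psi> x * u \<epsilon> x)"
    define g where "g = pdo_net m a (\<lambda>\<epsilon> x. \<psi> x * u \<epsilon> x) \<epsilon>"
    have v: "test_fun z \<rho>2 v" unfolding v_def using \<psi>t \<rho>s elim by (intro cutoff_test_fun) auto
    have g: "test_fun z \<rho>2 g" "\<And>k. fcoef k g = q (latt k) * fcoef k v"
      using fcoef_pdo_net[where z = z and d = \<rho>2 and u = "\<lambda>\<epsilon> x. \<psi> x * u \<epsilon> x" and \<epsilon> = \<epsilon> and m = m and a = a] v unfolding g_def v_def q_def by auto
    have \<phi>v: "(\<lambda>x. \<phi> x * v x) = (\<lambda>x. \<phi> x * u \<epsilon> x)"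
    proof
      fix x show "\<phi> x * v x = \<phi> x * u \<epsilon> x"
        using \<phi> \<psi>(2) \<rho>s by (cases "x \<in> cball z \<rho>") (auto simp: v_def test_fun_def)
    qed
    have \<phi>g: "(\<lambda>x. \<phi> x * g x) = (\<lambda>x. \<phi> x * pdo_net m a u \<epsilon> x)"
    proof
      fix x show "\<phi> x * g x = \<phi> x * pdo_net m a u \<epsilon> x"
      proof (cases "x \<in> cball z \<rho>")
        case True
        have "g x = pdo_net m a u \<epsilon> x" unfolding g_def
          by (rule pdo_net_cong_open[of "ball z \<rho>1"]) (use True \<rho>s \<psi>(2) in auto)
        then show ?thesis by simp
      qed (use \<phi> in \<open>auto simp: test_fun_def\<close>)
    qed
    have eb: "\<epsilon> powr (- (M + p0 + 1)) \<le> e" "\<epsilon> powr (- pf) \<le> e"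
      unfolding e_def by (rule powr_mono_neg; use elim in \<open>simp add: p_def\<close>)+
    show ?case
    proof
      fix k
      define a' where "a' = bracket k"
      have a': "1 \<le> a'" by (simp add: a'_def)
      have key: "norm ((q (latt k) - q (latt (\<lambda>i. k i - l i))) * fcoef (\<lambda>i. k i - l i) v) * a' ^ (j + 1) \<le> E * e * a' ^ m * bracket l ^ T" for l
      proof -
        define \<xi> where "\<xi> = (\<lambda>i. k i - l i)"
        define b c where "b = bracket \<xi>" and "c = bracket l"
        define X Y where "X = norm ((q (latt k) - q (latt \<xi>)) * fcoef \<xi> v)" and "Y = norm (q (latt \<xi>) * fcoef \<xi> v)"
        have abc: "1 \<le> a'" "1 \<le> b" "1 \<le> c" "a' \<le> b * c" "b \<le> a' * c"
          unfolding a'_def b_def c_def \<xi>_def using bracket_triangle by simp_all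
        have kl: "latt k = latt \<xi> + latt l" unfolding \<xi>_def latt_diff by simp
        have lc: "norm (latt l) \<le> c" by (simp add: c_def)
        have "X * a' ^ (j + 1) \<le> E * e * a' ^ m * c ^ (m + 2 * j + 2)"
        \<comment> \<open>The near case consists of the size conditions of
          \<open>symbol_diff_le\<close> at the point k - l.\<close>
        proof (cases "2 * r \<epsilon> + 1 \<le> norm (latt \<xi>) \<and> norm (latt l) * (K + 4) \<le> b")
          case True
          have "norm (q (latt k) - q (latt \<xi>)) \<le> K * norm (latt l) / b * norm (q (latt \<xi>))"
            unfolding kl K_def b_def q_def
            by (rule symbol_diff_le[where R = "r \<epsilon>"]) (use elim G(1) True in \<open>auto simp: smooth_on_symbol_net K_def b_def\<close>)
          also have "\<dots> \<le> K * c / b * norm (q (latt \<xi>))"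
            using lc K abc by (intro mult_right_mono divide_right_mono mult_left_mono) auto
          finally have "X \<le> K * c / b * Y"
            unfolding X_def Y_def norm_mult by (simp only: mult.assoc[symmetric] mult_right_mono norm_ge_zero)
          moreover have "Y * b ^ j \<le> (A * e) * b ^ m"
            using elim(1)[rule_format, of \<xi>] unfolding Y_def b_def e_def q_def v_def .
          ultimately have "X * a' ^ (j + 1) \<le> K * (A * e) * a' ^ m * c ^ (m + 2 * j + 2)"
            using abc K A(1) e by (intro commutator_bound_near[of a' b c K Y]) (auto simp: Y_def)
          also have "\<dots> \<le> E * e * a' ^ m * c ^ (m + 2 * j + 2)"
            unfolding E_def using abc e CP C0 H by (intro mult_right_mono) (auto simp: algebra_simps)
          finally show ?thesis .
        next
          case False
          define W where "W = (CP * C0) * \<epsilon> powr (- (M + p0))"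
          have W: "W \<ge> 0" using CP C0 by (simp add: W_def)
          have "X \<le> (norm (q (latt k)) + norm (q (latt \<xi>))) * norm (fcoef \<xi> v)"
            unfolding X_def norm_mult by (intro mult_right_mono norm_triangle_ineq4) simp
          also have "\<dots> \<le> (CP * \<epsilon> powr (- M) * a' ^ m + CP * \<epsilon> powr (- M) * b ^ m) * (C0 * \<epsilon> powr (- p0))"
            unfolding q_def v_def a'_def b_def using elim(2,4) CP(1) abc by (intro mult_mono add_mono) auto
          also have "\<dots> = W * (a' ^ m + b ^ m)" unfolding W_def by (simp add: powr_add[symmetric] algebra_simps)
          finally have XW: "X \<le> W * (a' ^ m + b ^ m)" .
          \<comment> \<open>The near case fails in one of two ways. Either k - l is of the size of
            the radius, and the slow scale pays with \<open>H0 / \<epsilon>\<close>; or l is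
            comparable to k - l, and powers of c pay.\<close>
          have bH: "b ^ (j + 1) \<le> (H / \<epsilon>) * c ^ (j + 1)"
          proof -
            have c1: "1 \<le> c ^ (j + 1)" using abc by (intro one_le_power)
            consider "norm (latt \<xi>) < 2 * r \<epsilon> + 1" | "b < norm (latt l) * (K + 4)" using False by linarith
            then show ?thesis
            proof cases
              case 1
              then have "b ^ (j + 1) \<le> (2 + 2 * r \<epsilon>) ^ (j + 1)" using abc by (intro power_mono) (auto simp: b_def)
              also have "\<dots> \<le> H0 / \<epsilon>" using elim(6) .
              also have "\<dots> \<le> H / \<epsilon>" using elim K by (intro divide_right_mono) (auto simp: H_def)
              also have "\<dots> \<le> (H / \<epsilon>) * c ^ (j + 1)" using mult_left_mono[OF c1, of "H / \<epsilon>"] H elim by simp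
              finally show ?thesis .
            next
              case 2
              have "b \<le> (K + 4) * c" 
              proof -
                have "norm (latt l) * (K + 4) \<le> c * (K + 4)" using lc K by (intro mult_right_mono) auto
                then show ?thesis using 2 unfolding mult.commute[of "K + 4" c] by (rule order_trans[OF less_imp_le, rotated])
              qed
              then have "b ^ (j + 1) \<le> ((K + 4) * c) ^ (j + 1)" using abc by (intro power_mono) auto
              also have "\<dots> = (K + 4) ^ (j + 1) * c ^ (j + 1)" by (rule power_mult_distrib)
              also have "\<dots> \<le> (H / \<epsilon>) * c ^ (j + 1)"
              proof (rule mult_right_mono)
                have "(K + 4) ^ (j + 1) \<le> H" using H0 by (simp add: H_def)
                also have "H \<le> H / \<epsilon>" using elim H by (simp add: le_divide_eq mult_left_le)
                finally show "(K + 4) ^ (j + 1) \<le> H / \<epsilon>" .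
              qed (use abc in auto)
              finally show ?thesis .
            qed
          qed
          have "X * a' ^ (j + 1) \<le> 2 * W * (H / \<epsilon>) * a' ^ m * c ^ (m + 2 * j + 2)"
            using abc W H elim XW bH by (intro commutator_bound_far[of a' b c W]) auto
          \<comment> \<open>One factor 1/\<epsilon> on top of the crude exponents, still within the
            exponent \<open>p\<close>. The induction hypothesis does not enter this case, so the
            loss does not accumulate.\<close>
          also have "2 * W * (H / \<epsilon>) = 2 * (CP * C0) * H * \<epsilon> powr (- (M + p0 + 1))"
          proof -
            have "\<epsilon> powr (- (M + p0 + 1)) = \<epsilon> powr (- (M + p0)) / \<epsilon>"
              using elim by (intro powr_minus_Suc) simp
            then show ?thesis unfolding W_def by simp
          qed
          also have "2 * (CP * C0) * H * \<epsilon> powr (- (M + p0 + 1)) * a' ^ m * c ^ (m + 2 * j + 2) \<le> E * e * a' ^ m * c ^ (m + 2 * j + 2)"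
            unfolding E_def using abc eb K A e CP C0 H by (intro mult_right_mono mult_mono) auto
          finally show ?thesis .
        qed
        then show ?thesis unfolding X_def \<xi>_def c_def T_def .
      qed
      define B where "B = D * E * e * a' ^ m / a' ^ (j + 1)"
      have "norm (q (latt k) * fcoef k (\<lambda>x. \<phi> x * v x) - fcoef k (\<lambda>x. \<phi> x * g x)) \<le> 4 ^ CARD('n) * B"
      proof (rule fcoef_commutator[where z = z and d = \<delta> and p = "\<lambda>k. q (latt k)"])
        show "continuous_on UNIV \<phi>" "continuous_on UNIV v" "continuous_on UNIV g" using \<phi> v g test_fun_continuous by blast+
        show "x \<notin> cball z \<delta> \<Longrightarrow> \<phi> x = 0" "x \<notin> cball z \<delta> \<Longrightarrow> v x = 0" "x \<notin> cball z \<delta> \<Longrightarrow> g x = 0" for x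
          using \<phi> v g \<rho> \<rho>s by (auto simp: test_fun_def)
        show "\<delta> < 1" by (rule \<delta>)
        show "fcoef k g = q (latt k) * fcoef k v" for k by (rule g)
        fix l
        let ?X = "norm ((q (latt k) - q (latt (\<lambda>i. k i - l i))) * fcoef (\<lambda>i. k i - l i) v)"
        have "(norm (fcoef l \<phi>) * ?X * bracket l ^ (2 * CARD('n))) * a' ^ (j + 1) = norm (fcoef l \<phi>) * bracket l ^ (2 * CARD('n)) * (?X * a' ^ (j + 1))"
          by (simp only: mult_ac)
        also have "\<dots> \<le> norm (fcoef l \<phi>) * bracket l ^ (2 * CARD('n)) * (E * e * a' ^ m * bracket l ^ T)"
          by (intro mult_left_mono key) auto
        also have "\<dots> = (norm (fcoef l \<phi>) * bracket l ^ (T + 2 * CARD('n))) * (E * e * a' ^ m)"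
          by (simp only: power_add mult_ac)
        also have "\<dots> \<le> D * (E * e * a' ^ m)" using D(2)[of l] E e a' by (intro mult_right_mono) auto
        finally show "norm (fcoef l \<phi>) * ?X * bracket l ^ (2 * CARD('n)) \<le> B"
          unfolding B_def using a' by (simp only: mult.assoc pos_le_divide_eq zero_less_power less_le_trans[OF zero_less_one])
      qed
      then have "norm (q (latt k) * fcoef k (\<lambda>x. \<phi> x * u \<epsilon> x)) \<le> norm (fcoef k (\<lambda>x. \<phi> x * pdo_net m a u \<epsilon> x)) + 4 ^ CARD('n) * B"
        unfolding \<phi>v \<phi>g using norm_triangle_ineq2[of "q (latt k) * fcoef k (\<lambda>x. \<phi> x * u \<epsilon> x)" "fcoef k (\<lambda>x. \<phi> x * pdo_net m a u \<epsilon> x)"] by linarith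
      then have "norm (q (latt k) * fcoef k (\<lambda>x. \<phi> x * u \<epsilon> x)) * a' ^ (j + 1) \<le> (norm (fcoef k (\<lambda>x. \<phi> x * pdo_net m a u \<epsilon> x)) + 4 ^ CARD('n) * B) * a' ^ (j + 1)"
        using a' by (intro mult_right_mono) auto
      also have "\<dots> = a' ^ (j + 1) * norm (fcoef k (\<lambda>x. \<phi> x * pdo_net m a u \<epsilon> x)) + 4 ^ CARD('n) * (D * E) * e * a' ^ m"
      proof -
        have "B * a' ^ (j + 1) = D * E * e * a' ^ m" unfolding B_def using a' by (intro nonzero_eq_divide_eq[THEN iffD1]) auto
        then show ?thesis unfolding distrib_right mult.assoc[of _ B] by (simp only: mult_ac)
      qed
      also have "a' ^ (j + 1) * norm (fcoef k (\<lambda>x. \<phi> x * pdo_net m a u \<epsilon> x)) \<le> Cf * \<epsilon> powr (- pf)"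
        using elim(3) unfolding a'_def by blast
      also have "Cf * \<epsilon> powr (- pf) \<le> Cf * e * a' ^ m"
      proof -
        have "Cf * \<epsilon> powr (- pf) \<le> Cf * e" using eb Cf by (intro mult_left_mono) auto
        also have "\<dots> \<le> Cf * e * a' ^ m" using mult_left_mono[OF one_le_power[OF a', of m], of "Cf * e"] Cf(1) e by simp
        finally show ?thesis .
      qed
      finally show "symcoef \<epsilon> \<phi> k * bracket k ^ (j + 1) 
        \<le> (Cf + 4 ^ CARD('n) * (D * E)) * \<epsilon> powr (- p) * bracket k ^ m"
        unfolding a'_def q_def e_def by (simp add: algebra_simps)
    qed
  qed
  moreover have "Cf + 4 ^ CARD('n) * (D * E) \<ge> 0" using Cf D E by simp
  ultimately show ?thesis by blast
qed

text \<open>Each step needs the previous bound for a cutoff of larger support, so the induction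
  ranges over all radii below \<delta> and all cutoffs.\<close>

lemma symbol_fcoef_bound:
  assumes "0 < \<rho>" "\<rho> < \<delta>" "test_fun z \<rho> \<phi>"
  shows "\<exists>C\<ge>0. \<forall>\<^sub>F \<epsilon> in at_right 0. \<forall>k.
     symcoef \<epsilon> \<phi> k * bracket k ^ j \<le> C * \<epsilon> powr (- p) * bracket k ^ m"
  using assms
proof (induction j arbitrary: \<rho> \<phi>)
  case 0
  then show ?case by (intro symbol_fcoef_bound_0[of \<rho>]) auto
next
  case (Suc j)
  show ?case using symbol_fcoef_bound_Suc[of j \<rho> \<phi>] Suc by (simp only: Suc_eq_plus1)
qed

text \<open>At frequencies beyond the radius, ellipticity divides the symbol out at the cost of
  \<open>\<epsilon> powr (- N)\<close>, and the factor \<open>bracket k ^ m\<close> cancels. At the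
  remaining ones the slow scale bounds the weight, which gives the exponent p0 + 1, and this is at
  most \<open>p\<close>.\<close>

lemma fcoef_u_decay:
  assumes "0 < \<rho>" "\<rho> < \<delta>" "test_fun z \<rho> \<phi>"
  shows "\<exists>C\<ge>0. \<forall>\<^sub>F \<epsilon> in at_right 0. \<forall>k. norm (fcoef k (\<lambda>x. \<phi> x * u \<epsilon> x)) * bracket k ^ j \<le> C * \<epsilon> powr (- (p + N))"
proof -
  obtain C1 where C1: "C1 \<ge> 0" "\<forall>\<^sub>F \<epsilon> in at_right 0. \<forall>k.
     symcoef \<epsilon> \<phi> k * bracket k ^ j \<le> C1 * \<epsilon> powr (- p) * bracket k ^ m"
    using symbol_fcoef_bound[OF assms] by blast
  obtain C0 where C0: "C0 \<ge> 0" "\<forall>\<^sub>F \<epsilon> in at_right 0. \<forall>k. norm (fcoef k (\<lambda>x. \<phi> x * u \<epsilon> x)) \<le> C0 * \<epsilon> powr (- p0)"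
    using fcoef_u_bound[OF assms(3)] assms(2) by auto
  obtain H where H: "H \<ge> 0" "\<forall>\<^sub>F \<epsilon> in at_right 0. (2 + 2 * r \<epsilon>) ^ j \<le> H / \<epsilon>" using slow by blast
  have "\<forall>\<^sub>F \<epsilon> in at_right 0. \<forall>k. norm (fcoef k (\<lambda>x. \<phi> x * u \<epsilon> x)) * bracket k ^ j \<le> (C1 + C0 * H) * \<epsilon> powr (- (p + N))"
    using C1(2) C0(2) H(2) elliptic eventually_unit_interval radius
  proof eventually_elim
    case (elim \<epsilon>)
    show ?case
    proof
      fix k
      let ?c = "norm (fcoef k (\<lambda>x. \<phi> x * u \<epsilon> x))"
      have b: "1 \<le> bracket k" by simp
      have e: "0 < \<epsilon> powr (- (p + N))" using elim by simp
      show "?c * bracket k ^ j \<le> (C1 + C0 * H) * \<epsilon> powr (- (p + N))"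
      proof (cases "r \<epsilon> \<le> norm (latt k)")
        case True
        have "(\<epsilon> powr N * bracket k ^ m) * ?c * bracket k ^ j \<le> norm (symbol_net m a \<epsilon> (latt k)) * ?c * bracket k ^ j"
          using elim(4) True by (intro mult_right_mono) auto
        also have "\<dots> \<le> C1 * \<epsilon> powr (- p) * bracket k ^ m" using elim(1)[rule_format, of k] by (simp add: norm_mult)
        finally have "bracket k ^ m * (\<epsilon> powr N * (?c * bracket k ^ j)) \<le> bracket k ^ m * (C1 * \<epsilon> powr (- p))"
          by (simp only: mult_ac)
        moreover have "0 < bracket k ^ m" using b by (intro zero_less_power) linarith
        ultimately have "\<epsilon> powr N * (?c * bracket k ^ j) \<le> C1 * \<epsilon> powr (- p)" by (simp only: mult_le_cancel_left_pos)
        then have "\<epsilon> powr (- N) * (\<epsilon> powr N * (?c * bracket k ^ j)) \<le> \<epsilon> powr (- N) * (C1 * \<epsilon> powr (- p))"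
          by (intro mult_left_mono) auto
        moreover have "\<epsilon> powr (- N) * \<epsilon> powr N = 1" using elim by (simp flip: powr_add)
        moreover have "\<epsilon> powr (- N) * \<epsilon> powr (- p) = \<epsilon> powr (- (p + N))"
          by (simp add: powr_add[symmetric] algebra_simps)
        ultimately have "?c * bracket k ^ j \<le> C1 * \<epsilon> powr (- (p + N))"
          by (simp only: mult.assoc[symmetric] mult_1) (simp only: mult_ac)
        also have "\<dots> \<le> (C1 + C0 * H) * \<epsilon> powr (- (p + N))" using e C0 H by (intro mult_right_mono) auto
        finally show ?thesis .
      next
        case False
        then have "bracket k ^ j \<le> (2 + 2 * r \<epsilon>) ^ j" using elim(6) by (intro power_mono) auto
        then have "bracket k ^ j \<le> H / \<epsilon>" using elim(3) by linarith
        then have "?c * bracket k ^ j \<le> (C0 * \<epsilon> powr (- p0)) * (H / \<epsilon>)" using elim(2) C0 b by (intro mult_mono) auto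
        also have "\<dots> = (C0 * H) * \<epsilon> powr (- (p0 + 1))"
          using elim by (simp only: powr_minus_Suc) simp
        also have "\<dots> \<le> (C1 + C0 * H) * \<epsilon> powr (- (p + N))"
          using elim C0 C1 H exponents by (intro mult_mono powr_mono_neg) (auto simp: p_def)
        finally show ?thesis .
      qed
    qed
  qed
  moreover have "C1 + C0 * H \<ge> 0" using C0 C1 H by simp
  ultimately show ?thesis by blast
qed

text \<open>The order of \<alpha> determines how many powers of decay are requested and the constant
  \<open>C\<close>, but not the exponent of \<epsilon>.\<close>

lemma mderiv_bound:
  "\<exists>C\<ge>0. \<forall>\<^sub>F \<epsilon> in at_right 0. \<forall>x\<in>ball z (\<delta> / 2). norm (mderiv \<alpha> (u \<epsilon>) x) \<le> C * \<epsilon> powr (- (p + N))"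
proof -
  define \<rho> where "\<rho> = 3 * \<delta> / 4"
  have \<rho>: "0 < \<rho>" "\<rho> < \<delta>" "\<delta> / 2 < \<rho>" "0 < \<delta> / 2" using \<delta> by (auto simp: \<rho>_def)
  from exists_smooth_bump[OF \<rho>(4,3), of z] obtain \<phi> where \<phi>: "smooth_on UNIV \<phi>" "\<forall>x\<in>cball z (\<delta> / 2). \<phi> x = 1"
    "\<forall>x. x \<notin> ball z \<rho> \<longrightarrow> \<phi> x = 0" by blast
  have \<phi>t: "test_fun z \<rho> \<phi>" using \<phi> unfolding test_fun_def by force
  \<comment> \<open>One part pays for the monomial of \<alpha>, the other for the summation over the
    lattice.\<close>
  define j where "j = mi_order \<alpha> + 2 * CARD('n)"
  obtain C where C: "C \<ge> 0" "\<forall>\<^sub>F \<epsilon> in at_right 0. \<forall>k. norm (fcoef k (\<lambda>x. \<phi> x * u \<epsilon> x)) * bracket k ^ j \<le> C * \<epsilon> powr (- (p + N))"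
    using fcoef_u_decay[OF \<rho>(1,2) \<phi>t] by blast
  have "\<forall>\<^sub>F \<epsilon> in at_right 0. \<forall>x\<in>ball z (\<delta> / 2). norm (mderiv \<alpha> (u \<epsilon>) x) \<le> (4 ^ CARD('n) * C) * \<epsilon> powr (- (p + N))"
    using C(2) smooth_u
  proof eventually_elim
    case (elim \<epsilon>)
    have t: "test_fun z \<rho> (\<lambda>x. \<phi> x * u \<epsilon> x)" using \<phi>t \<rho> elim(2) by (intro cutoff_test_fun) auto
    define g where "g = mderiv \<alpha> (\<lambda>x. \<phi> x * u \<epsilon> x)"
    have g: "test_fun z \<rho> g" unfolding g_def using t by (rule test_fun_mderiv)
    have "norm (g x) \<le> 4 ^ CARD('n) * (C * \<epsilon> powr (- (p + N)))" for x
    proof (rule sup_le_fcoef[where z = z and d = \<rho>])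
      show "continuous_on UNIV g" using g by (rule test_fun_continuous)
      show "x \<notin> cball z \<rho> \<Longrightarrow> g x = 0" for x using g by (simp add: test_fun_def)
      show "\<rho> < 1" using \<rho> \<delta> by linarith
      fix l
      have "norm (fcoef l g) * bracket l ^ (2 * CARD('n)) = \<bar>monomial \<alpha> (latt l)\<bar> * (norm (fcoef l (\<lambda>x. \<phi> x * u \<epsilon> x)) * bracket l ^ (2 * CARD('n)))"
        unfolding g_def fcoef_mderiv[OF t] by (simp add: norm_mult norm_power)
      also have "\<dots> \<le> bracket l ^ mi_order \<alpha> * (norm (fcoef l (\<lambda>x. \<phi> x * u \<epsilon> x)) * bracket l ^ (2 * CARD('n)))"
        by (intro mult_right_mono abs_monomial_le) auto
      also have "\<dots> = norm (fcoef l (\<lambda>x. \<phi> x * u \<epsilon> x)) * bracket l ^ j" unfolding j_def power_add by (simp only: mult_ac)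
      also have "\<dots> \<le> C * \<epsilon> powr (- (p + N))" using elim(1) by blast
      finally show "norm (fcoef l g) * bracket l ^ (2 * CARD('n)) \<le> C * \<epsilon> powr (- (p + N))" .
    qed
    moreover have "g x = mderiv \<alpha> (u \<epsilon>) x" if "x \<in> ball z (\<delta> / 2)" for x
      unfolding g_def by (rule mderiv_cong_open[of "ball z (\<delta> / 2)"]) (use that \<phi> in auto)
    ultimately show ?case unfolding mult.assoc by metis
  qed
  then show ?thesis using C by (intro exI[of _ "4 ^ CARD('n) * C"]) auto
qed

end

section \<open>Passing to the Colombeau algebra\<close>

text \<open>Partial derivatives commute because both sides have the same Fourier coefficients after
  localisation.\<close>

lemma mderiv_mderiv:
  fixes f :: "real^'n::finite \<Rightarrow> complex"
  assumes S: "open S" "smooth_on S f" "x \<in> S"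
  shows "mderiv \<alpha> (mderiv \<beta> f) x = mderiv (\<lambda>i. \<alpha> i + \<beta> i) f x"
proof -
  obtain d0 where d0: "0 < d0" "cball x d0 \<subseteq> S" using S open_contains_cball by blast
  \<comment> \<open>The radius has to stay below 1 for \<open>sup_le_fcoef\<close>.\<close>
  define d where "d = min d0 (1/2)"
  have d: "0 < d" "d < 1" "cball x d \<subseteq> S" "0 < d / 2" "d / 2 < d" using d0 by (auto simp: d_def)
  from exists_smooth_bump[OF d(4,5), of x] obtain \<phi> where \<phi>: "smooth_on UNIV \<phi>"
    "\<forall>y\<in>cball x (d/2). \<phi> y = 1" "\<forall>y. y \<notin> ball x d \<longrightarrow> \<phi> y = 0" by blast
  have \<phi>t: "test_fun x d \<phi>" using \<phi> unfolding test_fun_def by force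
  define h where "h y = \<phi> y * f y" for y
  have h: "test_fun x d h" unfolding h_def by (rule test_fun_mult[OF \<phi>t S(1) d(3) S(2)])
  have hf: "f y = h y" if "y \<in> ball x (d/2)" for y using that \<phi>(2) by (simp add: h_def)
  have 1: "mderiv \<gamma> f y = mderiv \<gamma> h y" if "y \<in> ball x (d/2)" for y \<gamma>
    by (rule mderiv_cong_open[OF open_ball hf that])
  have 2: "mderiv \<alpha> (mderiv \<beta> f) x = mderiv \<alpha> (mderiv \<beta> h) x"
    by (rule mderiv_cong_open[of "ball x (d/2)"]) (use d 1 in auto)
  define D1 D2 where "D1 = mderiv \<alpha> (mderiv \<beta> h)" and "D2 = mderiv (\<lambda>i. \<alpha> i + \<beta> i) h"
  have D: "test_fun x d D1" "test_fun x d D2" unfolding D1_def D2_def by (intro test_fun_mderiv h)+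
  have mono: "monomial (\<lambda>i. \<alpha> i + \<beta> i) y = monomial \<alpha> y * monomial \<beta> y" for y :: "real^'n"
    by (simp add: monomial_def power_add prod.distrib)
  have ord: "mi_order (\<lambda>i. \<alpha> i + \<beta> i) = mi_order \<alpha> + mi_order \<beta>" by (simp add: mi_order_def sum.distrib)
  have "fcoef k D1 = fcoef k D2" for k
    unfolding D1_def D2_def fcoef_mderiv[OF test_fun_mderiv[OF h]] fcoef_mderiv[OF h] mono ord
    by (simp add: power_add)
  moreover have "fcoef k (\<lambda>y. D1 y - D2 y) = fcoef k D1 - fcoef k D2" for k
    using D test_fun_continuous[OF D(1)] test_fun_continuous[OF D(2)]
    by (intro fcoef_diff[of _ x d]) (auto simp: test_fun_def)
  ultimately have z: "fcoef k (\<lambda>y. D1 y - D2 y) = 0" for k by simp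
  have "norm ((\<lambda>y. D1 y - D2 y) x) \<le> 4 ^ CARD('n) * 0"
  proof (rule sup_le_fcoef[of _ x d])
    show "continuous_on UNIV (\<lambda>y. D1 y - D2 y)"
      using test_fun_continuous[OF D(1)] test_fun_continuous[OF D(2)] by (intro continuous_intros)
    show "y \<notin> cball x d \<Longrightarrow> D1 y - D2 y = 0" for y using D by (simp add: test_fun_def)
  qed (use d z in auto)
  then have "D1 x = D2 x" by simp
  moreover have "mderiv (\<lambda>i. \<alpha> i + \<beta> i) f x = D2 x" unfolding D2_def by (rule 1) (use d in auto)
  ultimately show ?thesis using 2 D1_def by simp
qed

section \<open>Linearity of derivatives and polynomial bounds in 1/\<epsilon>\<close>

lemma fold_partial_lincomb:
  assumes S: "open S"
  shows "(\<And>j. j \<in> J \<Longrightarrow> smooth_on S (f j)) \<Longrightarrow> x \<in> S \<Longrightarrow>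
    fold partial is (\<lambda>x. \<Sum>j\<in>J. c j * f j x) x = (\<Sum>j\<in>J. c j * fold partial is (f j) x)"
proof (induction "is" arbitrary: f)
  case (Cons i "is")
  have "partial i (\<lambda>x. \<Sum>j\<in>J. c j * f j x) y = (\<Sum>j\<in>J. c j * partial i (f j) y)" if "y \<in> S" for y
  proof -
    have "((\<lambda>x. \<Sum>j\<in>J. c j * f j x) has_derivative (\<lambda>h. \<Sum>j\<in>J. c j * frechet_derivative (f j) (at y) h)) (at y)"
      using smooth_on_differentiable[OF Cons.prems(1) that]
      by (intro has_derivative_sum has_derivative_mult_right has_derivative_partial) auto
    from partial_eqI[OF this] show ?thesis by (simp add: partial_def)
  qed
  then have "fold partial is (partial i (\<lambda>x. \<Sum>j\<in>J. c j * f j x)) x = fold partial is (\<lambda>x. \<Sum>j\<in>J. c j * partial i (f j) x) x"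
    using Cons.prems(2) by (intro fold_partial_cong_open[OF S]) auto
  also have "\<dots> = (\<Sum>j\<in>J. c j * fold partial is (partial i (f j)) x)"
    using Cons.prems by (intro Cons.IH smooth_on_partial)
  finally show ?case by simp
qed simp

lemma mderiv_lincomb:
  assumes "open S" "\<And>j. j \<in> J \<Longrightarrow> smooth_on S (f j)" "x \<in> S"
  shows "mderiv \<alpha> (\<lambda>x. \<Sum>j\<in>J. c j * f j x) x = (\<Sum>j\<in>J. c j * mderiv \<alpha> (f j) x)"
proof -
  obtain "is" where "\<And>h :: real^'a \<Rightarrow> complex. mderiv \<alpha> h = fold partial is h" using mderiv_eq_fold[of \<alpha>] by blast
  then show ?thesis using fold_partial_lincomb[OF assms(1), of J f x "is" c] assms(2,3) by simp
qed

text \<open>The domain has an arbitrary type, so that the same closure rules serve derivatives on a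
  compact set, symbols on the whole frequency space, and generalized numbers.\<close>

definition poly_bounded :: "'a set \<Rightarrow> (real \<Rightarrow> 'a \<Rightarrow> complex) \<Rightarrow> bool" where
  "poly_bounded K h \<longleftrightarrow> (\<exists>p\<ge>0. \<exists>C\<ge>0. \<forall>\<^sub>F \<epsilon> in at_right 0. \<forall>x\<in>K. norm (h \<epsilon> x) \<le> C * \<epsilon> powr (- p))"

lemma poly_boundedI:
  assumes "p \<ge> 0" "C \<ge> 0" "\<forall>\<^sub>F \<epsilon> in at_right 0. \<forall>x\<in>K. norm (h \<epsilon> x) \<le> C * \<epsilon> powr (- p)"
  shows "poly_bounded K h"
  using assms unfolding poly_bounded_def by blast

lemma poly_boundedI_const:
  assumes "\<And>\<epsilon> x. x \<in> K \<Longrightarrow> norm (h \<epsilon> x) \<le> C"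
  shows "poly_bounded K h"
proof (rule poly_boundedI[where p = 0 and C = "max C 0"])
  show "\<forall>\<^sub>F \<epsilon> in at_right 0. \<forall>x\<in>K. norm (h \<epsilon> x) \<le> max C 0 * \<epsilon> powr - 0"
    using eventually_unit_interval
    by eventually_elim (use assms in \<open>auto simp: le_max_iff_disj\<close>)
qed auto

lemma poly_bounded_add:
  assumes "poly_bounded K f" "poly_bounded K g"
  shows "poly_bounded K (\<lambda>\<epsilon> x. f \<epsilon> x + g \<epsilon> x)"
proof -
  obtain p C where f: "p \<ge> 0" "C \<ge> 0" "\<forall>\<^sub>F \<epsilon> in at_right 0. \<forall>x\<in>K. norm (f \<epsilon> x) \<le> C * \<epsilon> powr (- p)"
    using assms(1) unfolding poly_bounded_def by blast
  obtain q D where g: "q \<ge> 0" "D \<ge> 0" "\<forall>\<^sub>F \<epsilon> in at_right 0. \<forall>x\<in>K. norm (g \<epsilon> x) \<le> D * \<epsilon> powr (- q)"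
    using assms(2) unfolding poly_bounded_def by blast
  have "\<forall>\<^sub>F \<epsilon> in at_right 0. \<forall>x\<in>K. norm (f \<epsilon> x + g \<epsilon> x) \<le> (C + D) * \<epsilon> powr (- (p + q))"
    using f(3) g(3) eventually_unit_interval
  proof eventually_elim
    case (elim \<epsilon>)
    have "C * \<epsilon> powr (- p) \<le> C * \<epsilon> powr (- (p + q))" "D * \<epsilon> powr (- q) \<le> D * \<epsilon> powr (- (p + q))"
      using elim f g by (auto intro!: mult_left_mono powr_mono')
    moreover have "norm (f \<epsilon> x + g \<epsilon> x) \<le> C * \<epsilon> powr (- p) + D * \<epsilon> powr (- q)" if "x \<in> K" for x
      using elim(1,2) that by (intro norm_triangle_le add_mono) auto
    ultimately show ?case unfolding distrib_right by (meson add_mono order_trans)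
  qed
  then show ?thesis using f g by (intro poly_boundedI[of "p + q" "C + D"] add_nonneg_nonneg)
qed

lemma poly_bounded_mult:
  assumes "poly_bounded K f" "poly_bounded K g"
  shows "poly_bounded K (\<lambda>\<epsilon> x. f \<epsilon> x * g \<epsilon> x)"
proof -
  obtain p C where f: "p \<ge> 0" "C \<ge> 0" "\<forall>\<^sub>F \<epsilon> in at_right 0. \<forall>x\<in>K. norm (f \<epsilon> x) \<le> C * \<epsilon> powr (- p)"
    using assms(1) unfolding poly_bounded_def by blast
  obtain q D where g: "q \<ge> 0" "D \<ge> 0" "\<forall>\<^sub>F \<epsilon> in at_right 0. \<forall>x\<in>K. norm (g \<epsilon> x) \<le> D * \<epsilon> powr (- q)"
    using assms(2) unfolding poly_bounded_def by blast
  have "\<forall>\<^sub>F \<epsilon> in at_right 0. \<forall>x\<in>K. norm (f \<epsilon> x * g \<epsilon> x) \<le> (C * D) * \<epsilon> powr (- (p + q))"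
    using f(3) g(3)
  proof eventually_elim
    case (elim \<epsilon>)
    show ?case
    proof
      fix x assume "x \<in> K"
      then have "norm (f \<epsilon> x * g \<epsilon> x) \<le> (C * \<epsilon> powr (- p)) * (D * \<epsilon> powr (- q))"
        unfolding norm_mult using elim f by (intro mult_mono) auto
      also have "\<dots> = (C * D) * \<epsilon> powr (- p + - q)" by (simp only: powr_add mult_ac)
      finally show "norm (f \<epsilon> x * g \<epsilon> x) \<le> (C * D) * \<epsilon> powr (- (p + q))" by simp
    qed
  qed
  then show ?thesis using f g by (intro poly_boundedI[of "p + q" "C * D"] add_nonneg_nonneg mult_nonneg_nonneg)
qed

lemma poly_bounded_sum:
  "(\<And>j. j \<in> J \<Longrightarrow> poly_bounded K (f j)) \<Longrightarrow> poly_bounded K (\<lambda>\<epsilon> x. \<Sum>j\<in>J. f j \<epsilon> x)"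
  by (induction J rule: infinite_finite_induct)
     (simp_all add: poly_bounded_add poly_boundedI_const[where C = 0])

lemma poly_bounded_cong:
  assumes "\<forall>\<^sub>F \<epsilon> in at_right 0. \<forall>x\<in>K. f \<epsilon> x = g \<epsilon> x" "poly_bounded K g"
  shows "poly_bounded K f"
proof -
  obtain p C where g: "p \<ge> 0" "C \<ge> 0" "\<forall>\<^sub>F \<epsilon> in at_right 0. \<forall>x\<in>K. norm (g \<epsilon> x) \<le> C * \<epsilon> powr (- p)"
    using assms(2) unfolding poly_bounded_def by blast
  have "\<forall>\<^sub>F \<epsilon> in at_right 0. \<forall>x\<in>K. norm (f \<epsilon> x) \<le> C * \<epsilon> powr (- p)"
    using assms(1) g(3) by eventually_elim auto
  then show ?thesis using g unfolding poly_bounded_def by blast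
qed

text \<open>A real supremum is informative only over a bounded nonempty set. Smoothness and
  compactness give boundedness for \<epsilon> in (0,1), and a point of \<open>K\<close> gives
  nonnegativity, so that the norm in the Landau symbol can be removed.\<close>

lemma sup_on_bigo_iff:
  assumes v: "v \<in> smooth_nets \<Omega>" and K: "K \<in> compacts_in \<Omega>"
  shows "(\<lambda>\<epsilon>. sup_on K (mderiv \<alpha> (v \<epsilon>))) \<in> O[at_right 0](\<lambda>\<epsilon>. \<epsilon> powr s) \<longleftrightarrow>
    (\<exists>C\<ge>0. \<forall>\<^sub>F \<epsilon> in at_right 0. \<forall>x\<in>K. norm (mderiv \<alpha> (v \<epsilon>) x) \<le> C * \<epsilon> powr s)"
proof -
  have Kc: "compact K" "K \<subseteq> \<Omega>" "K \<noteq> {}" using K by (auto simp: compacts_in_def)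
  have bd: "bdd_above ((\<lambda>x. norm (mderiv \<alpha> (v \<epsilon>) x)) ` K)" if "0 < \<epsilon>" "\<epsilon> < 1" for \<epsilon>
  proof -
    have "smooth_on \<Omega> (mderiv \<alpha> (v \<epsilon>))" using v that by (intro smooth_on_mderiv) (auto simp: smooth_nets_def)
    then have "continuous_on K (\<lambda>x. norm (mderiv \<alpha> (v \<epsilon>) x))"
      using Kc(2) by (intro continuous_intros) (auto intro: continuous_on_subset smooth_on_continuous)
    then show ?thesis using Kc(1) by (intro bounded_imp_bdd_above compact_imp_bounded compact_continuous_image)
  qed
  show ?thesis
  proof
    assume "(\<lambda>\<epsilon>. sup_on K (mderiv \<alpha> (v \<epsilon>))) \<in> O[at_right 0](\<lambda>\<epsilon>. \<epsilon> powr s)"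
    then obtain C where C: "C > 0" "\<forall>\<^sub>F \<epsilon> in at_right 0. norm (sup_on K (mderiv \<alpha> (v \<epsilon>))) \<le> C * norm (\<epsilon> powr s)"
      by (elim landau_o.bigE)
    have "\<forall>\<^sub>F \<epsilon> in at_right 0. \<forall>x\<in>K. norm (mderiv \<alpha> (v \<epsilon>) x) \<le> C * \<epsilon> powr s"
      using C(2) eventually_unit_interval
    proof eventually_elim
      case (elim \<epsilon>)
      show ?case
      proof
        fix x assume "x \<in> K"
        then have "norm (mderiv \<alpha> (v \<epsilon>) x) \<le> sup_on K (mderiv \<alpha> (v \<epsilon>))"
          unfolding sup_on_def using bd elim by (intro cSUP_upper) auto
        then show "norm (mderiv \<alpha> (v \<epsilon>) x) \<le> C * \<epsilon> powr s" using elim(1) by simp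
      qed
    qed
    then show "\<exists>C\<ge>0. \<forall>\<^sub>F \<epsilon> in at_right 0. \<forall>x\<in>K. norm (mderiv \<alpha> (v \<epsilon>) x) \<le> C * \<epsilon> powr s"
      using C(1) by (intro exI[of _ C]) auto
  next
    assume "\<exists>C\<ge>0. \<forall>\<^sub>F \<epsilon> in at_right 0. \<forall>x\<in>K. norm (mderiv \<alpha> (v \<epsilon>) x) \<le> C * \<epsilon> powr s"
    then obtain C where C: "C \<ge> 0" "\<forall>\<^sub>F \<epsilon> in at_right 0. \<forall>x\<in>K. norm (mderiv \<alpha> (v \<epsilon>) x) \<le> C * \<epsilon> powr s" by blast
    obtain x0 where x0: "x0 \<in> K" using Kc by blast
    have "\<forall>\<^sub>F \<epsilon> in at_right 0. norm (sup_on K (mderiv \<alpha> (v \<epsilon>))) \<le> C * norm (\<epsilon> powr s)"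
      using C(2) eventually_unit_interval
    proof eventually_elim
      case (elim \<epsilon>)
      have "sup_on K (mderiv \<alpha> (v \<epsilon>)) \<le> C * \<epsilon> powr s"
        unfolding sup_on_def using elim Kc by (intro cSUP_least) auto
      moreover have "norm (mderiv \<alpha> (v \<epsilon>) x0) \<le> sup_on K (mderiv \<alpha> (v \<epsilon>))"
        unfolding sup_on_def using bd elim x0 by (intro cSUP_upper) auto
      then have "0 \<le> sup_on K (mderiv \<alpha> (v \<epsilon>))" by (rule order_trans[OF norm_ge_zero])
      ultimately show ?case by simp
    qed
    then show "(\<lambda>\<epsilon>. sup_on K (mderiv \<alpha> (v \<epsilon>))) \<in> O[at_right 0](\<lambda>\<epsilon>. \<epsilon> powr s)" by (rule bigoI)
  qed
qed

lemma moderate_nets_iff: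
  "u \<in> moderate_nets \<Omega> \<longleftrightarrow> u \<in> smooth_nets \<Omega> \<and>
     (\<forall>K\<in>compacts_in \<Omega>. \<forall>\<alpha>. poly_bounded K (\<lambda>\<epsilon>. mderiv \<alpha> (u \<epsilon>)))"
  unfolding moderate_nets_def poly_bounded_def using sup_on_bigo_iff[of u \<Omega>] by auto

section \<open>Representatives and the passage to classes\<close>

lemma mem_colombeau_class:
  assumes "U \<in> colombeau \<Omega>"
  obtains u where "u \<in> moderate_nets \<Omega>" "U = colombeau_rel \<Omega> `` {u}"
  using assms unfolding colombeau_def by (auto elim: quotientE)

lemma zero_negligible:
  assumes "open \<Omega>"
  shows "(\<lambda>\<epsilon> x. 0) \<in> negligible_nets \<Omega>"
proof -
  have s: "(\<lambda>\<epsilon> x. 0) \<in> smooth_nets \<Omega>" using smooth_on_const[OF assms] by (simp add: smooth_nets_def)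
  have "mderiv \<alpha> (\<lambda>x. 0) x = 0" for \<alpha> and x :: "real^'a"
    \<comment> \<open>The zero function is the empty linear combination.\<close>
    using mderiv_lincomb[of UNIV "{}" "\<lambda>_ _. 0" x \<alpha> "\<lambda>_. 0"] by simp
  then show ?thesis unfolding negligible_nets_def using s sup_on_bigo_iff[OF s]
    by (auto intro!: exI[of _ 0])
qed

lemma colombeau_rel_refl: "open \<Omega> \<Longrightarrow> u \<in> moderate_nets \<Omega> \<Longrightarrow> (u, u) \<in> colombeau_rel \<Omega>"
  using zero_negligible by (simp add: colombeau_rel_def)

lemma moderate_number_poly_bounded:
  assumes "c \<in> moderate_numbers"
  shows "poly_bounded K (\<lambda>\<epsilon> x. c \<epsilon>)"
proof -
  obtain p where p: "p \<ge> 0" "(\<lambda>\<epsilon>. norm (c \<epsilon>)) \<in> O[at_right 0](\<lambda>\<epsilon>. \<epsilon> powr (- p))"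
    using assms unfolding moderate_numbers_def by blast
  then obtain C where C: "C > 0" "\<forall>\<^sub>F \<epsilon> in at_right 0. norm (norm (c \<epsilon>)) \<le> C * norm (\<epsilon> powr (- p))"
    by (elim landau_o.bigE)
  have "\<forall>\<^sub>F \<epsilon> in at_right 0. \<forall>x\<in>K. norm (c \<epsilon>) \<le> C * \<epsilon> powr (- p)"
    using C(2) by eventually_elim auto
  then show ?thesis using p C by (intro poly_boundedI[of p C]) auto
qed

lemma coeff_reps_moderate:
  assumes "a \<in> coeff_reps m A" "A \<gamma> \<in> gen_complex" "mi_order \<gamma> \<le> m"
  shows "a \<gamma> \<in> moderate_numbers"
  using assms by (auto simp: coeff_reps_def gen_complex_def gen_complex_rel_def elim!: quotientE)

lemma mderiv_pdo_net:
  assumes "open S" "smooth_on S (u \<epsilon>)" "x \<in> S"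
  shows "mderiv \<alpha> (pdo_net m a u \<epsilon>) x =
    (\<Sum>\<gamma> | mi_order \<gamma> \<le> m. (a \<gamma> \<epsilon> * (- \<i>) ^ mi_order \<gamma>) * mderiv (\<lambda>i. \<alpha> i + \<gamma> i) (u \<epsilon>) x)"
proof -
  have eq: "pdo_net m a u \<epsilon> = (\<lambda>x. \<Sum>\<gamma> | mi_order \<gamma> \<le> m. (a \<gamma> \<epsilon> * (- \<i>) ^ mi_order \<gamma>) * mderiv \<gamma> (u \<epsilon>) x)"
    by (auto simp: fun_eq_iff pdo_net_def mult_ac)
  show ?thesis unfolding eq using assms
    by (subst mderiv_lincomb[OF assms(1)]) (auto intro: smooth_on_mderiv simp: mderiv_mderiv)
qed

lemma pdo_net_moderate:
  assumes \<Omega>: "open \<Omega>" and u: "u \<in> moderate_nets \<Omega>"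
    and a: "\<And>\<gamma>. mi_order \<gamma> \<le> m \<Longrightarrow> a \<gamma> \<in> moderate_numbers"
  shows "pdo_net m a u \<in> moderate_nets \<Omega>"
  unfolding moderate_nets_iff
proof (intro conjI ballI allI)
  have su: "\<And>\<epsilon>. \<epsilon> \<in> {0<..1} \<Longrightarrow> smooth_on \<Omega> (u \<epsilon>)" using u by (auto simp: moderate_nets_iff smooth_nets_def)
  then show "pdo_net m a u \<in> smooth_nets \<Omega>" using smooth_on_pdo_net[OF \<Omega>, of u] by (auto simp: smooth_nets_def)
  fix K \<alpha> assume K: "K \<in> compacts_in \<Omega>"
  show "poly_bounded K (\<lambda>\<epsilon>. mderiv \<alpha> (pdo_net m a u \<epsilon>))"
  proof (rule poly_bounded_cong)
    show "\<forall>\<^sub>F \<epsilon> in at_right 0. \<forall>x\<in>K. mderiv \<alpha> (pdo_net m a u \<epsilon>) x =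
       (\<Sum>\<gamma> | mi_order \<gamma> \<le> m. (a \<gamma> \<epsilon> * (- \<i>) ^ mi_order \<gamma>) * mderiv (\<lambda>i. \<alpha> i + \<gamma> i) (u \<epsilon>) x)"
      using eventually_unit_interval
      by eventually_elim (use mderiv_pdo_net[OF \<Omega> su] K in \<open>auto simp: compacts_in_def\<close>)
    show "poly_bounded K (\<lambda>\<epsilon> x. \<Sum>\<gamma> | mi_order \<gamma> \<le> m. (a \<gamma> \<epsilon> * (- \<i>) ^ mi_order \<gamma>) * mderiv (\<lambda>i. \<alpha> i + \<gamma> i) (u \<epsilon>) x)"
    proof (intro poly_bounded_sum poly_bounded_mult)
      show "poly_bounded K (\<lambda>\<epsilon>. mderiv (\<lambda>i. \<alpha> i + \<gamma> i) (u \<epsilon>))" for \<gamma>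
        using u K by (auto simp: moderate_nets_iff)
      show "poly_bounded K (\<lambda>\<epsilon> x. (- \<i>) ^ mi_order \<gamma>)" for \<gamma> :: "'a multiindex"
        by (rule poly_boundedI_const[where C = 1]) (simp add: norm_power)
      show "\<gamma> \<in> {\<gamma>. mi_order \<gamma> \<le> m} \<Longrightarrow> poly_bounded K (\<lambda>\<epsilon> x. a \<gamma> \<epsilon>)" for \<gamma>
        using a by (intro moderate_number_poly_bounded) auto
    qed
  qed
qed

text \<open>Divided by (1 + |\<xi>|)^m, each monomial is bounded by 1 on the whole frequency space,
  and the closure rules for \<open>poly_bounded\<close> give a bound uniform in \<xi>.\<close>

lemma symbol_net_bound:
  fixes a :: "'n::finite multiindex \<Rightarrow> real \<Rightarrow> complex"
  assumes a: "\<And>\<gamma>. mi_order \<gamma> \<le> m \<Longrightarrow> a \<gamma> \<in> moderate_numbers"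
  obtains M C where "M \<ge> 0" "C \<ge> 0" "\<forall>\<^sub>F \<epsilon> in at_right 0. \<forall>\<xi>.
        norm (symbol_net m a \<epsilon> \<xi>) \<le> C * \<epsilon> powr (- M) * (1 + norm \<xi>) ^ m"
proof -
  have pos: "0 < (1 + norm \<xi>) ^ m" for \<xi> :: "real^'n" by (intro zero_less_power add_pos_nonneg) auto
  have "poly_bounded UNIV (\<lambda>\<epsilon> \<xi>. \<Sum>\<gamma> | mi_order \<gamma> \<le> m. a \<gamma> \<epsilon> * complex_of_real (monomial \<gamma> \<xi> / (1 + norm (\<xi> :: real^'n)) ^ m))"
  proof (intro poly_bounded_sum poly_bounded_mult)
    fix \<gamma> :: "'n multiindex" assume \<gamma>: "\<gamma> \<in> {\<gamma>. mi_order \<gamma> \<le> m}"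
    then show "poly_bounded UNIV (\<lambda>\<epsilon> x. a \<gamma> \<epsilon>)" using a by (intro moderate_number_poly_bounded) auto
    show "poly_bounded UNIV (\<lambda>\<epsilon> \<xi>. complex_of_real (monomial \<gamma> \<xi> / (1 + norm \<xi>) ^ m))"
    proof (rule poly_boundedI_const[where C = 1])
      fix \<xi> :: "real^'n"
      have "\<bar>monomial \<gamma> \<xi>\<bar> \<le> (1 + norm \<xi>) ^ mi_order \<gamma>" by (rule abs_monomial_le)
      also have "\<dots> \<le> (1 + norm \<xi>) ^ m" using \<gamma> by (intro power_increasing) auto
      finally show "norm (complex_of_real (monomial \<gamma> \<xi> / (1 + norm \<xi>) ^ m)) \<le> 1"
        unfolding norm_of_real abs_divide using pos[of \<xi>] by (simp add: divide_le_eq_1)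
    qed
  qed
  then obtain M C where MC: "M \<ge> 0" "C \<ge> 0" "\<forall>\<^sub>F \<epsilon> in at_right 0. \<forall>\<xi>\<in>UNIV.
     norm (\<Sum>\<gamma> | mi_order \<gamma> \<le> m. a \<gamma> \<epsilon> * complex_of_real (monomial \<gamma> \<xi> / (1 + norm (\<xi> :: real^'n)) ^ m)) \<le> C * \<epsilon> powr (- M)"
    unfolding poly_bounded_def by blast
  have "\<forall>\<^sub>F \<epsilon> in at_right 0. \<forall>\<xi>. norm (symbol_net m a \<epsilon> \<xi>) \<le> C * \<epsilon> powr (- M) * (1 + norm \<xi>) ^ m"
    using MC(3)
  proof eventually_elim
    case (elim \<epsilon>)
    show ?case
    proof
      fix \<xi> :: "real^'n"
      have "symbol_net m a \<epsilon> \<xi> = (\<Sum>\<gamma> | mi_order \<gamma> \<le> m. a \<gamma> \<epsilon> * complex_of_real (monomial \<gamma> \<xi> / (1 + norm \<xi>) ^ m)) * complex_of_real ((1 + norm \<xi>) ^ m)"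
      proof -
        have "t / (1 + norm \<xi>) ^ m * (1 + norm \<xi>) ^ m = t" for t unfolding times_divide_eq_left using less_imp_neq[OF pos[of \<xi>], symmetric] by (rule nonzero_mult_div_cancel_right)
        then show ?thesis unfolding symbol_net_def sum_distrib_right mult.assoc of_real_mult[symmetric] by simp
      qed
      then have "norm (symbol_net m a \<epsilon> \<xi>) = norm (\<Sum>\<gamma> | mi_order \<gamma> \<le> m. a \<gamma> \<epsilon> * complex_of_real (monomial \<gamma> \<xi> / (1 + norm \<xi>) ^ m)) * (1 + norm \<xi>) ^ m"
        by (simp only: norm_mult norm_of_real abs_of_pos[OF pos])
      also have "\<dots> \<le> C * \<epsilon> powr (- M) * (1 + norm \<xi>) ^ m"
        using elim pos[of \<xi>] by (intro mult_right_mono) auto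
      finally show "norm (symbol_net m a \<epsilon> \<xi>) \<le> C * \<epsilon> powr (- M) * (1 + norm \<xi>) ^ m" .
    qed
  qed
  then show ?thesis using that MC by blast
qed

text \<open>2 + 2r is at most 4 max(1, r), and 1 <= 1/\<epsilon>. The slow scale condition is taken
  with exponent s, so every power costs the same factor 1/\<epsilon>.\<close>

lemma slow_scale_bound:
  assumes "slow_scale r" "\<forall>\<^sub>F \<epsilon> in at_right 0. 0 < r \<epsilon>"
  shows "\<exists>C\<ge>0. \<forall>\<^sub>F \<epsilon> in at_right 0. (2 + 2 * r \<epsilon>) ^ s \<le> C / \<epsilon>"
proof -
  have "(\<lambda>\<epsilon>. \<bar>r \<epsilon>\<bar> powr real s) \<in> O[at_right 0](\<lambda>\<epsilon>. 1 / \<epsilon>)" using assms(1) by (simp add: slow_scale_def)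
  then obtain C where C: "C > 0" "\<forall>\<^sub>F \<epsilon> in at_right 0. norm (\<bar>r \<epsilon>\<bar> powr real s) \<le> C * norm (1 / \<epsilon>)"
    by (elim landau_o.bigE)
  have "\<forall>\<^sub>F \<epsilon> in at_right 0. (2 + 2 * r \<epsilon>) ^ s \<le> (4 ^ s * (1 + C)) / \<epsilon>"
    using C(2) assms(2) eventually_unit_interval
  proof eventually_elim
    case (elim \<epsilon>)
    have "(2 + 2 * r \<epsilon>) ^ s \<le> (4 * max 1 (r \<epsilon>)) ^ s" using elim(2) by (intro power_mono) auto
    also have "\<dots> = 4 ^ s * max 1 (r \<epsilon>) ^ s" by (rule power_mult_distrib)
    also have "max 1 (r \<epsilon>) ^ s \<le> 1 + r \<epsilon> ^ s" using elim(2) by (auto simp: max_def)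
    also have "r \<epsilon> ^ s \<le> C / \<epsilon>" using elim by (simp add: powr_realpow)
    also have "1 \<le> 1 / \<epsilon>" using elim by simp
    finally show ?case by (simp add: add_divide_distrib distrib_left mult_left_mono)
  qed
  then show ?thesis using C by (intro exI[of _ "4 ^ s * (1 + C)"]) auto
qed

text \<open>The symbol estimates for multi-indices of order one; the sum of the finitely many
  constants serves all coordinates.\<close>

lemma gradient_bound:
  fixes a :: "'n::finite multiindex \<Rightarrow> real \<Rightarrow> complex"
  assumes "0 < \<epsilon>\<^sub>0"
    and "\<And>\<alpha>. \<exists>C>0. \<forall>\<epsilon>\<in>{0<..<\<epsilon>\<^sub>0}. \<forall>\<xi>. norm \<xi> \<ge> r \<epsilon> \<longrightarrow>
           norm (mderiv \<alpha> (symbol_net m a \<epsilon>) \<xi>)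
             \<le> C * norm (symbol_net m a \<epsilon> \<xi>) * (1 + norm \<xi>) powr (- real (mi_order \<alpha>))"
  shows "\<exists>C>0. \<forall>\<^sub>F \<epsilon> in at_right 0. \<forall>i \<xi>. r \<epsilon> \<le> norm \<xi> \<longrightarrow>
        norm (partial i (symbol_net m a \<epsilon>) \<xi>) * (1 + norm \<xi>) \<le> C * norm (symbol_net m a \<epsilon> \<xi>)"
proof -
  have "\<forall>i. \<exists>C>0. \<forall>\<epsilon>\<in>{0<..<\<epsilon>\<^sub>0}. \<forall>\<xi>. norm \<xi> \<ge> r \<epsilon> \<longrightarrow>
      norm (partial i (symbol_net m a \<epsilon>) \<xi>) * (1 + norm \<xi>) \<le> C * norm (symbol_net m a \<epsilon> \<xi>)"
  proof
    fix i :: 'n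
    obtain C where C: "C > 0" "\<And>\<epsilon> \<xi>. \<epsilon> \<in> {0<..<\<epsilon>\<^sub>0} \<Longrightarrow> norm \<xi> \<ge> r \<epsilon> \<Longrightarrow>
        norm (mderiv ((\<lambda>j. 0)(i := 1)) (symbol_net m a \<epsilon>) \<xi>)
          \<le> C * norm (symbol_net m a \<epsilon> \<xi>) * (1 + norm \<xi>) powr (- real (mi_order ((\<lambda>j. 0)(i := 1))))"
      using assms(2) by blast
    have ord: "mi_order ((\<lambda>j. 0)(i := 1)) = 1" by (simp add: mi_order_def)
    have "norm (partial i (symbol_net m a \<epsilon>) \<xi>) * (1 + norm \<xi>) \<le> C * norm (symbol_net m a \<epsilon> \<xi>)"
      if e: "\<epsilon> \<in> {0<..<\<epsilon>\<^sub>0}" "norm \<xi> \<ge> r \<epsilon>" for \<epsilon> \<xi>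
    proof -
      have pos: "0 < 1 + norm \<xi>" by (intro add_pos_nonneg) auto
      have "(1 + norm \<xi>) powr (- real 1) = inverse (1 + norm \<xi>)" using pos by (simp add: powr_minus)
      then have "norm (partial i (symbol_net m a \<epsilon>) \<xi>) \<le> C * norm (symbol_net m a \<epsilon> \<xi>) / (1 + norm \<xi>)"
        using C(2)[OF e] unfolding ord mderiv_single by (simp add: divide_inverse)
      then show ?thesis using pos by (simp add: pos_le_divide_eq)
    qed
    then show "\<exists>C>0. \<forall>\<epsilon>\<in>{0<..<\<epsilon>\<^sub>0}. \<forall>\<xi>. norm \<xi> \<ge> r \<epsilon> \<longrightarrow>
      norm (partial i (symbol_net m a \<epsilon>) \<xi>) * (1 + norm \<xi>) \<le> C * norm (symbol_net m a \<epsilon> \<xi>)" using C(1) by blast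
  qed
  then obtain C where C: "\<And>i. C i > 0" "\<And>i \<epsilon> \<xi>. \<epsilon> \<in> {0<..<\<epsilon>\<^sub>0} \<Longrightarrow> norm \<xi> \<ge> r \<epsilon> \<Longrightarrow>
      norm (partial i (symbol_net m a \<epsilon>) \<xi>) * (1 + norm \<xi>) \<le> C i * norm (symbol_net m a \<epsilon> \<xi>)" by metis
  have Ci: "C i \<le> sum C UNIV" for i using C(1) by (intro member_le_sum) (auto intro: less_imp_le)
  have "\<forall>\<^sub>F \<epsilon> in at_right 0. \<epsilon> \<in> {0<..<\<epsilon>\<^sub>0}" using assms(1) by (rule eventually_at_right_real)
  then have "\<forall>\<^sub>F \<epsilon> in at_right 0. \<forall>i \<xi>. r \<epsilon> \<le> norm \<xi> \<longrightarrow>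
        norm (partial i (symbol_net m a \<epsilon>) \<xi>) * (1 + norm \<xi>) \<le> sum C UNIV * norm (symbol_net m a \<epsilon> \<xi>)"
  proof eventually_elim
    case (elim \<epsilon>)
    show ?case
    proof (intro allI impI)
      fix i and \<xi> :: "real^'n" assume "r \<epsilon> \<le> norm \<xi>"
      from C(2)[OF elim this, of i] mult_right_mono[OF Ci[of i] norm_ge_zero[of "symbol_net m a \<epsilon> \<xi>"]]
      show "norm (partial i (symbol_net m a \<epsilon>) \<xi>) * (1 + norm \<xi>) \<le> sum C UNIV * norm (symbol_net m a \<epsilon> \<xi>)"
        by (rule order_trans)
    qed
  qed
  moreover have "sum C UNIV > 0" using C(1) by (intro sum_pos) auto
  ultimately show ?thesis by blast
qed

text \<open>The net \<open>g\<close> is \<open>f\<close> plus a difference of two negligible nets,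
  whose derivatives are bounded on \<open>K\<close> by the choice q = 0. A bounded net is
  O(\<epsilon>^(-p)) for every p >= 0, so the exponent of \<open>f\<close> is kept. The net
  \<open>h\<close> plays the part of the representative by which the class is given.\<close>

lemma regular_net_diff_negligible:
  assumes \<Omega>: "open \<Omega>" and f: "f \<in> regular_nets \<Omega>" and g: "g \<in> moderate_nets \<Omega>"
    and h: "h \<in> moderate_nets \<Omega>" "(\<lambda>\<epsilon> x. h \<epsilon> x - f \<epsilon> x) \<in> negligible_nets \<Omega>"
      "(\<lambda>\<epsilon> x. h \<epsilon> x - g \<epsilon> x) \<in> negligible_nets \<Omega>"
  shows "g \<in> regular_nets \<Omega>"
proof -
  have sm: "f \<in> smooth_nets \<Omega>" "g \<in> smooth_nets \<Omega>" "(\<lambda>\<epsilon> x. h \<epsilon> x - f \<epsilon> x) \<in> smooth_nets \<Omega>"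
    "(\<lambda>\<epsilon> x. h \<epsilon> x - g \<epsilon> x) \<in> smooth_nets \<Omega>"
    using f g h by (auto simp: regular_nets_def moderate_nets_def negligible_nets_def)
  have "\<exists>p\<ge>0. \<forall>\<alpha>. (\<lambda>\<epsilon>. sup_on K (mderiv \<alpha> (g \<epsilon>))) \<in> O[at_right 0](\<lambda>\<epsilon>. \<epsilon> powr (- p))" if K: "K \<in> compacts_in \<Omega>" for K
  proof -
    obtain p where p: "p \<ge> 0" "\<And>\<alpha>. (\<lambda>\<epsilon>. sup_on K (mderiv \<alpha> (f \<epsilon>))) \<in> O[at_right 0](\<lambda>\<epsilon>. \<epsilon> powr (- p))"
      using f K unfolding regular_nets_def by blast
    have "(\<lambda>\<epsilon>. sup_on K (mderiv \<alpha> (g \<epsilon>))) \<in> O[at_right 0](\<lambda>\<epsilon>. \<epsilon> powr (- p))" for \<alpha>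
    proof -
      obtain C1 where C1: "C1 \<ge> 0" "\<forall>\<^sub>F \<epsilon> in at_right 0. \<forall>x\<in>K. norm (mderiv \<alpha> (f \<epsilon>) x) \<le> C1 * \<epsilon> powr (- p)"
        using p(2)[of \<alpha>] unfolding sup_on_bigo_iff[OF sm(1) K] by blast
      obtain C2 where C2: "C2 \<ge> 0" "\<forall>\<^sub>F \<epsilon> in at_right 0. \<forall>x\<in>K. norm (mderiv \<alpha> (\<lambda>x. h \<epsilon> x - f \<epsilon> x) x) \<le> C2 * \<epsilon> powr 0"
        using h(2) K sup_on_bigo_iff[OF sm(3) K, of \<alpha> 0] unfolding negligible_nets_def by blast
      obtain C3 where C3: "C3 \<ge> 0" "\<forall>\<^sub>F \<epsilon> in at_right 0. \<forall>x\<in>K. norm (mderiv \<alpha> (\<lambda>x. h \<epsilon> x - g \<epsilon> x) x) \<le> C3 * \<epsilon> powr 0"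
        using h(3) K sup_on_bigo_iff[OF sm(4) K, of \<alpha> 0] unfolding negligible_nets_def by blast
      have "\<forall>\<^sub>F \<epsilon> in at_right 0. \<forall>x\<in>K. norm (mderiv \<alpha> (g \<epsilon>) x) \<le> (C1 + C2 + C3) * \<epsilon> powr (- p)"
        using C1(2) C2(2) C3(2) eventually_unit_interval
      proof eventually_elim
        case (elim \<epsilon>)
        \<comment> \<open>The identity g = f + (h - f) - (h - g), in the form that
          \<open>mderiv_lincomb\<close> accepts.\<close>
        define c :: "nat \<Rightarrow> complex" where "c j = (if j = 2 then - 1 else 1)" for j
        define F where "F j = (if j = 0 then f \<epsilon> else if j = 1 then (\<lambda>x. h \<epsilon> x - f \<epsilon> x) else (\<lambda>x. h \<epsilon> x - g \<epsilon> x))" for j :: nat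
        have F: "smooth_on \<Omega> (F j)" for j using sm elim(4) unfolding smooth_nets_def F_def by auto
        have gF: "g \<epsilon> = (\<lambda>x. \<Sum>j\<in>{0,1,2}. c j * F j x)" by (auto simp: c_def F_def)
        have e1: "1 \<le> \<epsilon> powr (- p)" using elim(4) p(1) powr_mono'[of "- p" 0 \<epsilon>] by simp
        show ?case
        proof
          fix x assume x: "x \<in> K"
          then have x\<Omega>: "x \<in> \<Omega>" using K by (auto simp: compacts_in_def)
          have "mderiv \<alpha> (g \<epsilon>) x = (\<Sum>j\<in>{0,1,2}. c j * mderiv \<alpha> (F j) x)"
            unfolding gF by (rule mderiv_lincomb[OF \<Omega> F x\<Omega>])
          also have "\<dots> = mderiv \<alpha> (f \<epsilon>) x + (mderiv \<alpha> (\<lambda>x. h \<epsilon> x - f \<epsilon> x) x - mderiv \<alpha> (\<lambda>x. h \<epsilon> x - g \<epsilon> x) x)"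
            by (simp add: c_def F_def)
          also have "norm \<dots> \<le> C1 * \<epsilon> powr (- p) + (C2 * 1 + C3 * 1)"
            using elim x by (intro norm_triangle_le norm_triangle_le_diff add_mono) auto
          also have "\<dots> \<le> C1 * \<epsilon> powr (- p) + (C2 * \<epsilon> powr (- p) + C3 * \<epsilon> powr (- p))"
            using e1 C1(1) C2(1) C3(1) by (intro add_mono mult_left_mono) auto
          finally show "norm (mderiv \<alpha> (g \<epsilon>) x) \<le> (C1 + C2 + C3) * \<epsilon> powr (- p)" by (simp add: algebra_simps)
        qed
      qed
      then show ?thesis unfolding sup_on_bigo_iff[OF sm(2) K] using C1 C2 C3
        by (intro exI[of _ "C1 + C2 + C3"]) auto
    qed
    then show ?thesis using p(1) by blast
  qed
  then show ?thesis using g unfolding regular_nets_def by blast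
qed

text \<open>A finite subcover of \<open>K\<close> turns the local exponents into their sum. The
  cover and the exponent are fixed before \<alpha>; only the constants depend on it.\<close>

lemma regular_of_local:
  assumes u: "u \<in> moderate_nets \<Omega>"
    and loc: "\<And>z. z \<in> \<Omega> \<Longrightarrow> \<exists>\<rho>>0. \<exists>p\<ge>0. \<forall>\<alpha>. \<exists>C\<ge>0. \<forall>\<^sub>F \<epsilon> in at_right 0. \<forall>x\<in>ball z \<rho>.
        norm (mderiv \<alpha> (u \<epsilon>) x) \<le> C * \<epsilon> powr (- p)"
  shows "u \<in> regular_nets \<Omega>"
proof -
  have su: "u \<in> smooth_nets \<Omega>" using u by (simp add: moderate_nets_def)
  define Q where "Q z \<rho> p \<longleftrightarrow> \<rho> > 0 \<and> p \<ge> 0 \<and> (\<forall>\<alpha>. \<exists>C\<ge>0. \<forall>\<^sub>F \<epsilon> in at_right 0. \<forall>x\<in>ball z \<rho>.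
        norm (mderiv \<alpha> (u \<epsilon>) x) \<le> C * \<epsilon> powr (- p))" for z \<rho> p
  have "\<forall>z\<in>\<Omega>. \<exists>\<rho> p. Q z \<rho> p" using loc unfolding Q_def by blast
  then obtain \<rho> p where "\<forall>z\<in>\<Omega>. Q z (\<rho> z) (p z)" by metis
  then have Q: "\<And>z. z \<in> \<Omega> \<Longrightarrow> \<rho> z > 0" "\<And>z. z \<in> \<Omega> \<Longrightarrow> p z \<ge> 0"
    "\<And>z \<alpha>. z \<in> \<Omega> \<Longrightarrow> \<exists>C\<ge>0. \<forall>\<^sub>F \<epsilon> in at_right 0. \<forall>x\<in>ball z (\<rho> z). norm (mderiv \<alpha> (u \<epsilon>) x) \<le> C * \<epsilon> powr (- p z)"
    unfolding Q_def by blast+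
  have "\<exists>p\<ge>0. \<forall>\<alpha>. (\<lambda>\<epsilon>. sup_on K (mderiv \<alpha> (u \<epsilon>))) \<in> O[at_right 0](\<lambda>\<epsilon>. \<epsilon> powr (- p))" if K: "K \<in> compacts_in \<Omega>" for K
  proof -
    have Kc: "compact K" "K \<subseteq> \<Omega>" using K by (auto simp: compacts_in_def)
    have "K \<subseteq> (\<Union>z\<in>K. ball z (\<rho> z))" using Q(1) Kc(2) by force
    then obtain T where T: "T \<subseteq> K" "finite T" "K \<subseteq> (\<Union>z\<in>T. ball z (\<rho> z))"
      by (rule compactE_image[OF Kc(1), rotated]) auto
    define P where "P = sum p T"
    have T\<Omega>: "z \<in> \<Omega>" if "z \<in> T" for z using that T Kc by blast
    have P: "P \<ge> 0" "\<And>z. z \<in> T \<Longrightarrow> p z \<le> P"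
      unfolding P_def using Q(2) T\<Omega> T(2) by (auto intro!: sum_nonneg member_le_sum)
    have "(\<lambda>\<epsilon>. sup_on K (mderiv \<alpha> (u \<epsilon>))) \<in> O[at_right 0](\<lambda>\<epsilon>. \<epsilon> powr (- P))" for \<alpha>
    proof -
      have "\<forall>z\<in>T. \<exists>C. C \<ge> 0 \<and> (\<forall>\<^sub>F \<epsilon> in at_right 0. \<forall>x\<in>ball z (\<rho> z). norm (mderiv \<alpha> (u \<epsilon>) x) \<le> C * \<epsilon> powr (- p z))"
        using Q(3) T\<Omega> by blast
      from bchoice[OF this] obtain C where C: "\<And>z. z \<in> T \<Longrightarrow> C z \<ge> 0" "\<And>z. z \<in> T \<Longrightarrow>
          \<forall>\<^sub>F \<epsilon> in at_right 0. \<forall>x\<in>ball z (\<rho> z). norm (mderiv \<alpha> (u \<epsilon>) x) \<le> C z * \<epsilon> powr (- p z)" by blast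
      have "\<forall>\<^sub>F \<epsilon> in at_right 0. \<forall>z\<in>T. \<forall>x\<in>ball z (\<rho> z). norm (mderiv \<alpha> (u \<epsilon>) x) \<le> C z * \<epsilon> powr (- p z)"
        using T(2) C(2) by (intro eventually_ball_finite[of T] ballI)
      then have "\<forall>\<^sub>F \<epsilon> in at_right 0. \<forall>x\<in>K. norm (mderiv \<alpha> (u \<epsilon>) x) \<le> sum C T * \<epsilon> powr (- P)"
        using eventually_unit_interval
      proof eventually_elim
        case (elim \<epsilon>)
        show ?case
        proof
          fix x assume "x \<in> K"
          then obtain z where z: "z \<in> T" "x \<in> ball z (\<rho> z)" using T(3) by blast
          then have "norm (mderiv \<alpha> (u \<epsilon>) x) \<le> C z * \<epsilon> powr (- p z)" using elim(1) by blast
          also have "\<dots> \<le> sum C T * \<epsilon> powr (- P)"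
            using z C(1) T(2) P elim(2) by (intro mult_mono member_le_sum powr_mono' sum_nonneg) auto
          finally show "norm (mderiv \<alpha> (u \<epsilon>) x) \<le> sum C T * \<epsilon> powr (- P)" .
        qed
      qed
      moreover have "sum C T \<ge> 0" using C(1) by (intro sum_nonneg)
      ultimately show ?thesis unfolding sup_on_bigo_iff[OF su K] by blast
    qed
    then show ?thesis using P(1) by blast
  qed
  then show ?thesis using u unfolding regular_nets_def by blast
qed

text \<open>The theorem for representatives: around each point of \<Omega> a small ball satisfies
  the assumptions of \<open>regularity_on_ball\<close>, and the resulting exponent
  \<open>p + N\<close> is free of \<alpha>.\<close>

lemma regular_of_pdo_regular:
  fixes \<Omega> :: "(real ^ 'n::finite) set"
  assumes \<Omega>: "open \<Omega>" and u: "u \<in> moderate_nets \<Omega>"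
    and a: "\<And>\<gamma>. mi_order \<gamma> \<le> m \<Longrightarrow> a \<gamma> \<in> moderate_numbers"
    and wh: "WH_elliptic_net m a r" and slow: "slow_scale r"
    and reg: "pdo_net m a u \<in> regular_nets \<Omega>"
  shows "u \<in> regular_nets \<Omega>"
proof (rule regular_of_local[OF u])
  fix z assume z: "z \<in> \<Omega>"
  from wh[unfolded WH_elliptic_net_def] obtain N \<epsilon>\<^sub>0 where wh':
    "N > 0 \<and> \<epsilon>\<^sub>0 > 0 \<and> \<epsilon>\<^sub>0 \<le> 1 \<and>
        (\<forall>\<epsilon>\<in>{0<..<\<epsilon>\<^sub>0}. r \<epsilon> > 0) \<and>
        (\<forall>\<epsilon>\<in>{0<..<\<epsilon>\<^sub>0}. \<forall>\<xi>. norm \<xi> \<ge> r \<epsilon> \<longrightarrow>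
           norm (symbol_net m a \<epsilon> \<xi>) \<ge> \<epsilon> powr N * (1 + norm \<xi>) ^ m) \<and>
        (\<forall>\<alpha>. \<exists>C>0. \<forall>\<epsilon>\<in>{0<..<\<epsilon>\<^sub>0}. \<forall>\<xi>. norm \<xi> \<ge> r \<epsilon> \<longrightarrow>
           norm (mderiv \<alpha> (symbol_net m a \<epsilon>) \<xi>)
             \<le> C * norm (symbol_net m a \<epsilon> \<xi>) * (1 + norm \<xi>) powr (- real (mi_order \<alpha>)))"
    by (elim exE conjE) (rule that, intro conjI)
  note N = conjunct1[OF wh'] conjunct1[OF conjunct2[OF wh']]
    bspec[OF conjunct1[OF conjunct2[OF conjunct2[OF conjunct2[OF wh']]]]]
    bspec[OF conjunct1[OF conjunct2[OF conjunct2[OF conjunct2[OF conjunct2[OF wh']]]]], rule_format]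
    spec[OF conjunct2[OF conjunct2[OF conjunct2[OF conjunct2[OF conjunct2[OF wh']]]]]]
  have ev: "\<forall>\<^sub>F \<epsilon> in at_right 0. \<epsilon> \<in> {0<..<\<epsilon>\<^sub>0}" using N(2) by (rule eventually_at_right_real)
  have rad: "\<forall>\<^sub>F \<epsilon> in at_right 0. 0 < r \<epsilon>" using ev by eventually_elim (rule N(3))
  obtain d0 where d0: "0 < d0" "cball z d0 \<subseteq> \<Omega>" using \<Omega> z open_contains_cball by blast
  \<comment> \<open>The ball has to lie in \<Omega> and to have radius below 1.\<close>
  define \<delta> where "\<delta> = min d0 (1/2)"
  have \<delta>: "0 < \<delta>" "\<delta> < 1" "cball z \<delta> \<subseteq> \<Omega>" using d0 by (auto simp: \<delta>_def)
  have K: "cball z \<delta> \<in> compacts_in \<Omega>" using \<delta> by (auto simp: compacts_in_def)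
  obtain M CM where M: "M \<ge> 0" "CM \<ge> 0" "\<forall>\<^sub>F \<epsilon> in at_right 0. \<forall>\<xi>.
        norm (symbol_net m a \<epsilon> \<xi>) \<le> CM * \<epsilon> powr (- M) * (1 + norm \<xi>) ^ m"
    by (rule symbol_net_bound[of m a, OF a])
  \<comment> \<open>The zero multi-index is the zeroth power of the derivative in an arbitrary
    direction, for which \<open>undefined\<close> is taken.\<close>
  have m0: "mderiv (\<lambda>_. 0) f = f" for f :: "real^'n \<Rightarrow> complex"
  proof -
    have "(\<lambda>_ :: 'n. 0 :: nat)(undefined := 0) = (\<lambda>_. 0)" by (rule fun_upd_idem) simp
    then show ?thesis using mderiv_single[of undefined 0 f] by simp
  qed
  obtain p0 C0 where p0: "p0 \<ge> 0" "C0 \<ge> 0" "\<forall>\<^sub>F \<epsilon> in at_right 0. \<forall>x\<in>cball z \<delta>. norm (u \<epsilon> x) \<le> C0 * \<epsilon> powr (- p0)"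
  proof -
    have "poly_bounded (cball z \<delta>) (\<lambda>\<epsilon>. mderiv (\<lambda>_. 0) (u \<epsilon>))" using u K unfolding moderate_nets_iff by blast
    then show ?thesis using that unfolding m0 poly_bounded_def by blast
  qed
  have sm: "pdo_net m a u \<in> smooth_nets \<Omega>" using reg by (simp add: regular_nets_def moderate_nets_def)
  obtain pf where pf: "pf \<ge> 0" "\<And>\<alpha>. (\<lambda>\<epsilon>. sup_on (cball z \<delta>) (mderiv \<alpha> (pdo_net m a u \<epsilon>))) \<in> O[at_right 0](\<lambda>\<epsilon>. \<epsilon> powr (- pf))"
    using reg K unfolding regular_nets_def by blast
  interpret regularity_on_ball \<Omega> z \<delta> u m a r M p0 pf N
  proof
    show "\<forall>\<^sub>F \<epsilon> in at_right 0. smooth_on \<Omega> (u \<epsilon>)"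
      using eventually_unit_interval by eventually_elim (use u in \<open>auto simp: moderate_nets_iff smooth_nets_def\<close>)
    show "\<exists>C\<ge>0. \<forall>\<^sub>F \<epsilon> in at_right 0. \<forall>x\<in>cball z \<delta>. norm ((partial i ^^ j) (pdo_net m a u \<epsilon>) x) \<le> C * \<epsilon> powr (- pf)" for i j
      using iffD1[OF sup_on_bigo_iff[OF sm K] pf(2), of "(\<lambda>_. 0)(i := j)"] unfolding mderiv_single .
    show "\<exists>C>0. \<forall>\<^sub>F \<epsilon> in at_right 0. \<forall>i \<xi>. r \<epsilon> \<le> norm \<xi> \<longrightarrow>
        norm (partial i (symbol_net m a \<epsilon>) \<xi>) * (1 + norm \<xi>) \<le> C * norm (symbol_net m a \<epsilon> \<xi>)"
      using N(2,5) by (rule gradient_bound)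
    show "\<forall>\<^sub>F \<epsilon> in at_right 0. \<forall>\<xi>. r \<epsilon> \<le> norm \<xi> \<longrightarrow> \<epsilon> powr N * (1 + norm \<xi>) ^ m \<le> norm (symbol_net m a \<epsilon> \<xi>)"
      using ev by eventually_elim (use N(4) in blast)
    show "\<exists>C\<ge>0. \<forall>\<^sub>F \<epsilon> in at_right 0. (2 + 2 * r \<epsilon>) ^ s \<le> C / \<epsilon>" for s
      using slow rad by (rule slow_scale_bound)
    show "\<exists>C\<ge>0. \<forall>\<^sub>F \<epsilon> in at_right 0. \<forall>x\<in>cball z \<delta>. norm (u \<epsilon> x) \<le> C * \<epsilon> powr (- p0)" using p0 by blast
    show "\<exists>C\<ge>0. \<forall>\<^sub>F \<epsilon> in at_right 0. \<forall>\<xi>. norm (symbol_net m a \<epsilon> \<xi>) \<le> C * \<epsilon> powr (- M) * (1 + norm \<xi>) ^ m" using M by blast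
  qed (use \<Omega> \<delta> M p0 pf N rad in auto)
  have "0 \<le> p + N" using exponents by (auto simp: p_def)
  then show "\<exists>\<rho>>0. \<exists>p\<ge>0. \<forall>\<alpha>. \<exists>C\<ge>0. \<forall>\<^sub>F \<epsilon> in at_right 0. \<forall>x\<in>ball z \<rho>. norm (mderiv \<alpha> (u \<epsilon>) x) \<le> C * \<epsilon> powr (- p)"
    using mderiv_bound \<delta>(1) by (intro exI[of _ "\<delta> / 2"] conjI exI[of _ "p + N"]) auto
qed

theorem theorem5p5:
  fixes \<Omega> :: "(real ^ 'n::finite) set"
    and m :: nat
    and A :: "'n multiindex \<Rightarrow> (real \<Rightarrow> complex) set"
    and r :: "real \<Rightarrow> real"
    and F U :: "'n fun_net set"
  assumes "open \<Omega>"
    and "\<And>\<gamma>. mi_order \<gamma> \<le> m \<Longrightarrow> A \<gamma> \<in> gen_complex"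
    and "WH_elliptic m A r"
    and "slow_scale r"
    and "F \<in> colombeau_regular \<Omega>"
    and "U \<in> colombeau \<Omega>"
    and "gen_pdo \<Omega> m A U = F"
  shows "U \<in> colombeau_regular \<Omega>"
proof -
  obtain a where a: "a \<in> coeff_reps m A" "WH_elliptic_net m a r"
    using assms(3) unfolding WH_elliptic_def by blast
  have am: "a \<gamma> \<in> moderate_numbers" if "mi_order \<gamma> \<le> m" for \<gamma>
    using coeff_reps_moderate[OF a(1) assms(2)] that by blast
  obtain u where u: "u \<in> moderate_nets \<Omega>" "U = colombeau_rel \<Omega> `` {u}"
    using assms(6) by (rule mem_colombeau_class)
  have uU: "u \<in> U" using colombeau_rel_refl[OF assms(1) u(1)] u(2) by simp
  define g where "g = pdo_net m a u"
  have g: "g \<in> moderate_nets \<Omega>" unfolding g_def using assms(1) u(1) am by (rule pdo_net_moderate)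
  \<comment> \<open>The class of \<open>g\<close> is one of the sets in the union that defines
    \<open>gen_pdo\<close>, and \<open>g\<close> belongs to it by reflexivity.\<close>
  have gF: "g \<in> F"
    using colombeau_rel_refl[OF assms(1) g] a(1) uU unfolding assms(7)[symmetric] gen_pdo_def g_def by blast
  obtain f where f: "f \<in> F" "f \<in> regular_nets \<Omega>" "F \<in> colombeau \<Omega>"
    using assms(5) unfolding colombeau_regular_def by blast
  obtain h where h: "h \<in> moderate_nets \<Omega>" "F = colombeau_rel \<Omega> `` {h}"
    using f(3) by (rule mem_colombeau_class)
  \<comment> \<open>\<open>f\<close> and \<open>g\<close> lie in one class, so the regularity of
    \<open>f\<close> passes to \<open>g\<close>, the representative computed from
    \<open>u\<close>.\<close>
  have "g \<in> regular_nets \<Omega>"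
    using assms(1) f(2) g h(1)
    by (rule regular_net_diff_negligible) (use f(1) gF h(2) in \<open>auto simp: colombeau_rel_def\<close>)
  from regular_of_pdo_regular[OF assms(1) u(1) am a(2) assms(4) this[unfolded g_def]]
  have "u \<in> regular_nets \<Omega>" .
  then show ?thesis using assms(6) uU unfolding colombeau_regular_def by blast
qed

end
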